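(* (a) (From $S$-machine to $S$-graph) Let $\mathcal S$ be an $S$-machine over the hardware $\mathcal H$. Then there exists an $S$-graph $\mathcal G(\mathcal S)=(S_{\mathcal H},E)$ over the $S$-graph hardware $\mathcal G(\mathcal H)$ (namely the one constructed in the context), with $E=\bigsqcup_{\tau\in\mathcal S}E_\tau$, which "simulates" $\mathcal S$ in the following sense: (i) For any computation $\varepsilon=(w_0,\tau_1,w_1,\dots,\tau_n,w_n)$ of $\mathcal S$, there exists a unique computation $\varphi_{\mathcal G(\mathcal S)}(\varepsilon)=\bigl(\mu_{\mathcal H}(w_0),e_1,\mu_{\mathcal H}(w_1),\dots,e_n,\mu_{\mathcal H}(w_n)\bigr)$ of $\mathcal G(\mathcal S)$ such that $e_i\in E_{\tau_i}$ for all $i\in\{1,\dots,n\}$. (ii) For any computation $\delta=\bigl((w_0,s_0),e_1,(w_1,s_1),\dots,e_n,(w_n,s_n)\bigr)$ of $\mathcal G(\mathcal S)$, there exists a computation $\varphi_{\mathcal S}(\delta)=\bigl(\mu_{\mathcal H}^{-1}(w_0,s_0),\tau_1,\mu_{\mathcal H}^{-1}(w_1,s_1),\dots,\tau_n,\mu_{\mathcal H}^{-1}(w_n,s_n)\bigr)$ of $\mathcal S$, where $\tau_i$ is the (unique) $S$-rule of $\mathcal S$ satisfying $e_i\in E_{\tau_i}$. (b) (From $S$-graph to $S$-machine) Let $\mathcal G=(S_{\mathcal G},E_{\mathcal G})$ be an $S$-graph over the hardware $\mathcal H=(\mathcal I,\mathcal A)$ and let $\eta:\mathcal I\to\{1,\dots,N\}$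 be a bijection. Then there exists an $S$-machine $\mathcal S(\mathcal G,\eta)$ over the hardware $\mathcal S_{\mathcal G,\eta}(\mathcal H)$ (namely the one constructed in the context) which "simulates" $\mathcal G$ in the following sense: (i) There is a bijection $\phi$ between the $S$-rules of $\mathcal S(\mathcal G,\eta)$ and the edges $E_{\mathcal G}$. (ii) For any computation $\varepsilon=(w_0,\tau_1,w_1,\dots,\tau_n,w_n)$ of $\mathcal S(\mathcal G,\eta)$, there exists a computation $\psi_{\mathcal G,\eta}(\varepsilon)=\bigl(\mu_{\mathcal G,\eta}(w_0),\phi(\tau_1),\mu_{\mathcal G,\eta}(w_1),\dots,\phi(\tau_n),\mu_{\mathcal G,\eta}(w_n)\bigr)$ of $\mathcal G$. (iii) For any computation $\delta=\bigl((w_0,s_0),e_1,(w_1,s_1),\dots,e_n,(w_n,s_n)\bigr)$ of $\mathcal G$, there exists a computation $\psi_{\mathcal S(\mathcal G,\eta)}(\delta)=\bigl(\mu_{\mathcal G,\eta}^{-1}(w_0,s_0),\tau_1,\mu_{\mathcal G,\eta}^{-1}(w_1,s_1),\dots,\tau_n,\mu_{\mathcal G,\eta}^{-1}(w_n,s_n)\bigr)$ of $\mathcal S(\mathcal G,\eta)$, where $\tau_i=\phi^{-1}(e_i)$ for all $i$. (c) (Partial duality) Let $\mathcal G'$ be an $S$-graph over the hardware $\mathcal H=(\mathcal I,\mathcal A)$. Then for any enumeration (bijection) $\eta:\mathcal I\to\{1,\dots,N\}$, $\mathcal G(\mathcal S(\mathcal G',\eta))\cong\mathcal G'$.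
   Context: $F(X)$ denotes the set of freely reduced group words over $X\sqcup X^{-1}$. **$S$-machines.** A hardware is $\mathcal H=(Y,Q)$ with finite sets $Y_1,\dots,Y_N$ (not necessarily disjoint) and finite pairwise disjoint sets $Q_1,\dots,Q_{N+1}$ disjoint from $\bigcup Y_i$; put $Y_0=Y_{N+1}=\emptyset$. Admissible words: $L_{\mathcal H}=Q_1F(Y_1)Q_2\cdots F(Y_N)Q_{N+1}$. For $l\le r$, $L^{l,r}_{\mathcal H}$ is the set of subwords of admissible words that start with a letter of $Q_l$ and end with a letter of $Q_r$. An $S$-rule is $\tau=[U_1\to V_1,\dots,U_M\to V_M]$ with $U_t\in L_{\mathcal H}^{l_t,r_t}$, $V_t\in F(Y_{l_t-1})L_{\mathcal H}^{l_t,r_t}F(Y_{r_t})$, and $r_i<l_j$ for $i<j$. If $V_t=x_tU_t'y_t$ with $x_t\in F(Y_{l_t-1})$, $U'_t\in L^{l_t,r_t}_{\mathcal H}$, $y_t\in F(Y_{r_t})$, then $\tau^{-1}=[U_t'\to x_t^{-1}U_ty_t^{-1}]_t$. $\tau$ is applicable to $w\in L_{\mathcal H}$ if each $U_t$ is a subword of $w$; then $w\cdot\tau$ is obtained by simultaneously replacing each $U_t$ by $V_t$ and freely reducing. An $S$-machine over $\mathcal H$ is a finite set of $S$-rules closed under inverses. A computation is $(w_0,\tau_1,w_1,\dots,\tau_n,w_n)$, $n\ge0$, with $w_i=w_{i-1}\cdot\tau_i$, where each $w_i$ is admissible and each $\tau_i$ is a rule of the machine. **$S$-graphs.** An $S$-graph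 hardware is $\mathcal H=(\mathcal I,\mathcal A)$ with a finite index set $\mathcal I$ and finite alphabets $\mathcal A=(A_i)_{i\in\mathcal I}$. Put $L_i=F(A_i)$, $L_{\mathcal H}=\prod_{i\in\mathcal I}L_i$. An action is a pair $(t,g)$: the transformation $t$ assigns to each $i$ elements $t_i^l,t_i^r\in L_i$ (left and right multipliers) and acts by $t(w)=(t_i^lw_it_i^r)_i$ (freely reduced); the guard $g$ assigns to each $i$ an element of $L_i$ or the symbol NA; $g$ accepts $w$ if for every $i$, $g(i)=\mathrm{NA}$ or $g(i)=w_i$. The inverse action $(t,g)^{-1}=(t',g')$ has $t'^l_i=(t_i^l)^{-1}$, $t'^r_i=(t_i^r)^{-1}$, $g'(i)=\mathrm{NA}$ if $g(i)=\mathrm{NA}$ and $g'(i)=t_i^lg(i)t_i^r$ otherwise. An $S$-graph over $\mathcal H$ is a finite directed graph $(S,E)$ (loops and multiple edges allowed) with edges labelled by actions over $\mathcal H$, an edge being written $e=(s_1,s_2,t,g)$ (tail, head, action), such that for each edge $e$ the inverse edge $e^{-1}=(s_2,s_1,(t,g)^{-1})$ is in $E$. Elements of $S$ are called states. A configuration is $(w,s)\in L_{\mathcal H}\times S$; $e=(s_1,s_2,t,g)$ is applicable to it if $s=s_1$ and $g$ accepts $w$, with result $(t(w),s_2)$. A computation is a sequence $((w_0,s_0),e_1,\dots,e_n,(w_n,s_n))$, $n\ge0$, in which $(w_i,s_i)$ is the result of applying $e_i$ to $(w_{i-1},s_{i-1})$. Two $S$-graphs are isomorphic, $\mathcal G\cong\mathcal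 G'$, if one can pass from $\mathcal G$ to $\mathcal G'$ simply by renaming the states and by reindexing; i.e. there are bijections between their states and between the index sets of their hardwares which make the graphs identical (letters of the alphabets are not renamed). **Correspondences.** For an $S$-machine hardware $\mathcal H=(Y,Q)$: $\mathcal G(\mathcal H)=(\{1,\dots,N\},(Y_i)_{i=1}^N)$, $S_{\mathcal H}=\prod_{i=1}^{N+1}Q_i$, and $\mu_{\mathcal H}:L_{\mathcal H}\to L_{\mathcal G(\mathcal H)}\times S_{\mathcal H}$ is the bijection $\mu_{\mathcal H}(q_1w_1q_2\cdots w_Nq_{N+1})=((w_i)_i,(q_i)_i)$. For an $S$-graph $\mathcal G=(S_{\mathcal G},E_{\mathcal G})$ over $\mathcal H=(\mathcal I,\mathcal A)$ with $|\mathcal I|=N$ and a bijection $\eta:\mathcal I\to\{1,\dots,N\}$: $\mathcal S_{\mathcal G,\eta}(\mathcal H)$ is the $S$-machine hardware with $Y_i=A_{\eta^{-1}(i)}$, $Q_1=S_{\mathcal G}$, $Q_j=\{q_j^*\}$ for $2\le j\le N+1$, and $\mu_{\mathcal G,\eta}$ is the bijection from its admissible words to $L_{\mathcal H}\times S_{\mathcal G}$ given by $\mu_{\mathcal G,\eta}(q_1w_1q_2\cdots w_Nq_{N+1})=((w_{\eta(i)})_{i\in\mathcal I},q_1)$. **Construction of $\mathcal G(\mathcal S)$.** For $\tau=[U_t\to v_t^{l_t-1}V_tv_t^{r_t}]_{t=1}^M\in\mathcal S$ with $U_t=q_t^{l_t}u_t^{l_t}q_t^{l_t+1}\cdots u_t^{r_t-1}q_t^{r_t}$,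 $V_t=p_t^{l_t}v_t^{l_t}p_t^{l_t+1}\cdots v_t^{r_t-1}p_t^{r_t}$ ($q_t^j,p_t^j\in Q_j$, $u_t^j,v_t^j\in F(Y_j)$), let $(t_\tau,g_\tau)$ be the action over $\mathcal G(\mathcal H)$ that, for each $t$: has, at each index $i$ with $l_t\le i\le r_t-1$, guard $u_t^i$ and left multiplier $v_t^i(u_t^i)^{-1}$; has left multiplier $v_t^{r_t}$ at index $r_t$ (if $r_t\le N$); has right multiplier $v_t^{l_t-1}$ at index $l_t-1$ (if $l_t\ge2$); all other multipliers are trivial and all other guards are NA. Let $I_\tau=\bigsqcup_t\{l_t,\dots,r_t\}$ and let $J_\tau$ be its complement in $\{1,\dots,N+1\}$. $E_\tau$ consists of one edge for each $\theta\in\prod_{j\in J_\tau}Q_j$, labelled $(t_\tau,g_\tau)$, from the state given by $\theta$ on $J_\tau$ and the letters $q_t^j$ on $I_\tau$ to the state given by $\theta$ on $J_\tau$ and the letters $p_t^j$ on $I_\tau$. **Construction of $\mathcal S(\mathcal G,\eta)$.** For an edge $e=(s_1,s_2,t,g)$ write $g_j=g(\eta^{-1}(j))$ and $t_j^l,t_j^r$ for the multipliers at $\eta^{-1}(j)$ ($t_0^r$ and $t_{N+1}^l$ are trivial). Split $\{1,\dots,N+1\}$ into the maximal intervals $\{l_i,\dots,r_i\}$, $i=1,\dots,M$ (in increasing order, single points allowed), such that $g_j\ne\mathrm{NA}$ for $l_i\le j\le r_i-1$. Put $\gamma_1=s_1$, $\gamma_1'=s_2$, $\gamma_j=\gamma_j'=q_j^*$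 for $j\ge2$. Then $\tau_e=[U_i\to t^r_{l_i-1}V_it^l_{r_i}]_{i=1}^M$ with $U_i=\gamma_{l_i}g_{l_i}\gamma_{l_i+1}\cdots g_{r_i-1}\gamma_{r_i}$ and $V_i=\gamma'_{l_i}\,t^l_{l_i}g_{l_i}t^r_{l_i}\,\gamma'_{l_i+1}\cdots t^l_{r_i-1}g_{r_i-1}t^r_{r_i-1}\,\gamma'_{r_i}$. The machine is $\mathcal S(\mathcal G,\eta)=\{\tau_e\mid e\in E_{\mathcal G}\}$, and $\phi(\tau_e)=e$.
   Formalization: In (c) actions are compared at guarded indices only via t^l g t^r; literal isomorphism is proved if right multipliers there are trivial (necessary). In (b) each rule τ_e is labelled by its edge e, since parallel or equivalent edges give equal rules; otherwise unlabelled rules are shown distinct. *)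

theory Defs
  imports Main "HOL-Library.FuncSet" "HOL-Library.Sublist" "HOL-Library.Disjoint_Sets"
begin

section \<open>Group words\<close>

text \<open>\<^term>\<open>(x, True)\<close> is the letter \<open>x\<close> and \<^term>\<open>(x, False)\<close> is its formal inverse.\<close>

type_synonym 'x gword = "('x \<times> bool) list"

definition cancels :: "'x \<times> bool \<Rightarrow> 'x \<times> bool \<Rightarrow> bool" where
  "cancels a b \<longleftrightarrow> fst a = fst b \<and> snd a \<noteq> snd b"

definition reduced :: "'x gword \<Rightarrow> bool" where
  "reduced w \<longleftrightarrow> successively (\<lambda>a b. \<not> cancels a b) w"

definition Free :: "'x set \<Rightarrow> 'x gword set" where
  "Free X = {w. fst ` set w \<subseteq> X \<and> reduced w}"

fun push_letter :: "'x \<times> bool \<Rightarrow> 'x gword \<Rightarrow> 'x gword" where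
  "push_letter a [] = [a]"
| "push_letter a (b # w) = (if cancels a b then w else a # b # w)"

definition free_red :: "'x gword \<Rightarrow> 'x gword" where
  "free_red w = foldr push_letter w []"

definition winv :: "'x gword \<Rightarrow> 'x gword" where
  "winv w = rev (map (\<lambda>(x, b). (x, \<not> b)) w)"

section \<open>S-machines\<close>

text \<open>
  State letters and tape letters live in the two summands of \<open>'q + 'y\<close>; in this way the state
  letters of a hardware are disjoint from its tape letters. The sets \<open>Q\<^sub>1, \<dots>, Q\<^sub>N\<^sub>+\<^sub>1\<close> and
  \<open>Y\<^sub>1, \<dots>, Y\<^sub>N\<close> are the values of functions on \<open>{1..N+1}\<close> and \<open>{1..N}\<close>.
\<close>

record ('q, 'y) sm_hw =
  len :: nat
  tapes :: "nat \<Rightarrow> 'y set"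
  heads :: "nat \<Rightarrow> 'q set"

definition sm_hardware :: "('q, 'y) sm_hw \<Rightarrow> bool" where
  "sm_hardware H \<longleftrightarrow>
     (\<forall>i\<in>{1..len H}. finite (tapes H i)) \<and>
     (\<forall>i\<in>{1..len H + 1}. finite (heads H i)) \<and>
     disjoint_family_on (heads H) {1..len H + 1}"

text \<open>The convention that \<open>Y\<^sub>0\<close> and \<open>Y\<^sub>N\<^sub>+\<^sub>1\<close> are empty.\<close>

definition tape :: "('q, 'y) sm_hw \<Rightarrow> nat \<Rightarrow> 'y set" where
  "tape H i = (if i \<in> {1..len H} then tapes H i else {})"

type_synonym ('q, 'y) hword = "('q + 'y) gword"

definition hl :: "'q \<Rightarrow> ('q + 'y) \<times> bool" where
  "hl q = (Inl q, True)"

definition tw :: "'y gword \<Rightarrow> ('q, 'y) hword" where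
  "tw u = map (map_prod Inr id) u"

text \<open>\<open>seg q u l r\<close> is the word \<open>q\<^sub>l u\<^sub>l q\<^sub>l\<^sub>+\<^sub>1 \<dots> u\<^sub>r\<^sub>-\<^sub>1 q\<^sub>r\<close>.\<close>

definition seg :: "(nat \<Rightarrow> 'q) \<Rightarrow> (nat \<Rightarrow> 'y gword) \<Rightarrow> nat \<Rightarrow> nat \<Rightarrow> ('q, 'y) hword" where
  "seg q u l r = hl (q l) # concat (map (\<lambda>j. tw (u j) @ [hl (q (j + 1))]) [l..<r])"

definition admissible :: "('q, 'y) sm_hw \<Rightarrow> ('q, 'y) hword set" where
  "admissible H = {seg q u 1 (len H + 1) | q u.
     (\<forall>j\<in>{1..len H + 1}. q j \<in> heads H j) \<and> (\<forall>j\<in>{1..len H}. u j \<in> Free (tape H j))}"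

definition admissible_sub :: "('q, 'y) sm_hw \<Rightarrow> nat \<Rightarrow> nat \<Rightarrow> ('q, 'y) hword set" where
  "admissible_sub H l r = {x. x \<noteq> [] \<and> (\<exists>w\<in>admissible H. sublist x w) \<and>
     hd x \<in> hl ` heads H l \<and> last x \<in> hl ` heads H r}"

text \<open>
  A rule carries a label besides its list \<open>[(U\<^sub>1, V\<^sub>1), \<dots>, (U\<^sub>M, V\<^sub>M)]\<close>, so that a machine may contain
  parallel copies of a rule, just as an S-graph may contain parallel edges. With \<^typ>\<open>unit\<close> as the
  type of labels a machine is a set of unlabelled rules.
\<close>

record ('n, 'q, 'y) srule =
  label :: 'n
  parts :: "(('q, 'y) hword \<times> ('q, 'y) hword) list"

definition s_rule :: "('q, 'y) sm_hw \<Rightarrow> ('n, 'q, 'y) srule \<Rightarrow> bool" where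
  "s_rule H \<tau> \<longleftrightarrow> (\<exists>l r :: nat \<Rightarrow> nat.
     (\<forall>t<length (parts \<tau>).
        1 \<le> l t \<and> l t \<le> r t \<and> r t \<le> len H + 1 \<and>
        fst (parts \<tau> ! t) \<in> admissible_sub H (l t) (r t) \<and>
        (\<exists>x\<in>Free (tape H (l t - 1)). \<exists>U'\<in>admissible_sub H (l t) (r t). \<exists>y\<in>Free (tape H (r t)).
           snd (parts \<tau> ! t) = tw x @ U' @ tw y)) \<and>
     (\<forall>i j. i < j \<and> j < length (parts \<tau>) \<longrightarrow> r i < l j))"

definition part_inverse ::
  "('q, 'y) hword \<times> ('q, 'y) hword \<Rightarrow> ('q, 'y) hword \<times> ('q, 'y) hword \<Rightarrow> bool" where
  "part_inverse p p' \<longleftrightarrow> (\<exists>x U' y.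
     snd p = tw x @ U' @ tw y \<and> U' \<noteq> [] \<and> hd U' \<in> range hl \<and> last U' \<in> range hl \<and>
     p' = (U', tw (winv x) @ fst p @ tw (winv y)))"

definition rule_inverse :: "('n, 'q, 'y) srule \<Rightarrow> ('n, 'q, 'y) srule \<Rightarrow> bool" where
  "rule_inverse \<tau> \<tau>' \<longleftrightarrow> list_all2 part_inverse (parts \<tau>) (parts \<tau>')"

definition s_machine :: "('q, 'y) sm_hw \<Rightarrow> ('n, 'q, 'y) srule set \<Rightarrow> bool" where
  "s_machine H S \<longleftrightarrow> sm_hardware H \<and> finite S \<and> (\<forall>\<tau>\<in>S. s_rule H \<tau>) \<and>
     (\<forall>\<tau>\<in>S. \<exists>\<tau>'\<in>S. rule_inverse \<tau> \<tau>')"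

definition rule_applicable :: "('n, 'q, 'y) srule \<Rightarrow> ('q, 'y) hword \<Rightarrow> bool" where
  "rule_applicable \<tau> w \<longleftrightarrow> (\<forall>p\<in>set (parts \<tau>). sublist (fst p) w)"

text \<open>
  Simultaneous replacement, before free reduction. In an admissible word the \<open>U\<^sub>t\<close> of a rule occur at
  most once each, without overlaps and in the order of the list.
\<close>

inductive replaced ::
  "(('q, 'y) hword \<times> ('q, 'y) hword) list \<Rightarrow> ('q, 'y) hword \<Rightarrow> ('q, 'y) hword \<Rightarrow> bool" where
  "replaced [] w w"
| "replaced ps w w' \<Longrightarrow> replaced ((U, V) # ps) (a @ U @ w) (a @ V @ w')"

definition rule_step ::
  "('n, 'q, 'y) srule \<Rightarrow> ('q, 'y) hword \<Rightarrow> ('q, 'y) hword \<Rightarrow> bool" where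
  "rule_step \<tau> w w' \<longleftrightarrow>
     rule_applicable \<tau> w \<and> (\<exists>v. replaced (parts \<tau>) w v \<and> w' = free_red v)"

definition sm_computation ::
  "('q, 'y) sm_hw \<Rightarrow> ('n, 'q, 'y) srule set \<Rightarrow>
   ('q, 'y) hword list \<Rightarrow> ('n, 'q, 'y) srule list \<Rightarrow> bool" where
  "sm_computation H S ws \<tau>s \<longleftrightarrow>
     length ws = length \<tau>s + 1 \<and> set ws \<subseteq> admissible H \<and> set \<tau>s \<subseteq> S \<and>
     (\<forall>i<length \<tau>s. rule_step (\<tau>s ! i) (ws ! i) (ws ! (i + 1)))"

section \<open>S-graphs\<close>

record ('i, 'y) sg_hw =
  idx :: "'i set"
  alph :: "'i \<Rightarrow> 'y set"

definition sg_hardware :: "('i, 'y) sg_hw \<Rightarrow> bool" where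
  "sg_hardware H \<longleftrightarrow> finite (idx H) \<and> (\<forall>i\<in>idx H. finite (alph H i))"

definition lang :: "('i, 'y) sg_hw \<Rightarrow> ('i \<Rightarrow> 'y gword) set" where
  "lang H = (\<Pi>\<^sub>E i\<in>idx H. Free (alph H i))"

text \<open>The guard value \<^term>\<open>None\<close> stands for NA.\<close>

record ('i, 'y) action =
  lmul :: "'i \<Rightarrow> 'y gword"
  rmul :: "'i \<Rightarrow> 'y gword"
  guard :: "'i \<Rightarrow> 'y gword option"

definition sg_action :: "('i, 'y) sg_hw \<Rightarrow> ('i, 'y) action \<Rightarrow> bool" where
  "sg_action H a \<longleftrightarrow> lmul a \<in> lang H \<and> rmul a \<in> lang H \<and>
     guard a \<in> (\<Pi>\<^sub>E i\<in>idx H. insert None (Some ` Free (alph H i)))"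

definition transform ::
  "('i, 'y) sg_hw \<Rightarrow> ('i, 'y) action \<Rightarrow> ('i \<Rightarrow> 'y gword) \<Rightarrow> ('i \<Rightarrow> 'y gword)" where
  "transform H a w = (\<lambda>i\<in>idx H. free_red (lmul a i @ w i @ rmul a i))"

definition accepts ::
  "('i, 'y) sg_hw \<Rightarrow> ('i, 'y) action \<Rightarrow> ('i \<Rightarrow> 'y gword) \<Rightarrow> bool" where
  "accepts H a w \<longleftrightarrow> (\<forall>i\<in>idx H. guard a i = None \<or> guard a i = Some (w i))"

definition action_inv :: "('i, 'y) sg_hw \<Rightarrow> ('i, 'y) action \<Rightarrow> ('i, 'y) action" where
  "action_inv H a = \<lparr>
     lmul = (\<lambda>i\<in>idx H. winv (lmul a i)),
     rmul = (\<lambda>i\<in>idx H. winv (rmul a i)),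
     guard = (\<lambda>i\<in>idx H. map_option (\<lambda>g. free_red (lmul a i @ g @ rmul a i)) (guard a i)) \<rparr>"

text \<open>The tag of an edge allows for parallel edges with the same action.\<close>

record ('e, 's, 'i, 'y) edge =
  tag :: 'e
  src :: 's
  dst :: 's
  act :: "('i, 'y) action"

record ('e, 's, 'i, 'y) graph =
  verts :: "'s set"
  edges :: "('e, 's, 'i, 'y) edge set"

definition s_graph :: "('i, 'y) sg_hw \<Rightarrow> ('e, 's, 'i, 'y) graph \<Rightarrow> bool" where
  "s_graph H G \<longleftrightarrow> sg_hardware H \<and> finite (verts G) \<and> finite (edges G) \<and>
     (\<forall>e\<in>edges G. src e \<in> verts G \<and> dst e \<in> verts G \<and> sg_action H (act e) \<and>
        (\<exists>e'\<in>edges G. src e' = dst e \<and> dst e' = src e \<and> act e' = action_inv H (act e)))"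

definition edge_step ::
  "('i, 'y) sg_hw \<Rightarrow> ('e, 's, 'i, 'y) edge \<Rightarrow>
   ('i \<Rightarrow> 'y gword) \<times> 's \<Rightarrow> ('i \<Rightarrow> 'y gword) \<times> 's \<Rightarrow> bool" where
  "edge_step H e c c' \<longleftrightarrow>
     snd c = src e \<and> accepts H (act e) (fst c) \<and> c' = (transform H (act e) (fst c), dst e)"

definition sg_computation ::
  "('i, 'y) sg_hw \<Rightarrow> ('e, 's, 'i, 'y) graph \<Rightarrow>
   (('i \<Rightarrow> 'y gword) \<times> 's) list \<Rightarrow> ('e, 's, 'i, 'y) edge list \<Rightarrow> bool" where
  "sg_computation H G cs es \<longleftrightarrow>
     length cs = length es + 1 \<and> set cs \<subseteq> lang H \<times> verts G \<and> set es \<subseteq> edges G \<and>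
     (\<forall>i<length es. edge_step H (es ! i) (cs ! i) (cs ! (i + 1)))"

subsection \<open>Isomorphism\<close>

text \<open>
  At a guarded index an action is only ever applied to the word prescribed by the guard, so the two
  multipliers matter there only through the resulting word; an action \<open>a\<close> and one with right
  multiplier trivial and left multiplier \<open>l g r g\<inverse>\<close> at that index (where \<open>l\<close>, \<open>r\<close>, \<open>g\<close> are the
  multipliers and the guard of \<open>a\<close>) are indistinguishable. The following relation identifies
  actions that differ only in this way; multipliers at unguarded indices are compared literally.
\<close>

definition same_action :: "'i set \<Rightarrow> ('i, 'y) action \<Rightarrow> ('i, 'y) action \<Rightarrow> bool" where
  "same_action I a b \<longleftrightarrow> (\<forall>i\<in>I. guard a i = guard b i \<and>
     (case guard a i of
        None \<Rightarrow> lmul a i = lmul b i \<and> rmul a i = rmul b i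
      | Some g \<Rightarrow> free_red (lmul a i @ g @ rmul a i) = free_red (lmul b i @ g @ rmul b i)))"

definition guard_normal :: "('i, 'y) sg_hw \<Rightarrow> ('e, 's, 'i, 'y) graph \<Rightarrow> bool" where
  "guard_normal H G \<longleftrightarrow>
     (\<forall>e\<in>edges G. \<forall>i\<in>idx H. guard (act e) i \<noteq> None \<longrightarrow> rmul (act e) i = [])"

definition reindex :: "'i set \<Rightarrow> ('i \<Rightarrow> 'j) \<Rightarrow> ('j, 'y) action \<Rightarrow> ('i, 'y) action" where
  "reindex I h a = \<lparr> lmul = (\<lambda>i\<in>I. lmul a (h i)), rmul = (\<lambda>i\<in>I. rmul a (h i)),
     guard = (\<lambda>i\<in>I. guard a (h i)) \<rparr>"

text \<open>
  Isomorphism by renaming states and reindexing, where the actions of corresponding edges are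
  compared by \<open>R\<close> (literally, or by \<^const>\<open>same_action\<close>). Letters are not renamed.
\<close>

definition sg_iso_wrt ::
  "(('i, 'y) action \<Rightarrow> ('i, 'y) action \<Rightarrow> bool) \<Rightarrow>
   ('i, 'y) sg_hw \<Rightarrow> ('e, 's, 'i, 'y) graph \<Rightarrow>
   ('j, 'y) sg_hw \<Rightarrow> ('f, 't, 'j, 'y) graph \<Rightarrow> bool" where
  "sg_iso_wrt R H G H' G' \<longleftrightarrow> (\<exists>f h b.
     bij_betw f (verts G) (verts G') \<and> bij_betw h (idx H) (idx H') \<and>
     bij_betw b (edges G) (edges G') \<and>
     (\<forall>i\<in>idx H. alph H' (h i) = alph H i) \<and>
     (\<forall>e\<in>edges G. src (b e) = f (src e) \<and> dst (b e) = f (dst e) \<and>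
        R (act e) (reindex (idx H) h (act (b e)))))"

definition sg_iso_literal ::
  "('i, 'y) sg_hw \<Rightarrow> ('e, 's, 'i, 'y) graph \<Rightarrow>
   ('j, 'y) sg_hw \<Rightarrow> ('f, 't, 'j, 'y) graph \<Rightarrow> bool" where
  "sg_iso_literal H G H' G' \<longleftrightarrow> sg_iso_wrt (=) H G H' G'"

definition sg_iso ::
  "('i, 'y) sg_hw \<Rightarrow> ('e, 's, 'i, 'y) graph \<Rightarrow>
   ('j, 'y) sg_hw \<Rightarrow> ('f, 't, 'j, 'y) graph \<Rightarrow> bool" where
  "sg_iso H G H' G' \<longleftrightarrow> sg_iso_wrt (same_action (idx H)) H G H' G'"

section \<open>From S-machines to S-graphs\<close>

text \<open>
  Reading off the pieces of a word: the state letters in order, and the tape words before, between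
  and after them (one more than there are state letters).
\<close>

fun state_letters :: "('q, 'y) hword \<Rightarrow> 'q list" where
  "state_letters [] = []"
| "state_letters ((Inl q, b) # w) = q # state_letters w"
| "state_letters ((Inr y, b) # w) = state_letters w"

fun blocks :: "('q, 'y) hword \<Rightarrow> 'y gword list" where
  "blocks [] = [[]]"
| "blocks ((Inl q, b) # w) = [] # blocks w"
| "blocks ((Inr y, b) # w) = ((y, b) # hd (blocks w)) # tl (blocks w)"

definition graph_hw :: "('q, 'y) sm_hw \<Rightarrow> (nat, 'y) sg_hw" where
  "graph_hw H = \<lparr> idx = {1..len H}, alph = tapes H \<rparr>"

definition mu ::
  "('q, 'y) sm_hw \<Rightarrow> ('q, 'y) hword \<Rightarrow> (nat \<Rightarrow> 'y gword) \<times> (nat \<Rightarrow> 'q)" where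
  "mu H w = ((\<lambda>i\<in>{1..len H}. blocks w ! i), (\<lambda>i\<in>{1..len H + 1}. state_letters w ! (i - 1)))"

definition mu_inv ::
  "('q, 'y) sm_hw \<Rightarrow> (nat \<Rightarrow> 'y gword) \<times> (nat \<Rightarrow> 'q) \<Rightarrow> ('q, 'y) hword" where
  "mu_inv H = inv_into (admissible H) (mu H)"

text \<open>
  For \<open>p = (U, v\<^sup>l\<^sup>-\<^sup>1 V v\<^sup>r)\<close> with \<open>U = q\<^sup>l u\<^sup>l \<dots> q\<^sup>r\<close> and \<open>V = p\<^sup>l v\<^sup>l \<dots> p\<^sup>r\<close>: \<open>lo\<close> and \<open>hi\<close> are \<open>l\<close> and \<open>r\<close>,
  the letters \<open>q\<^sup>j\<close> and \<open>p\<^sup>j\<close> are \<open>old_q\<close> and \<open>new_q\<close> (for \<open>l \<le> j \<le> r\<close>), and the words \<open>u\<^sup>j\<close> (for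
  \<open>l \<le> j < r\<close>) and \<open>v\<^sup>j\<close> (for \<open>l - 1 \<le> j \<le> r\<close>) are \<open>old_w\<close> and \<open>new_w\<close>.
\<close>

type_synonym ('q, 'y) part = "('q, 'y) hword \<times> ('q, 'y) hword"

definition lo :: "('q, 'y) sm_hw \<Rightarrow> ('q, 'y) part \<Rightarrow> nat" where
  "lo H p = (THE l. l \<in> {1..len H + 1} \<and> hd (state_letters (fst p)) \<in> heads H l)"

definition hi :: "('q, 'y) sm_hw \<Rightarrow> ('q, 'y) part \<Rightarrow> nat" where
  "hi H p = lo H p + length (state_letters (fst p)) - 1"

definition old_q :: "('q, 'y) sm_hw \<Rightarrow> ('q, 'y) part \<Rightarrow> nat \<Rightarrow> 'q" where
  "old_q H p j = state_letters (fst p) ! (j - lo H p)"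

definition new_q :: "('q, 'y) sm_hw \<Rightarrow> ('q, 'y) part \<Rightarrow> nat \<Rightarrow> 'q" where
  "new_q H p j = state_letters (snd p) ! (j - lo H p)"

definition old_w :: "('q, 'y) sm_hw \<Rightarrow> ('q, 'y) part \<Rightarrow> nat \<Rightarrow> 'y gword" where
  "old_w H p j = blocks (fst p) ! (j + 1 - lo H p)"

definition new_w :: "('q, 'y) sm_hw \<Rightarrow> ('q, 'y) part \<Rightarrow> nat \<Rightarrow> 'y gword" where
  "new_w H p j = blocks (snd p) ! (j + 1 - lo H p)"

definition rule_action :: "('q, 'y) sm_hw \<Rightarrow> ('n, 'q, 'y) srule \<Rightarrow> (nat, 'y) action" where
  "rule_action H \<tau> = \<lparr>
     lmul = (\<lambda>i\<in>{1..len H}.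
       case find (\<lambda>p. lo H p \<le> i \<and> i < hi H p) (parts \<tau>) of
         Some p \<Rightarrow> free_red (new_w H p i @ winv (old_w H p i))
       | None \<Rightarrow> (case find (\<lambda>p. hi H p = i) (parts \<tau>) of Some p \<Rightarrow> new_w H p i | None \<Rightarrow> [])),
     rmul = (\<lambda>i\<in>{1..len H}.
       case find (\<lambda>p. lo H p = i + 1) (parts \<tau>) of Some p \<Rightarrow> new_w H p i | None \<Rightarrow> []),
     guard = (\<lambda>i\<in>{1..len H}.
       map_option (\<lambda>p. old_w H p i) (find (\<lambda>p. lo H p \<le> i \<and> i < hi H p) (parts \<tau>))) \<rparr>"

definition touched :: "('q, 'y) sm_hw \<Rightarrow> ('n, 'q, 'y) srule \<Rightarrow> nat set" where
  "touched H \<tau> = (\<Union>p\<in>set (parts \<tau>). {lo H p..hi H p})"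

definition untouched :: "('q, 'y) sm_hw \<Rightarrow> ('n, 'q, 'y) srule \<Rightarrow> nat set" where
  "untouched H \<tau> = {1..len H + 1} - touched H \<tau>"

definition rule_state ::
  "('q, 'y) sm_hw \<Rightarrow> ('n, 'q, 'y) srule \<Rightarrow> (('q, 'y) part \<Rightarrow> nat \<Rightarrow> 'q) \<Rightarrow>
   (nat \<Rightarrow> 'q) \<Rightarrow> (nat \<Rightarrow> 'q)" where
  "rule_state H \<tau> letter \<theta> = (\<lambda>j\<in>{1..len H + 1}.
     case find (\<lambda>p. lo H p \<le> j \<and> j \<le> hi H p) (parts \<tau>) of Some p \<Rightarrow> letter p j | None \<Rightarrow> \<theta> j)"

text \<open>
  The edges of \<open>E\<^sub>\<tau>\<close> are tagged by \<open>(\<tau>, \<theta>)\<close>, so that different rules have disjoint sets of edges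
  even where these edges agree as labelled arrows.
\<close>

type_synonym ('n, 'q, 'y) redge =
  "(('n, 'q, 'y) srule \<times> (nat \<Rightarrow> 'q), nat \<Rightarrow> 'q, nat, 'y) edge"

definition rule_edges ::
  "('q, 'y) sm_hw \<Rightarrow> ('n, 'q, 'y) srule \<Rightarrow> ('n, 'q, 'y) redge set" where
  "rule_edges H \<tau> = (\<lambda>\<theta>. \<lparr> tag = (\<tau>, \<theta>),
     src = rule_state H \<tau> (old_q H) \<theta>, dst = rule_state H \<tau> (new_q H) \<theta>,
     act = rule_action H \<tau> \<rparr>) ` (\<Pi>\<^sub>E j\<in>untouched H \<tau>. heads H j)"

definition graph_states :: "('q, 'y) sm_hw \<Rightarrow> (nat \<Rightarrow> 'q) set" where
  "graph_states H = (\<Pi>\<^sub>E j\<in>{1..len H + 1}. heads H j)"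

definition graph_of ::
  "('q, 'y) sm_hw \<Rightarrow> ('n, 'q, 'y) srule set \<Rightarrow>
   (('n, 'q, 'y) srule \<times> (nat \<Rightarrow> 'q), nat \<Rightarrow> 'q, nat, 'y) graph" where
  "graph_of H S = \<lparr> verts = graph_states H, edges = (\<Union>\<tau>\<in>S. rule_edges H \<tau>) \<rparr>"

section \<open>From S-graphs to S-machines\<close>

text \<open>\<open>Vertex s\<close> is the state \<open>s\<close> as an element of \<open>Q\<^sub>1\<close>, and \<open>Star j\<close> is \<open>q\<^sub>j\<^sup>*\<close>.\<close>

datatype 's mstate = Vertex (vertex: 's) | Star nat

definition idx_at :: "('i, 'y) sg_hw \<Rightarrow> ('i \<Rightarrow> nat) \<Rightarrow> nat \<Rightarrow> 'i" where
  "idx_at H \<eta> j = inv_into (idx H) \<eta> j"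

definition machine_hw ::
  "('i, 'y) sg_hw \<Rightarrow> ('e, 's, 'i, 'y) graph \<Rightarrow> ('i \<Rightarrow> nat) \<Rightarrow> ('s mstate, 'y) sm_hw" where
  "machine_hw H G \<eta> = \<lparr> len = card (idx H), tapes = (\<lambda>j. alph H (idx_at H \<eta> j)),
     heads = (\<lambda>j. if j = 1 then Vertex ` verts G else {Star j}) \<rparr>"

definition nu ::
  "('i, 'y) sg_hw \<Rightarrow> ('i \<Rightarrow> nat) \<Rightarrow> ('s mstate, 'y) hword \<Rightarrow> ('i \<Rightarrow> 'y gword) \<times> 's" where
  "nu H \<eta> w = ((\<lambda>i\<in>idx H. blocks w ! \<eta> i), vertex (hd (state_letters w)))"

definition nu_inv ::
  "('i, 'y) sg_hw \<Rightarrow> ('e, 's, 'i, 'y) graph \<Rightarrow> ('i \<Rightarrow> nat) \<Rightarrow>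
   ('i \<Rightarrow> 'y gword) \<times> 's \<Rightarrow> ('s mstate, 'y) hword" where
  "nu_inv H G \<eta> = inv_into (admissible (machine_hw H G \<eta>)) (nu H \<eta>)"

definition lm :: "('i, 'y) sg_hw \<Rightarrow> ('i \<Rightarrow> nat) \<Rightarrow> ('i, 'y) action \<Rightarrow> nat \<Rightarrow> 'y gword" where
  "lm H \<eta> a j = (if j \<in> {1..card (idx H)} then lmul a (idx_at H \<eta> j) else [])"

definition rm :: "('i, 'y) sg_hw \<Rightarrow> ('i \<Rightarrow> nat) \<Rightarrow> ('i, 'y) action \<Rightarrow> nat \<Rightarrow> 'y gword" where
  "rm H \<eta> a j = (if j \<in> {1..card (idx H)} then rmul a (idx_at H \<eta> j) else [])"

definition gd :: "('i, 'y) sg_hw \<Rightarrow> ('i \<Rightarrow> nat) \<Rightarrow> ('i, 'y) action \<Rightarrow> nat \<Rightarrow> 'y gword option" where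
  "gd H \<eta> a j = (if j \<in> {1..card (idx H)} then guard a (idx_at H \<eta> j) else None)"

text \<open>
  The maximal intervals \<open>{l\<^sub>i..r\<^sub>i}\<close> in increasing order: \<open>j\<close> is a left end iff the guard at \<open>j - 1\<close> is
  NA or \<open>j = 1\<close>, and a right end iff the guard at \<open>j\<close> is NA or \<open>j = N + 1\<close>. (By definition
  \<^const>\<open>gd\<close> is \<^term>\<open>None\<close> at \<open>0\<close> and \<open>N + 1\<close>.)
\<close>

definition intervals ::
  "('i, 'y) sg_hw \<Rightarrow> ('i \<Rightarrow> nat) \<Rightarrow> ('i, 'y) action \<Rightarrow> (nat \<times> nat) list" where
  "intervals H \<eta> a = (let js = [1..<card (idx H) + 2] in
     zip (filter (\<lambda>j. gd H \<eta> a (j - 1) = None) js) (filter (\<lambda>j. gd H \<eta> a j = None) js))"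

definition gamma :: "'s \<Rightarrow> nat \<Rightarrow> 's mstate" where
  "gamma s j = (if j = 1 then Vertex s else Star j)"

definition edge_rule ::
  "('i, 'y) sg_hw \<Rightarrow> ('i \<Rightarrow> nat) \<Rightarrow> ('e, 's, 'i, 'y) edge \<Rightarrow>
   (('e, 's, 'i, 'y) edge, 's mstate, 'y) srule" where
  "edge_rule H \<eta> e = (let a = act e; g = (\<lambda>j. the (gd H \<eta> a j)) in
     \<lparr> label = e,
       parts = map (\<lambda>(l, r).
         (seg (gamma (src e)) g l r,
          tw (rm H \<eta> a (l - 1)) @
          seg (gamma (dst e)) (\<lambda>j. free_red (lm H \<eta> a j @ g j @ rm H \<eta> a j)) l r @
          tw (lm H \<eta> a r))) (intervals H \<eta> a) \<rparr>)"

definition machine_of ::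
  "('i, 'y) sg_hw \<Rightarrow> ('e, 's, 'i, 'y) graph \<Rightarrow> ('i \<Rightarrow> nat) \<Rightarrow>
   (('e, 's, 'i, 'y) edge, 's mstate, 'y) srule set" where
  "machine_of H G \<eta> = edge_rule H \<eta> ` edges G"

end

theory Submission
  imports Defs
begin

text \<open>
  An admissible word is the same thing as its coordinates, the state letters \<open>q\<^sub>j\<close> and the tape
  words \<open>u\<^sub>j\<close> (\<open>mu_bij\<close>), so in both directions of the correspondence it suffices to compare one
  application of a rule with one passage along an edge, for words and configurations that have
  the same coordinates.

  From machines to graphs. The sets of state letters are disjoint, so a left-hand side occurs in
  an admissible word at one place at most, and it occurs there iff the coordinates in its range
  are the prescribed ones. As the ranges of the parts of a rule are disjoint and increasing, a
  simultaneous replacement has at most one result, which can be written down coordinate by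
  coordinate (\<open>replaced_rest\<close>). State letters only occur with exponent \<open>1\<close>; hence they never cancel,
  and free reduction acts on every tape word separately (\<open>free_red_rest\<close>). Together this gives
  \<open>rule_step_iff\<close>: the rule applies iff the prescribed coordinates match, and then the coordinate at
  an index \<open>i\<close> in the interior of a part becomes \<open>v\<^sub>i\<close>, while any other tape word only receives
  factors on its two sides. An edge of \<open>E\<^sub>\<tau>\<close> does the same (\<open>edge_step_iff\<close>): at a guarded index the
  word is forced to be \<open>u\<^sub>i\<close>, and the left multiplier \<open>v\<^sub>i u\<^sub>i\<inverse>\<close> takes it to \<open>v\<^sub>i\<close>. The parameter \<open>\<theta>\<close> of
  the edge must be the list of untouched state letters of the word, which explains why the edge
  is unique. That the graph is closed under inverse edges follows by applying this coordinate
  description to an inverse rule (\<open>rule_action_inverse\<close>, \<open>rule_state_inverse\<close>).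

  From graphs to machines. The maximal intervals of an action cover all of \<open>{1..N+1}\<close>, so the rule
  of an edge \<open>e\<close> touches every state letter and \<open>E\<^sub>\<tau>\<close> consists of a single edge for \<open>\<tau> = \<tau>\<^sub>e\<close>. Its
  action is that of \<open>e\<close>, except that at an index with guard \<open>g\<close> the multipliers \<open>l\<close>, \<open>r\<close> are replaced
  by \<open>l g r g\<inverse>\<close> and the empty word (\<open>lmul_edge_rule\<close>, \<open>rmul_edge_rule\<close>). On the only word accepted
  there both actions agree. This is the partial duality of graphs and machines, and it also makes
  a second analysis of replacements unnecessary: a rule \<open>\<tau>\<^sub>e\<close> takes a step iff the single edge of
  its own graph does, iff \<open>e\<close> does (\<open>rule_step_edge_rule\<close>).
\<close>

section \<open>Free reduction\<close>

definition linv :: "'x \<times> bool \<Rightarrow> 'x \<times> bool" where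
  "linv a = (fst a, \<not> snd a)"

lemma cancels_iff: "cancels a b \<longleftrightarrow> b = linv a"
  by (cases a; cases b) (auto simp: cancels_def linv_def)

lemma linv_linv [simp]: "linv (linv a) = a"
  by (simp add: linv_def)

lemma reduced_Nil [simp]: "reduced []"
  by (simp add: reduced_def)

lemma reduced_push: "reduced w \<Longrightarrow> reduced (push_letter a w)"
  by (cases w) (auto simp: reduced_def successively_Cons)

lemma reduced_foldr_push: "reduced z \<Longrightarrow> reduced (foldr push_letter w z)"
  by (induction w) (auto intro: reduced_push)

lemma reduced_free_red: "reduced (free_red w)"
  by (simp add: free_red_def reduced_foldr_push)

lemma free_red_Nil [simp]: "free_red [] = []"
  by (simp add: free_red_def)

lemma free_red_Cons: "free_red (a # w) = push_letter a (free_red w)"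
  by (simp add: free_red_def)

lemma free_red_id: "reduced w \<Longrightarrow> free_red w = w"
proof (induction w)
  case (Cons a w)
  then show ?case
    by (cases w) (auto simp: free_red_Cons reduced_def successively_Cons)
qed simp

lemma free_red_append: "free_red (a @ b) = foldr push_letter a (free_red b)"
  by (simp add: free_red_def)

lemma free_red_right [simp]: "free_red (a @ free_red b) = free_red (a @ b)"
  by (simp add: free_red_append free_red_id reduced_free_red)

text \<open>
  On reduced words, pushing a letter is a bijection whose inverse pushes the inverse letter. Thus the
  free group acts on its reduced words, and the laws of the group follow without a discussion of
  confluence.
\<close>

lemma push_push_linv: "reduced w \<Longrightarrow> push_letter a (push_letter (linv a) w) = w"
proof (cases w)
  case (Cons b v)
  show "reduced w \<Longrightarrow> push_letter a (push_letter (linv a) w) = w"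
    by (cases v) (auto simp: Cons cancels_iff reduced_def successively_Cons)
qed (simp add: cancels_iff)

lemma foldr_push_letter:
  assumes "reduced z"
  shows "foldr push_letter (push_letter a w) z = push_letter a (foldr push_letter w z)"
proof (cases w)
  case (Cons b w')
  then show ?thesis
    using push_push_linv[OF reduced_foldr_push[OF assms, of w'], of a]
    by (auto simp: cancels_iff)
qed simp

text \<open>
  Both \<open>a\<close> and its reduction act in the same way on reduced words.
\<close>

lemma free_red_left [simp]: "free_red (free_red a @ b) = free_red (a @ b)"
proof -
  have "foldr push_letter (free_red a) z = foldr push_letter a z" if "reduced z" for z :: "'a gword"
    by (induction a) (auto simp: free_red_Cons foldr_push_letter that)
  then show ?thesis
    by (simp add: free_red_append reduced_free_red)
qed

lemma free_red_mid [simp]: "free_red (a @ free_red b @ c) = free_red (a @ b @ c)"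
  using free_red_right[of a "free_red b @ c"] free_red_right[of a "b @ c"] by simp

lemma winv_eq: "winv w = rev (map linv w)"
  by (simp add: winv_def linv_def case_prod_beta')

lemma winv_Nil [simp]: "winv [] = []"
  by (simp add: winv_def)

lemma winv_append: "winv (a @ b) = winv b @ winv a"
  by (simp add: winv_def)

lemma winv_winv [simp]: "winv (winv w) = w"
  by (simp add: winv_eq rev_map o_def)

lemma letters_winv [simp]: "fst ` set (winv w) = fst ` set w"
  by (simp add: winv_eq image_image linv_def)

lemma free_red_winv_cancel [simp]: "free_red (winv a @ a @ b) = free_red b"
proof (induction a arbitrary: b)
  case (Cons x a)
  have "free_red (winv (x # a) @ (x # a) @ b) = foldr push_letter (winv a)
      (push_letter (linv x) (push_letter (linv (linv x)) (free_red (a @ b))))"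
    by (simp add: winv_eq free_red_append free_red_Cons)
  also have "\<dots> = free_red (winv a @ a @ b)"
    by (subst push_push_linv) (simp_all add: reduced_free_red reduced_foldr_push free_red_append)
  finally show ?case
    using Cons by simp
qed simp

lemma free_red_cancel_winv [simp]: "free_red (a @ winv a @ b) = free_red b"
  using free_red_winv_cancel[of "winv a" b] by simp

lemma free_red_winv_cancel_end [simp]:
  "free_red (b @ winv a @ a) = free_red b" "free_red (b @ a @ winv a) = free_red b"
proof -
  have "free_red (b @ free_red (winv a @ a)) = free_red b" "free_red (b @ free_red (a @ winv a)) = free_red b"
    using free_red_winv_cancel[of a "[]"] free_red_cancel_winv[of a "[]"] by (simp_all del: free_red_right)
  then show "free_red (b @ winv a @ a) = free_red b" "free_red (b @ a @ winv a) = free_red b"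
    by simp_all
qed

lemma reduced_winv: "reduced w \<Longrightarrow> reduced (winv w)"
proof -
  have "cancels (linv b) (linv a) \<longleftrightarrow> cancels a b" for a b :: "'a \<times> bool"
    by (auto simp: cancels_def linv_def)
  then show "reduced w \<Longrightarrow> reduced (winv w)"
    by (simp add: reduced_def winv_eq successively_map)
qed

lemma winv_free_red: "winv (free_red w) = free_red (winv w)"
proof -
  have push: "free_red (winv (push_letter a w)) = free_red (winv w @ [linv a])" for a and w :: "'a gword"
  proof (cases w)
    case (Cons b w')
    then show ?thesis
      using free_red_winv_cancel_end(2)[of "winv w'" "[a]"]
      by (auto simp: winv_eq cancels_iff)
  qed (simp add: winv_eq)
  have "free_red (winv (free_red w)) = free_red (winv w)"
  proof (induction w)
    case (Cons a w)
    have "free_red (winv (free_red (a # w))) = free_red (free_red (winv (free_red w)) @ [linv a])"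
      by (simp add: free_red_Cons push)
    also have "\<dots> = free_red (winv (a # w))"
      unfolding Cons by (simp add: winv_eq)
    finally show ?case .
  qed simp
  then show ?thesis
    by (simp add: free_red_id reduced_winv reduced_free_red)
qed

lemma set_free_red: "set (free_red w) \<subseteq> set w"
proof (induction w)
  case (Cons a w)
  have "set (push_letter a v) \<subseteq> insert a (set v)" for v
    by (cases v) auto
  with Cons show ?case
    by (fastforce simp: free_red_Cons)
qed simp

lemma Free_free_red: "fst ` set w \<subseteq> X \<Longrightarrow> free_red w \<in> Free X"
  using set_free_red[of w] by (auto simp: Free_def reduced_free_red)

lemma Nil_in_Free [simp]: "[] \<in> Free X"
  by (simp add: Free_def)

lemma Free_letters: "w \<in> Free X \<Longrightarrow> fst ` set w \<subseteq> X"
  by (simp add: Free_def)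

lemma free_red_Free: "w \<in> Free X \<Longrightarrow> free_red w = w"
  by (simp add: Free_def free_red_id)

lemma Free_empty [simp]: "Free {} = {[]}"
  by (auto simp: Free_def)

lemma winv_Free: "w \<in> Free X \<Longrightarrow> winv w \<in> Free X"
  by (simp add: Free_def reduced_winv)

section \<open>Words with state letters\<close>

text \<open>
  The part \<open>u\<^sub>l q\<^sub>l\<^sub>+\<^sub>1 \<dots> u\<^sub>r\<^sub>-\<^sub>1 q\<^sub>r\<close> of an admissible word after the state letter \<open>q\<^sub>l\<close>. Unlike \<open>seg\<close> it
  concatenates without overlaps, and a whole admissible word is of this shape too, with an empty
  tape word at the index \<open>0\<close>; this lets inductions over the parts of a rule start at the left end
  of the word without a special case.
\<close>

definition rest :: "(nat \<Rightarrow> 'q) \<Rightarrow> (nat \<Rightarrow> 'y gword) \<Rightarrow> nat \<Rightarrow> nat \<Rightarrow> ('q, 'y) hword" where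
  "rest q u l r = concat (map (\<lambda>j. tw (u j) @ [hl (q (j + 1))]) [l..<r])"

lemma tw_Nil [simp]: "tw [] = []"
  by (simp add: tw_def)

lemma tw_append: "tw (a @ b) = tw a @ tw b"
  by (simp add: tw_def)

lemma rest_self [simp]: "rest q u l l = []"
  by (simp add: rest_def)

lemma rest_Cons: "l < r \<Longrightarrow> rest q u l r = tw (u l) @ hl (q (Suc l)) # rest q u (Suc l) r"
  by (simp add: rest_def upt_conv_Cons)

lemma seg_rest: "seg q u l r = hl (q l) # rest q u l r"
  by (simp add: seg_def rest_def)

lemma rest_append: "l \<le> m \<Longrightarrow> m \<le> r \<Longrightarrow> rest q u l r = rest q u l m @ rest q u m r"
  using upt_add_eq_append[of l m "r - m"] by (simp add: rest_def)

lemma rest_cong: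
  "(\<And>j. l \<le> j \<Longrightarrow> j < r \<Longrightarrow> u j = u' j \<and> q (Suc j) = q' (Suc j)) \<Longrightarrow> rest q u l r = rest q' u' l r"
  unfolding rest_def by (intro arg_cong[where f = concat] map_cong) auto

lemma seg_cong:
  "(\<And>j. l \<le> j \<Longrightarrow> j \<le> r \<Longrightarrow> q j = q' j) \<Longrightarrow> (\<And>j. l \<le> j \<Longrightarrow> j < r \<Longrightarrow> u j = u' j) \<Longrightarrow> l \<le> r \<Longrightarrow>
   seg q u l r = seg q' u' l r"
  unfolding seg_rest by (auto intro!: rest_cong)

lemma tw_Cons: "tw ((y, b) # a) = (Inr y, b) # tw a"
  by (simp add: tw_def)

lemma tw_hl_inject: "tw a @ hl c # v = tw b @ hl d # w \<longleftrightarrow> a = b \<and> c = d \<and> v = w"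
proof (induction a arbitrary: b)
  case Nil
  show ?case
    by (cases b ) (auto simp: tw_def hl_def)
next
  case (Cons x a)
  note IH = Cons.IH
  obtain y s where x: "x = (y, s)"
    by fastforce
  show ?case
  proof (cases b)
    case Nil
    then show ?thesis by (simp add: x tw_Cons hl_def)
  next
    case (Cons x' b')
    obtain y' s' where x': "x' = (y', s')"
      by fastforce
    show ?thesis
      using IH[of b'] by (auto simp: Cons x x' tw_Cons)
  qed
qed

text \<open>
  Tape letters and state letters are told apart by the two summands of their type, so such words can
  be compared letter by letter from the left.
\<close>

lemma rest_append_eq:
  assumes "l \<le> r" "r \<le> n" "rest q u l r @ w = rest q' u' l n"
  shows "w = rest q' u' r n \<and> (\<forall>j. l \<le> j \<longrightarrow> j < r \<longrightarrow> u j = u' j \<and> q (Suc j) = q' (Suc j))"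
  using assms
proof (induction rule: inc_induct)
  case (step m)
  from step.hyps step.prems have "u m = u' m" "q (Suc m) = q' (Suc m)"
      "rest q u (Suc m) r @ w = rest q' u' (Suc m) n"
    by (auto simp: rest_Cons tw_hl_inject)
  moreover from this step have "w = rest q' u' r n \<and>
      (\<forall>j. Suc m \<le> j \<longrightarrow> j < r \<longrightarrow> u j = u' j \<and> q (Suc j) = q' (Suc j))"
    by blast
  ultimately show ?case
    by (metis le_neq_implies_less Suc_leI)
qed simp

lemma tw_append_hl:
  "a @ hl c # b = tw x @ w \<Longrightarrow> \<exists>a'. a = tw x @ a' \<and> w = a' @ hl c # b"
proof (induction x arbitrary: a)
  case (Cons y x)
  then show ?case by (cases a; cases y) (auto simp: tw_Cons hl_def)
qed simp

text \<open>
  An occurrence of a state letter determines how the word is cut: this locates the occurrences of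
  left-hand sides.
\<close>

lemma rest_split_hl:
  assumes "j \<le> n" "a @ hl c # b = rest q u j n"
  shows "\<exists>k. j < k \<and> k \<le> n \<and> c = q k \<and> a = rest q u j (k - 1) @ tw (u (k - 1)) \<and> b = rest q u k n"
  using assms
proof (induction arbitrary: a rule: inc_induct)
  case (step m)
  have "a @ hl c # b = tw (u m) @ hl (q (Suc m)) # rest q u (Suc m) n"
    by (simp only: step.prems rest_Cons[OF step.hyps(2)])
  from tw_append_hl[OF this] obtain a' where a: "a = tw (u m) @ a'"
    and a': "hl (q (Suc m)) # rest q u (Suc m) n = a' @ hl c # b"
    by (elim exE conjE)
  show ?case
  proof (cases a')
    case Nil
    then have "c = q (Suc m)" "b = rest q u (Suc m) n"
      using a' by (simp_all add: hl_def)
    then show ?thesis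
      using a Nil step.hyps by (intro exI[of _ "Suc m"]) simp
  next
    case (Cons x a'')
    then have x: "x = hl (q (Suc m))" "a'' @ hl c # b = rest q u (Suc m) n"
      using a' by simp_all
    from step.IH[OF x(2)] obtain k where k: "Suc m < k" "k \<le> n" "c = q k"
        "a'' = rest q u (Suc m) (k - 1) @ tw (u (k - 1))" "b = rest q u k n"
      by (elim exE conjE)
    have "a = rest q u m (k - 1) @ tw (u (k - 1))"
      using k(1) by (subst rest_Cons) (simp_all add: a Cons x(1) k(4))
    with k show ?thesis by (intro exI[of _ k]) simp
  qed
qed simp

lemma state_letters_tw [simp]: "state_letters (tw x @ w) = state_letters w"
  by (induction x) (auto simp: tw_Cons)

lemma state_letters_hl [simp]: "state_letters (hl q # w) = q # state_letters w"
  by (simp add: hl_def)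

lemma state_letters_rest: 
  "l \<le> r \<Longrightarrow> state_letters (rest q u l r @ tw y) = map q [Suc l..<Suc r]"
proof (induction rule: inc_induct)
  case base
  show ?case using state_letters_tw[of y "[]"] by simp
qed (simp add: rest_Cons upt_conv_Cons del: upt_Suc)

lemma state_letters_seg:
  "l \<le> r \<Longrightarrow> state_letters (tw x @ seg q u l r @ tw y) = map q [l..<Suc r]"
  by (simp add: seg_rest state_letters_rest upt_conv_Cons del: upt_Suc)

lemma blocks_neq_Nil [simp]: "blocks w \<noteq> []"
  by (induction w rule: blocks.induct) auto

lemma blocks_hl [simp]: "blocks (hl q # w) = [] # blocks w"
  by (simp add: hl_def)

lemma blocks_tw: "blocks (tw x @ w) = (x @ hd (blocks w)) # tl (blocks w)"
  by (induction x) (auto simp: tw_Cons)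

lemma blocks_rest: "l \<le> r \<Longrightarrow> blocks (rest q u l r @ tw y) = map u [l..<r] @ [y]"
proof (induction rule: inc_induct)
  case base
  show ?case using blocks_tw[of y "[]"] by simp
qed (simp add: rest_Cons upt_conv_Cons blocks_tw)

lemma blocks_seg: "l \<le> r \<Longrightarrow> blocks (tw x @ seg q u l r @ tw y) = x # map u [l..<r] @ [y]"
  by (simp add: seg_rest blocks_rest blocks_tw)


text \<open>
  A positive state letter absorbs no letters coming from the left.
\<close>

lemma foldr_push_tw_hl:
  "foldr push_letter (tw a) (hl c # w) = tw (free_red a) @ hl c # w"
proof (induction a)
  case (Cons x a)
  have "push_letter (map_prod Inr id x) (tw v @ hl c # w) = tw (push_letter x v) @ hl c # w" for v
    by (cases v) (auto simp: tw_def hl_def cancels_def)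
  then show ?case
    using Cons by (simp add: tw_def free_red_Cons)
qed simp

text \<open>
  Cancelling two state letters would need one with exponent \<open>-1\<close>.
\<close>

lemma free_red_rest: "l \<le> r \<Longrightarrow> free_red (rest q u l r) = rest q (\<lambda>j. free_red (u j)) l r"
proof (induction rule: inc_induct)
  case (step m)
  have "push_letter (hl (q (Suc m))) (rest q (\<lambda>j. free_red (u j)) (Suc m) r) =
      hl (q (Suc m)) # rest q (\<lambda>j. free_red (u j)) (Suc m) r"
  proof (cases "Suc m < r")
    case True
    then show ?thesis
      by (cases "free_red (u (Suc m))") (auto simp: rest_Cons tw_def hl_def cancels_def)
  next
    case False
    with step.hyps have "Suc m = r" by simp
    then show ?thesis by simp
  qed
  with step show ?case
    by (simp add: rest_Cons free_red_append free_red_Cons foldr_push_tw_hl)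
qed simp

lemma rest_snoc: "l < r \<Longrightarrow> rest q u l r = rest q u l (r - 1) @ tw (u (r - 1)) @ [hl (q r)]"
  using rest_append[of l "r - 1" r q u] by (simp add: rest_Cons)

lemma seg_eq_rest: "u 0 = [] \<Longrightarrow> seg q u 1 (Suc n) = rest q u 0 (Suc n)"
  by (simp add: seg_rest rest_Cons)

lemma seg_sublist:
  assumes "a \<le> l" "l \<le> r" "r \<le> n"
  shows "sublist (seg q u l r) (seg q u a n)"
proof (cases "a = l")
  case True
  then show ?thesis
    using assms rest_append[of l r n q u] by (simp add: seg_rest sublist_code)
next
  case False
  then have "seg q u a n = (hl (q a) # rest q u a (l - 1) @ tw (u (l - 1))) @ seg q u l r @ rest q u r n"
    using assms rest_append[of a l n q u] rest_append[of l r n q u] rest_snoc[of a l q u]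
    by (simp add: seg_rest)
  then show ?thesis
    by (simp only: sublist_appendI)
qed

section \<open>Admissible words\<close>

lemma heads_unique:
  assumes "sm_hardware H" "c \<in> heads H i" "c \<in> heads H j" "i \<in> {1..len H + 1}" "j \<in> {1..len H + 1}"
  shows "i = j"
  using assms disjoint_family_onD[of "heads H" "{1..len H + 1}" i j]
  by (auto simp only: sm_hardware_def)

lemma tape_outside [simp]: "tape H 0 = {}" "tape H (Suc (len H)) = {}"
  by (simp_all add: tape_def)

definition state_fun :: "('q, 'y) sm_hw \<Rightarrow> nat \<Rightarrow> nat \<Rightarrow> (nat \<Rightarrow> 'q) \<Rightarrow> bool" where
  "state_fun H l r q \<longleftrightarrow> (\<forall>j. l \<le> j \<longrightarrow> j \<le> r \<longrightarrow> q j \<in> heads H j)"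

definition tape_fun :: "('q, 'y) sm_hw \<Rightarrow> nat \<Rightarrow> nat \<Rightarrow> (nat \<Rightarrow> 'y gword) \<Rightarrow> bool" where
  "tape_fun H l r u \<longleftrightarrow> (\<forall>j. l \<le> j \<longrightarrow> j < r \<longrightarrow> u j \<in> Free (tape H j))"

lemma admissible_iff:
  "w \<in> admissible H \<longleftrightarrow>
    (\<exists>q u. w = seg q u 1 (len H + 1) \<and> state_fun H 1 (len H + 1) q \<and> tape_fun H 1 (len H + 1) u)"
  by (simp add: admissible_def state_fun_def tape_fun_def Ball_def less_Suc_eq_le imp_conjL)

text \<open>
  The list \<open>blocks\<close> starts with the empty word before \<open>q\<^sub>1\<close>, so its entry number \<open>i\<close> is \<open>u\<^sub>i\<close>.
\<close>

lemma mu_seg: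
  "mu H (seg q u 1 (len H + 1)) = (restrict u {1..len H}, restrict q {1..len H + 1})"
proof -
  have "blocks (seg q u 1 (len H + 1)) ! i = u i" if "i \<in> {1..len H}" for i
    using blocks_seg[of 1 "len H + 1" "[]" q u "[]"] that diff_less_mono[of i "Suc (len H)" 1]
    by (simp add: nth_Cons' nth_append del: upt_Suc)
  moreover have "state_letters (seg q u 1 (len H + 1)) ! (i - 1) = q i" if "i \<in> {1..len H + 1}" for i
    using state_letters_seg[of 1 "len H + 1" "[]" q u "[]"] that
    by (cases i) (simp_all add: nth_map_upt[of _ "Suc (Suc (len H))" "Suc 0" q] del: upt_Suc)
  ultimately show ?thesis
    by (auto simp: mu_def restrict_def)
qed

lemma mu_bij: "bij_betw (mu H) (admissible H) (lang (graph_hw H) \<times> graph_states H)"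
proof (rule bij_betw_imageI)
  show "inj_on (mu H) (admissible H)"
  proof (rule inj_onI)
    fix w w' assume "w \<in> admissible H" "w' \<in> admissible H" and eq: "mu H w = mu H w'"
    then obtain q u q' u' where w: "w = seg q u 1 (len H + 1)" "w' = seg q' u' 1 (len H + 1)"
      by (auto simp: admissible_iff)
    have "restrict u {1..len H} = restrict u' {1..len H}"
         "restrict q {1..len H + 1} = restrict q' {1..len H + 1}"
      using eq unfolding w mu_seg by simp_all
    then have "u j = u' j" if "1 \<le> j" "j < len H + 1" for j
      using that by (metis Suc_eq_plus1 atLeastAtMost_iff less_Suc_eq_le restrict_apply')
    moreover have "q j = q' j" if "1 \<le> j" "j \<le> len H + 1" for j
      using that \<open>restrict q _ = _\<close> by (metis atLeastAtMost_iff restrict_apply')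
    ultimately show "w = w'"
      unfolding w by (intro seg_cong) auto
  qed
  show "mu H ` admissible H = lang (graph_hw H) \<times> graph_states H"
  proof (intro equalityI subsetI)
    fix c assume "c \<in> mu H ` admissible H"
    then obtain q u where "c = mu H (seg q u 1 (len H + 1))"
        "state_fun H 1 (len H + 1) q" "tape_fun H 1 (len H + 1) u"
      by (auto simp: admissible_iff)
    then show "c \<in> lang (graph_hw H) \<times> graph_states H"
      by (auto simp only: mu_seg) 
         (auto simp: lang_def graph_hw_def graph_states_def state_fun_def tape_fun_def tape_def)
  next
    fix c assume c: "c \<in> lang (graph_hw H) \<times> graph_states H"
    obtain u q where uq: "c = (u, q)" by fastforce
    with c have "restrict u {1..len H} = u" "restrict q {1..len H + 1} = q"
      by (auto simp: lang_def graph_hw_def graph_states_def PiE_restrict)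
    then have "c = mu H (seg q u 1 (len H + 1))"
      by (simp only: uq mu_seg)
    moreover have "seg q u 1 (len H + 1) \<in> admissible H"
      using c unfolding admissible_iff uq
      by (intro exI[of _ q] exI[of _ u])
        (auto simp: lang_def graph_hw_def graph_states_def state_fun_def tape_fun_def tape_def)
    ultimately show "c \<in> mu H ` admissible H"
      by (rule image_eqI)
  qed
qed

lemma mu_inv:
  assumes "c \<in> lang (graph_hw H) \<times> graph_states H"
  shows "mu_inv H c \<in> admissible H" "mu H (mu_inv H c) = c"
  using assms mu_bij[of H] unfolding mu_inv_def bij_betw_def
  by (metis inv_into_into, metis f_inv_into_f)

text \<open>
  The first and the last letter of the subword belong to known sets of state letters, and each set
  contributes a single letter to an admissible word; this fixes the two places where the word is
  cut.
\<close>

lemma admissible_subD: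
  assumes H: "sm_hardware H" and lr: "1 \<le> l" "l \<le> r" "r \<le> len H + 1"
    and x: "x \<in> admissible_sub H l r"
  shows "\<exists>q u. x = seg q u l r \<and> state_fun H l r q \<and> tape_fun H l r u"
proof -
  from x obtain w where "w \<in> admissible H" "sublist x w" "x \<noteq> []"
      "hd x \<in> hl ` heads H l" "last x \<in> hl ` heads H r"
    by (auto simp: admissible_sub_def)
  then obtain c d where cd: "c \<in> heads H l" "d \<in> heads H r" "last x = hl d" and "hd x = hl c"
    by blast
  then obtain x' where x': "x = hl c # x'"
    using \<open>x \<noteq> []\<close> by (metis list.collapse)
  obtain a b where ab: "w = a @ (hl c # x') @ b"
    using \<open>sublist x w\<close> unfolding x' sublist_def by blast
  obtain q u where w: "w = seg q u 1 (len H + 1)"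
    and q: "state_fun H 1 (len H + 1) q" and u: "tape_fun H 1 (len H + 1) u"
    using \<open>w \<in> admissible H\<close> unfolding admissible_iff by blast
  \<comment> \<open>The word at the index \<open>0\<close> has to be empty for the full word to be of the form \<open>rest\<close>.\<close>
  define u0 where "u0 = u(0 := [])"
  have "seg q u 1 (len H + 1) = seg q u0 1 (len H + 1)"
    by (rule seg_cong) (auto simp: u0_def)
  then have eq: "a @ hl c # (x' @ b) = rest q u0 0 (len H + 1)"
    using w ab seg_eq_rest[of u0 q "len H"] by (simp add: u0_def)
  obtain k where k: "0 < k" "k \<le> len H + 1" "c = q k" "x' @ b = rest q u0 k (len H + 1)"
    using rest_split_hl[OF _ eq] by auto
  have "k = l"
    using heads_unique[OF H, of c k l] k q cd lr by (auto simp: state_fun_def)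
  have x_seg: "x = seg q u0 l r"
  proof (cases x' rule: rev_cases)
    case Nil
    then have "c = d" using cd x' by (simp add: hl_def)
    then have "l = r" using heads_unique[OF H, of c l r] cd lr by auto
    then show ?thesis
      using Nil x' k \<open>k = l\<close> by (simp add: seg_rest)
  next
    case (snoc x'' y)
    then have "x'' @ hl d # b = rest q u0 l (len H + 1)"
      using cd x' k \<open>k = l\<close> by simp
    from rest_split_hl[OF _ this] lr obtain k' where k': "l < k'" "k' \<le> len H + 1" "d = q k'"
        "x'' = rest q u0 l (k' - 1) @ tw (u0 (k' - 1))"
      by auto
    have "k' = r"
      using heads_unique[OF H, of d k' r] k' q cd lr by (auto simp: state_fun_def)
    then show ?thesis
      using k' snoc x' k(3) cd(3) \<open>k = l\<close> by (simp add: seg_rest rest_snoc[of l r])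
  qed
  have "seg q u0 l r = seg q u l r"
    using lr by (intro seg_cong) (auto simp: u0_def)
  moreover have "state_fun H l r q" "tape_fun H l r u"
    using q u lr by (auto simp: state_fun_def tape_fun_def)
  ultimately show ?thesis
    using x_seg by (intro exI[of _ q] exI[of _ u]) simp
qed

text \<open>
  The coordinates outside of the range can be filled arbitrarily, but only if there are letters to
  fill them with.
\<close>

lemma admissible_subI:
  assumes lr: "1 \<le> l" "l \<le> r" "r \<le> len H + 1"
    and q: "state_fun H l r q" and u: "tape_fun H l r u"
    and ne: "\<And>j. j \<in> {1..len H + 1} \<Longrightarrow> heads H j \<noteq> {}"
  shows "seg q u l r \<in> admissible_sub H l r"
proof -
  \<comment> \<open>The word is completed by arbitrary letters and empty tape words.\<close>
  define q' where "q' j = (if l \<le> j \<and> j \<le> r then q j else SOME c. c \<in> heads H j)" for j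
  define u' where "u' j = (if l \<le> j \<and> j < r then u j else [])" for j
  have "seg q' u' 1 (len H + 1) \<in> admissible H"
    unfolding admissible_iff using q u ne
    by (intro exI[of _ q'] exI[of _ u'])
       (auto simp: state_fun_def tape_fun_def q'_def u'_def some_in_eq)
  moreover have "seg q' u' l r = seg q u l r"
    using lr by (intro seg_cong) (auto simp: q'_def u'_def)
  then have "sublist (seg q u l r) (seg q' u' 1 (len H + 1))"
    using seg_sublist[of 1 l r "len H + 1" q' u'] lr by simp
  moreover have "last (seg q u l r) = hl (q r)"
    using lr by (cases "l = r") (simp_all add: seg_rest rest_snoc[of l r])
  ultimately show ?thesis
    using q lr by (auto simp: admissible_sub_def state_fun_def seg_rest)
qed

section \<open>Rules in coordinates\<close>

text \<open>
  The coordinates of a part, with the two outer words \<open>v\<^sup>l\<^sup>-\<^sup>1\<close> and \<open>v\<^sup>r\<close> as values of the same function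
  as the inner words of the right-hand side.
\<close>

definition part_form ::
  "('q, 'y) sm_hw \<Rightarrow> ('q, 'y) part \<Rightarrow> nat \<Rightarrow> nat \<Rightarrow>
   (nat \<Rightarrow> 'q) \<Rightarrow> (nat \<Rightarrow> 'y gword) \<Rightarrow> (nat \<Rightarrow> 'q) \<Rightarrow> (nat \<Rightarrow> 'y gword) \<Rightarrow> bool" where
  "part_form H p l r q u q' v \<longleftrightarrow> 1 \<le> l \<and> l \<le> r \<and> r \<le> len H + 1 \<and>
     fst p = seg q u l r \<and> snd p = tw (v (l - 1)) @ seg q' v l r @ tw (v r) \<and>
     state_fun H l r q \<and> tape_fun H l r u \<and> state_fun H l r q' \<and> tape_fun H (l - 1) (Suc r) v"

definition wf_part :: "('q, 'y) sm_hw \<Rightarrow> ('q, 'y) part \<Rightarrow> bool" where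
  "wf_part H p \<longleftrightarrow>
     part_form H p (lo H p) (hi H p) (old_q H p) (old_w H p) (new_q H p) (new_w H p)"

text \<open>
  The functions \<open>lo\<close>, \<open>hi\<close>, \<open>old_q\<close> and so on read the coordinates back from the words.
\<close>

lemma part_form_unique:
  assumes H: "sm_hardware H" and p: "part_form H p l r q u q' v"
  shows "lo H p = l" "hi H p = r"
    "\<And>j. l \<le> j \<Longrightarrow> j \<le> r \<Longrightarrow> old_q H p j = q j"
    "\<And>j. l \<le> j \<Longrightarrow> j \<le> r \<Longrightarrow> new_q H p j = q' j"
    "\<And>j. l \<le> j \<Longrightarrow> j < r \<Longrightarrow> old_w H p j = u j"
    "\<And>j. l - 1 \<le> j \<Longrightarrow> j \<le> r \<Longrightarrow> new_w H p j = v j"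
proof -
  have lr: "1 \<le> l" "l \<le> r" "r \<le> len H + 1"
    using p by (auto simp: part_form_def)
  have sl: "state_letters (fst p) = map q [l..<Suc r]" "state_letters (snd p) = map q' [l..<Suc r]"
    using p state_letters_seg[of l r "[]" q u "[]"] state_letters_seg[of l r "v (l-1)" q' v "v r"] lr
    by (auto simp: part_form_def simp del: upt_Suc)
  have bl: "blocks (fst p) = [] # map u [l..<r] @ [[]]"
    using p blocks_seg[of l r "[]" q u "[]"] by (simp add: part_form_def)
  have bl': "blocks (snd p) = map v [l - 1..<Suc r]"
  proof -
    have "[l - 1..<Suc r] = (l - 1) # [l..<r] @ [r]"
      using lr by (simp add: upt_conv_Cons)
    then show ?thesis
      using p blocks_seg[of l r "v (l-1)" q' v "v r"] by (simp add: part_form_def)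
  qed
  have hd: "hd (state_letters (fst p)) = q l"
    using lr by (simp add: sl upt_conv_Cons del: upt_Suc)
  show lo: "lo H p = l"
    unfolding lo_def hd
  proof (rule the_equality)
    show "l \<in> {1..len H + 1} \<and> q l \<in> heads H l"
      using p by (auto simp: part_form_def state_fun_def)
    then show "j = l" if "j \<in> {1..len H + 1} \<and> q l \<in> heads H j" for j
      using heads_unique[OF H, of "q l" j l] that by blast
  qed
  show "hi H p = r"
    using lr by (simp add: hi_def lo sl)
  show "old_q H p j = q j" "new_q H p j = q' j" if "l \<le> j" "j \<le> r" for j
    using that by (simp_all add: old_q_def new_q_def lo sl del: upt_Suc)
  show "old_w H p j = u j" if "l \<le> j" "j < r" for j
    using that diff_less_mono[of j r l] by (simp add: old_w_def lo bl nth_append Suc_diff_le)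
  show "new_w H p j = v j" if "l - 1 \<le> j" "j \<le> r" for j
    using that lr by (simp add: new_w_def lo bl' del: upt_Suc)
qed

lemma part_form_cong:
  assumes "part_form H p l r q u q' v"
    and "\<And>j. l \<le> j \<Longrightarrow> j \<le> r \<Longrightarrow> q1 j = q j" "\<And>j. l \<le> j \<Longrightarrow> j < r \<Longrightarrow> u1 j = u j"
    and "\<And>j. l \<le> j \<Longrightarrow> j \<le> r \<Longrightarrow> q1' j = q' j" "\<And>j. l - 1 \<le> j \<Longrightarrow> j \<le> r \<Longrightarrow> v1 j = v j"
  shows "part_form H p l r q1 u1 q1' v1"
proof -
  have "seg q1 u1 l r = seg q u l r" "seg q1' v1 l r = seg q' v l r"
    using assms by (auto simp: part_form_def intro!: seg_cong)
  then show ?thesis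
    using assms by (auto simp: part_form_def state_fun_def tape_fun_def)
qed

lemma wf_partI:
  assumes "sm_hardware H" "part_form H p l r q u q' v"
  shows "wf_part H p"
  unfolding wf_part_def part_form_unique(1,2)[OF assms]
  by (rule part_form_cong[OF assms(2)]) (rule part_form_unique[OF assms]; simp)+

text \<open>
  The content of \<open>s_rule\<close> without existential quantifiers: ranges and words are read off from the
  parts themselves. It asks for words of the shape of a subword of an admissible word rather than for
  an admissible word that contains them.
\<close>

definition wf_rule :: "('q, 'y) sm_hw \<Rightarrow> ('n, 'q, 'y) srule \<Rightarrow> bool" where
  "wf_rule H \<tau> \<longleftrightarrow> (\<forall>p\<in>set (parts \<tau>). wf_part H p) \<and>
     sorted_wrt (\<lambda>p p'. hi H p < lo H p') (parts \<tau>)"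

lemma wf_rule_if_s_rule:
  assumes H: "sm_hardware H" and "s_rule H \<tau>"
  shows "wf_rule H \<tau>"
proof -
  from assms(2) obtain l r where s:
    "\<forall>t<length (parts \<tau>). 1 \<le> l t \<and> l t \<le> r t \<and> r t \<le> len H + 1 \<and>
       fst (parts \<tau> ! t) \<in> admissible_sub H (l t) (r t) \<and>
       (\<exists>x\<in>Free (tape H (l t - 1)). \<exists>U'\<in>admissible_sub H (l t) (r t). \<exists>y\<in>Free (tape H (r t)).
          snd (parts \<tau> ! t) = tw x @ U' @ tw y)"
    "\<forall>i j. i < j \<and> j < length (parts \<tau>) \<longrightarrow> r i < l j"
    unfolding s_rule_def by (elim exE conjE)
  have lr: "1 \<le> l t \<and> l t \<le> r t \<and> r t \<le> len H + 1"
    and U: "fst (parts \<tau> ! t) \<in> admissible_sub H (l t) (r t)"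
    and V: "\<exists>x\<in>Free (tape H (l t - 1)). \<exists>U'\<in>admissible_sub H (l t) (r t).
        \<exists>y\<in>Free (tape H (r t)). snd (parts \<tau> ! t) = tw x @ U' @ tw y"
    if "t < length (parts \<tau>)" for t
    using s(1) that by simp_all
  have form: "\<exists>q u q' v. part_form H (parts \<tau> ! t) (l t) (r t) q u q' v" if t: "t < length (parts \<tau>)" for t
  proof -
    obtain q u where 1: "fst (parts \<tau> ! t) = seg q u (l t) (r t)" "state_fun H (l t) (r t) q"
        "tape_fun H (l t) (r t) u"
      using admissible_subD[OF H _ _ _ U[OF t]] lr[OF t] by auto
    obtain x U' y where 2: "x \<in> Free (tape H (l t - 1))" "U' \<in> admissible_sub H (l t) (r t)"
        "y \<in> Free (tape H (r t))" "snd (parts \<tau> ! t) = tw x @ U' @ tw y"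
      using V[OF t] by auto
    obtain q' u' where 3: "U' = seg q' u' (l t) (r t)" "state_fun H (l t) (r t) q'"
        "tape_fun H (l t) (r t) u'"
      using admissible_subD[OF H _ _ _ 2(2)] lr[OF t] by auto
    define v where "v j = (if j < l t then x else if j < r t then u' j else y)" for j
    have "seg q' v (l t) (r t) = U'"
      unfolding 3 using lr[OF t] by (intro seg_cong) (auto simp: v_def)
    moreover have "tape_fun H (l t - 1) (Suc (r t)) v"
      unfolding tape_fun_def
    proof (intro allI impI)
      fix j assume "l t - 1 \<le> j" "j < Suc (r t)"
      then consider "j = l t - 1" "j < l t" | "l t \<le> j" "j < r t" | "j = r t" "l t \<le> j"
        using lr[OF t] by linarith
      then show "v j \<in> Free (tape H j)"
        using 2(1,3) 3(3) by cases (auto simp: v_def tape_fun_def)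
    qed
    ultimately have "part_form H (parts \<tau> ! t) (l t) (r t) q u q' v"
      using 1 2(4) 3(2) lr[OF t] by (auto simp: part_form_def v_def)
    then show ?thesis by blast
  qed
  then have "lo H (parts \<tau> ! t) = l t \<and> hi H (parts \<tau> ! t) = r t \<and> wf_part H (parts \<tau> ! t)"
    if "t < length (parts \<tau>)" for t
    using part_form_unique(1,2)[OF H] wf_partI[OF H] that by metis
  with s(2) show ?thesis
    by (simp add: wf_rule_def all_set_conv_all_nth sorted_wrt_iff_nth_less)
qed

lemma s_rule_if_wf_rule:
  assumes "wf_rule H \<tau>" and ne: "\<And>j. j \<in> {1..len H + 1} \<Longrightarrow> heads H j \<noteq> {}"
  shows "s_rule H \<tau>"
proof -
  have "1 \<le> lo H p \<and> lo H p \<le> hi H p \<and> hi H p \<le> len H + 1 \<and>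
        fst p \<in> admissible_sub H (lo H p) (hi H p) \<and>
        (\<exists>x\<in>Free (tape H (lo H p - 1)). \<exists>U'\<in>admissible_sub H (lo H p) (hi H p).
           \<exists>y\<in>Free (tape H (hi H p)). snd p = tw x @ U' @ tw y)" if "p \<in> set (parts \<tau>)" for p
  proof -
    have p: "part_form H p (lo H p) (hi H p) (old_q H p) (old_w H p) (new_q H p) (new_w H p)"
      using assms(1) that by (auto simp: wf_rule_def wf_part_def)
    have lr: "1 \<le> lo H p" "lo H p \<le> hi H p" "hi H p \<le> len H + 1"
      using p by (auto simp: part_form_def)
    moreover have "fst p \<in> admissible_sub H (lo H p) (hi H p)"
      using p admissible_subI[OF lr _ _ ne] by (auto simp: part_form_def)
    moreover have "seg (new_q H p) (new_w H p) (lo H p) (hi H p) \<in> admissible_sub H (lo H p) (hi H p)"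
      using p by (intro admissible_subI[OF lr _ _ ne]) (auto simp: part_form_def tape_fun_def)
    moreover have "new_w H p (lo H p - 1) \<in> Free (tape H (lo H p - 1))"
        "new_w H p (hi H p) \<in> Free (tape H (hi H p))"
      using p lr by (auto simp: part_form_def tape_fun_def)
    ultimately show ?thesis
      using p by (auto simp: part_form_def)
  qed
  with assms(1) show ?thesis
    unfolding s_rule_def wf_rule_def
    by (intro exI[of _ "\<lambda>t. lo H (parts \<tau> ! t)"] exI[of _ "\<lambda>t. hi H (parts \<tau> ! t)"])
       (auto simp: sorted_wrt_iff_nth_less)
qed

section \<open>Applying a rule\<close>

definition guarding :: "('q, 'y) sm_hw \<Rightarrow> ('q, 'y) part list \<Rightarrow> nat \<Rightarrow> ('q, 'y) part option" where
  "guarding H ps i = find (\<lambda>p. lo H p \<le> i \<and> i < hi H p) ps"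

definition left_mult :: "('q, 'y) sm_hw \<Rightarrow> ('q, 'y) part list \<Rightarrow> nat \<Rightarrow> 'y gword" where
  "left_mult H ps i = (case find (\<lambda>p. hi H p = i) ps of Some p \<Rightarrow> new_w H p i | None \<Rightarrow> [])"

definition right_mult :: "('q, 'y) sm_hw \<Rightarrow> ('q, 'y) part list \<Rightarrow> nat \<Rightarrow> 'y gword" where
  "right_mult H ps i = (case find (\<lambda>p. lo H p = i + 1) ps of Some p \<Rightarrow> new_w H p i | None \<Rightarrow> [])"

text \<open>
  The state letters after the replacement of the parts \<open>ps\<close>, if \<open>letter\<close> is \<open>new_q H\<close>. The same
  expression with \<open>old_q H\<close> describes the source of an edge, with \<open>\<theta>\<close> in place of \<open>q\<close>.
\<close>

definition next_state :: "('q, 'y) sm_hw \<Rightarrow> (('q, 'y) part \<Rightarrow> nat \<Rightarrow> 'q) \<Rightarrow> ('q, 'y) part list \<Rightarrow>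
    (nat \<Rightarrow> 'q) \<Rightarrow> nat \<Rightarrow> 'q" where
  "next_state H letter ps q j =
     (case find (\<lambda>p. lo H p \<le> j \<and> j \<le> hi H p) ps of Some p \<Rightarrow> letter p j | None \<Rightarrow> q j)"

text \<open>
  The tape words after the replacement and before free reduction. An index in the interior of a part
  is overwritten. Any other index lies between two state letters that are not in one part; the part
  that ends on its left contributes its last word and the part that starts on its right its first
  one.
\<close>

definition next_tape :: "('q, 'y) sm_hw \<Rightarrow> ('q, 'y) part list \<Rightarrow> (nat \<Rightarrow> 'y gword) \<Rightarrow> nat \<Rightarrow> 'y gword" where
  "next_tape H ps u i = (case guarding H ps i of Some p \<Rightarrow> new_w H p i
     | None \<Rightarrow> left_mult H ps i @ u i @ right_mult H ps i)"

definition matches :: "('q, 'y) sm_hw \<Rightarrow> ('q, 'y) part list \<Rightarrow>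
    (nat \<Rightarrow> 'q) \<Rightarrow> (nat \<Rightarrow> 'y gword) \<Rightarrow> bool" where
  "matches H ps q u \<longleftrightarrow> (\<forall>p\<in>set ps. (\<forall>j\<in>{lo H p..hi H p}. q j = old_q H p j) \<and>
     (\<forall>j\<in>{lo H p..<hi H p}. u j = old_w H p j))"

lemma wf_partD:
  assumes "wf_part H p"
  shows "1 \<le> lo H p" "lo H p \<le> hi H p" "hi H p \<le> len H + 1"
    "fst p = seg (old_q H p) (old_w H p) (lo H p) (hi H p)"
    "snd p = tw (new_w H p (lo H p - 1)) @ seg (new_q H p) (new_w H p) (lo H p) (hi H p) @
       tw (new_w H p (hi H p))"
    "\<And>j. lo H p \<le> j \<Longrightarrow> j \<le> hi H p \<Longrightarrow> old_q H p j \<in> heads H j"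
    "\<And>j. lo H p \<le> j \<Longrightarrow> j \<le> hi H p \<Longrightarrow> new_q H p j \<in> heads H j"
    "\<And>j. lo H p \<le> j \<Longrightarrow> j < hi H p \<Longrightarrow> old_w H p j \<in> Free (tape H j)"
    "\<And>j. lo H p - 1 \<le> j \<Longrightarrow> j \<le> hi H p \<Longrightarrow> new_w H p j \<in> Free (tape H j)"
  using assms by (auto simp: wf_part_def part_form_def state_fun_def tape_fun_def)

lemma find_eq_NoneI: "(\<And>p. p \<in> set ps \<Longrightarrow> \<not> P p) \<Longrightarrow> find P ps = None"
  by (simp add: find_None_iff)

text \<open>
  To the left of all parts nothing changes, except for the word that the first part sends to its
  left neighbour.
\<close>

lemma next_before:
  assumes "\<forall>p\<in>set ps. r < lo H p \<and> lo H p \<le> hi H p" "i \<le> r"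
  shows "guarding H ps i = None" "left_mult H ps i = []"
    "next_state H f ps q i = q i"
    "i < r \<Longrightarrow> right_mult H ps i = []"
    "next_tape H ps u i = u i @ right_mult H ps i"
    "i < r \<Longrightarrow> next_tape H ps u i = u i"
proof -
  show g: "guarding H ps i = None"
    using assms by (auto simp: guarding_def intro!: find_eq_NoneI)
  show l: "left_mult H ps i = []"
    using assms by (subst left_mult_def, subst find_eq_NoneI) auto
  show "next_state H f ps q i = q i"
    using assms by (subst next_state_def, subst find_eq_NoneI) auto
  show r: "i < r \<Longrightarrow> right_mult H ps i = []"
    using assms by (subst right_mult_def, subst find_eq_NoneI) auto
  show "next_tape H ps u i = u i @ right_mult H ps i"
    by (simp add: next_tape_def g l)
  then show "i < r \<Longrightarrow> next_tape H ps u i = u i"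
    by (simp add: r)
qed

text \<open>
  The effect of a first part does not interfere with that of the later ones, since at a common
  neighbouring index the first part writes on the left side of the tape word and the next part on
  its right side.
\<close>

lemma next_Cons:
  assumes p: "wf_part H p" and ps: "\<forall>p'\<in>set ps. hi H p < lo H p' \<and> lo H p' \<le> hi H p'"
  shows "lo H p \<le> i \<Longrightarrow> i \<le> hi H p \<Longrightarrow> next_state H f (p # ps) q i = f p i"
    "hi H p < i \<Longrightarrow> next_state H f (p # ps) q i = next_state H f ps q i"
    "lo H p \<le> i \<Longrightarrow> i < hi H p \<Longrightarrow> next_tape H (p # ps) u i = new_w H p i"
    "hi H p < i \<Longrightarrow> next_tape H (p # ps) u i = next_tape H ps u i"
    "next_tape H (p # ps) u (hi H p) = new_w H p (hi H p) @ next_tape H ps u (hi H p)"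
    "next_tape H (p # ps) u (lo H p - 1) = u (lo H p - 1) @ new_w H p (lo H p - 1)"
proof -
  have lr: "1 \<le> lo H p" "lo H p \<le> hi H p"
    using wf_partD[OF p] by simp_all
  show "lo H p \<le> i \<Longrightarrow> i \<le> hi H p \<Longrightarrow> next_state H f (p # ps) q i = f p i"
    "hi H p < i \<Longrightarrow> next_state H f (p # ps) q i = next_state H f ps q i"
    "lo H p \<le> i \<Longrightarrow> i < hi H p \<Longrightarrow> next_tape H (p # ps) u i = new_w H p i"
    by (simp_all add: next_state_def next_tape_def guarding_def)
  show "next_tape H (p # ps) u i = next_tape H ps u i" if "hi H p < i"
  proof -
    have "guarding H (p # ps) i = guarding H ps i" "left_mult H (p # ps) i = left_mult H ps i"
        "right_mult H (p # ps) i = right_mult H ps i"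
      using lr that by (simp_all add: guarding_def left_mult_def right_mult_def)
    then show ?thesis by (simp only: next_tape_def)
  qed
  have "guarding H (p # ps) (hi H p) = guarding H ps (hi H p)"
       "right_mult H (p # ps) (hi H p) = right_mult H ps (hi H p)"
    using lr by (simp_all add: guarding_def right_mult_def)
  then show "next_tape H (p # ps) u (hi H p) = new_w H p (hi H p) @ next_tape H ps u (hi H p)"
    using next_before(1,2)[OF ps order_refl] by (simp add: next_tape_def left_mult_def)
  have "\<not> lo H p \<le> lo H p - 1" "hi H p \<noteq> lo H p - 1"
    using lr by simp_all
  then have "guarding H (p # ps) (lo H p - 1) = guarding H ps (lo H p - 1)"
       "left_mult H (p # ps) (lo H p - 1) = left_mult H ps (lo H p - 1)"
    by (simp_all add: guarding_def left_mult_def)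
  then show "next_tape H (p # ps) u (lo H p - 1) = u (lo H p - 1) @ new_w H p (lo H p - 1)"
    using next_before(1,2)[OF ps, of "lo H p - 1"] lr by (simp add: next_tape_def right_mult_def)
qed

text \<open>
  The result of a replacement decomposes as the inductive definition of \<open>replaced\<close> requires. If the
  part reaches the right end of the word, there is no tape word to receive its last word; the latter
  is empty then because the tape alphabet number \<open>N + 1\<close> is.
\<close>

lemma rest_next_Cons:
  assumes p: "wf_part H p" and ps: "\<forall>p'\<in>set ps. hi H p < lo H p' \<and> lo H p' \<le> hi H p'"
    and j: "j < lo H p" and n: "n = len H + 1"
  shows "rest (next_state H (new_q H) (p # ps) q) (next_tape H (p # ps) u) j n =
    (rest q u j (lo H p - 1) @ tw (u (lo H p - 1))) @ snd p @
    rest (next_state H (new_q H) ps q) (next_tape H ps u) (hi H p) n"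
proof -
  define l r where lr_def: "l = lo H p" "r = hi H p"
  define Q U Q' U' where QU: "Q = next_state H (new_q H) (p # ps) q" "U = next_tape H (p # ps) u"
    "Q' = next_state H (new_q H) ps q" "U' = next_tape H ps u"
  have lr: "1 \<le> l" "l \<le> r" "r \<le> n" "j \<le> l - 1" "l - 1 < l" "l - 1 < n" "l - 1 \<le> n" "l \<le> n"
    using wf_partD[OF p] j n by (auto simp: lr_def)
  have all: "\<forall>p'\<in>set (p # ps). l - 1 < lo H p' \<and> lo H p' \<le> hi H p'"
    using wf_partD(1,2)[OF p] ps by (auto simp: lr_def)
  have before: "rest Q U j (l - 1) = rest q u j (l - 1)"
    unfolding QU by (rule rest_cong) (use next_before[OF all] in simp)
  have Ul: "U (l - 1) = u (l - 1) @ new_w H p (l - 1)"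
    unfolding QU lr_def by (rule next_Cons(6)[OF p ps])
  have inside: "rest Q U l r = rest (new_q H p) (new_w H p) l r"
    unfolding QU by (rule rest_cong) (use next_Cons(1,3)[OF p ps] in \<open>simp add: lr_def\<close>)
  have Ql: "Q l = new_q H p l"
    unfolding QU by (rule next_Cons(1)[OF p ps]) (use lr in \<open>simp_all add: lr_def\<close>)
  have after: "rest Q U r n = tw (new_w H p r) @ rest Q' U' r n"
  proof (cases "r = n")
    case True
    then have "new_w H p r = []"
      using wf_partD(9)[OF p, of r] lr by (simp add: lr_def n)
    with True show ?thesis by simp
  next
    case False
    then have "r < n" using lr by simp
    have "rest Q U (Suc r) n = rest Q' U' (Suc r) n"
      unfolding QU by (rule rest_cong) (use next_Cons(2,4)[OF p ps] in \<open>simp add: lr_def\<close>)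
    moreover have "U r = new_w H p r @ U' r" "Q (Suc r) = Q' (Suc r)"
      unfolding QU using next_Cons(2,5)[OF p ps] by (simp_all add: lr_def)
    ultimately show ?thesis
      by (simp add: rest_Cons[OF \<open>r < n\<close>] tw_append)
  qed
  have "rest Q U j n = rest Q U j (l - 1) @ tw (U (l - 1)) @ hl (Q l) # rest Q U l r @ rest Q U r n"
    using lr rest_append[of j "l - 1" n Q U] rest_Cons[of "l - 1" n Q U] rest_append[of l r n Q U]
    by simp
  then show ?thesis
    unfolding before Ul inside Ql after wf_partD(5)[OF p] seg_rest
    by (simp add: QU lr_def tw_append)
qed

inductive_cases replaced_NilE: "replaced [] w v"
inductive_cases replaced_ConsE: "replaced (p # ps) w v"

text \<open>
  Simultaneous replacement in coordinates. The disjointness of the sets of state letters enters to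
  see that the first part can only be applied at its own range; what remains to its right is again a
  word of the form \<open>rest\<close>, so the induction proceeds with the later parts there.
\<close>

lemma replaced_rest:
  assumes H: "sm_hardware H" and n: "n = len H + 1" and q: "state_fun H 1 n q"
    and "\<forall>p\<in>set ps. wf_part H p \<and> j < lo H p" "sorted_wrt (\<lambda>p p'. hi H p < lo H p') ps" "j \<le> n"
  shows "replaced ps (rest q u j n) v \<longleftrightarrow>
    matches H ps q u \<and> v = rest (next_state H (new_q H) ps q) (next_tape H ps u) j n"
  using assms(4-6)
proof (induction ps arbitrary: j v)
  case Nil
  have "next_state H (new_q H) [] q = q" "next_tape H [] u = u"
    by (simp_all add: fun_eq_iff next_state_def next_tape_def guarding_def left_mult_def right_mult_def)
  then show ?case
    by (auto simp: matches_def elim: replaced_NilE intro: replaced.intros)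
next
  case (Cons p ps)
  define l r where lr_def: "l = lo H p" "r = hi H p"
  have p: "wf_part H p" and j: "j < l"
    and ps: "\<forall>p'\<in>set ps. hi H p < lo H p' \<and> lo H p' \<le> hi H p'"
    using Cons.prems wf_partD(2)[of H] by (simp_all add: lr_def)
  have lr: "1 \<le> l" "l \<le> r" "r \<le> n"
    using wf_partD[OF p] n by (auto simp: lr_def)
  have IH: "replaced ps (rest q u r n) v \<longleftrightarrow>
      matches H ps q u \<and> v = rest (next_state H (new_q H) ps q) (next_tape H ps u) r n" for v
    using Cons.prems lr ps by (intro Cons.IH) (auto simp: lr_def)
  note result = rest_next_Cons[OF p ps j[unfolded lr_def] n, of q u, folded lr_def]
  show ?case
  proof
    assume "replaced (p # ps) (rest q u j n) v"
    then obtain a w v' where a: "rest q u j n = a @ fst p @ w" and v: "v = a @ snd p @ v'"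
      and w: "replaced ps w v'"
      by (auto elim: replaced_ConsE)
    have "a @ hl (old_q H p l) # (rest (old_q H p) (old_w H p) l r @ w) = rest q u j n"
      unfolding a wf_partD(4)[OF p] by (simp add: seg_rest lr_def)
    from rest_split_hl[OF Cons.prems(3) this] obtain k where k: "j < k" "k \<le> n" "old_q H p l = q k"
      "a = rest q u j (k - 1) @ tw (u (k - 1))" "rest (old_q H p) (old_w H p) l r @ w = rest q u k n"
      by (elim exE conjE)
    \<comment> \<open>The occurrence starts at the letter number \<open>k\<close>, and this letter belongs to the set number \<open>l\<close>.\<close>
    have "k = l"
      using heads_unique[OF H, of "q k" k l] q k wf_partD(6)[OF p, of l] lr n
      by (auto simp: state_fun_def lr_def)
    have w': "w = rest q u r n"
        "\<forall>i. l \<le> i \<longrightarrow> i < r \<longrightarrow> old_w H p i = u i \<and> old_q H p (Suc i) = q (Suc i)"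
      using rest_append_eq[OF lr(2,3)] k(5) \<open>k = l\<close> by blast+
    have "q i = old_q H p i" if "l \<le> i" "i \<le> r" for i
    proof (cases "i = l")
      case False
      with that obtain i' where "i = Suc i'" "l \<le> i'" "i' < r"
        by (cases i) auto
      with w'(2) show ?thesis by simp
    qed (use k(3) \<open>k = l\<close> in simp)
    then have "matches H (p # ps) q u"
      using IH w'(2) w[unfolded w'(1)] by (simp add: matches_def lr_def)
    moreover have "v = rest (next_state H (new_q H) (p # ps) q) (next_tape H (p # ps) u) j n"
      using IH w[unfolded w'(1)] v k(4) \<open>k = l\<close> by (simp add: result)
    ultimately show "matches H (p # ps) q u \<and>
        v = rest (next_state H (new_q H) (p # ps) q) (next_tape H (p # ps) u) j n"
      by blast
  next
    assume *: "matches H (p # ps) q u \<and>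
        v = rest (next_state H (new_q H) (p # ps) q) (next_tape H (p # ps) u) j n"
    then have "fst p = seg q u l r"
      unfolding wf_partD(4)[OF p] lr_def[symmetric] using lr
      by (intro seg_cong) (auto simp: matches_def lr_def)
    moreover have "rest q u j n =
        rest q u j (l - 1) @ tw (u (l - 1)) @ hl (q l) # rest q u l r @ rest q u r n"
      using lr j rest_append[of j "l - 1" n q u] rest_Cons[of "l - 1" n q u] rest_append[of l r n q u]
      by simp
    ultimately have w: "rest q u j n = (rest q u j (l - 1) @ tw (u (l - 1))) @ fst p @ rest q u r n"
      by (simp add: seg_rest)
    have "replaced ps (rest q u r n) (rest (next_state H (new_q H) ps q) (next_tape H ps u) r n)"
      using * by (simp add: IH matches_def)
    from replaced.intros(2)[OF this, of "fst p" "snd p" "rest q u j (l - 1) @ tw (u (l - 1))"]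
    show "replaced (p # ps) (rest q u j n) v"
      using * unfolding w result by simp
  qed
qed

lemma sublist_if_replaced: "replaced ps w v \<Longrightarrow> p \<in> set ps \<Longrightarrow> sublist (fst p) w"
proof (induction rule: replaced.induct)
  case (2 ps w w' U V a)
  have "sublist w (a @ U @ w)"
    using sublist_appendI[of w "a @ U" "[]"] by simp
  with 2 show ?case
    by (auto intro: sublist_order.order_trans)
qed simp

lemma matches_cong:
  assumes "\<And>p. p \<in> set ps \<Longrightarrow> 1 \<le> lo H p" "\<And>j. 1 \<le> j \<Longrightarrow> q j = q' j" "\<And>j. 1 \<le> j \<Longrightarrow> u j = u' j"
  shows "matches H ps q u \<longleftrightarrow> matches H ps q' u'"
  unfolding matches_def using assms by (intro ball_cong conj_cong refl) (metis atLeastAtMost_iff atLeastLessThan_iff order_trans)+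

text \<open>
  The coordinate \<open>0\<close> is an artefact of writing a word as \<open>rest\<close>. A rule could send a word there only
  from a part that starts at \<open>q\<^sub>1\<close>, and that word is empty since the tape alphabet number \<open>0\<close> is.
\<close>

lemma rule_step_iff:
  assumes H: "sm_hardware H" and \<tau>: "wf_rule H \<tau>" and q: "state_fun H 1 (len H + 1) q"
  shows "rule_step \<tau> (seg q u 1 (len H + 1)) w' \<longleftrightarrow> matches H (parts \<tau>) q u \<and>
    w' = seg (next_state H (new_q H) (parts \<tau>) q) (\<lambda>i. free_red (next_tape H (parts \<tau>) u i)) 1 (len H + 1)"
proof -
  define n where "n = len H + 1"
  define u0 where "u0 = u(0 := [])"
  define Q U where "Q = next_state H (new_q H) (parts \<tau>) q" and "U = next_tape H (parts \<tau>) u0"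
  have wf: "\<forall>p\<in>set (parts \<tau>). wf_part H p" and sorted: "sorted_wrt (\<lambda>p p'. hi H p < lo H p') (parts \<tau>)"
    using \<tau> by (auto simp: wf_rule_def)
  have pos: "\<forall>p\<in>set (parts \<tau>). wf_part H p \<and> 0 < lo H p"
    using wf wf_partD(1) by (metis One_nat_def Suc_le_eq)
  have pos': "\<forall>p\<in>set (parts \<tau>). 0 < lo H p \<and> lo H p \<le> hi H p"
    using pos wf_partD(2) by blast
  have seg0: "seg q u 1 n = rest q u0 0 n"
    using seg_eq_rest[of u0 q "len H"] seg_cong[of 1 n q q u u0] by (simp add: n_def u0_def)
  have "right_mult H (parts \<tau>) 0 = []"
  proof (cases "find (\<lambda>p. lo H p = 0 + 1) (parts \<tau>)")
    case (Some p)
    then have "p \<in> set (parts \<tau>)" "lo H p = 1"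
      by (auto simp: find_Some_iff)
    then show ?thesis
      using wf wf_partD(9)[of H p 0] Some by (simp add: right_mult_def)
  qed (simp add: right_mult_def)
  then have "U 0 = []"
    using next_before(5)[OF pos', of 0 u0] by (simp add: U_def u0_def)
  then have "free_red (rest Q U 0 n) = seg Q (\<lambda>i. free_red (U i)) 1 n"
    using seg_eq_rest[of "\<lambda>i. free_red (U i)" Q "len H"] by (simp add: free_red_rest n_def)
  also have "\<dots> = seg Q (\<lambda>i. free_red (next_tape H (parts \<tau>) u i)) 1 n"
    by (rule seg_cong) (auto simp: U_def u0_def next_tape_def n_def split: option.splits)
  finally have red: "free_red (rest Q U 0 n) = \<dots>" .
  have m: "matches H (parts \<tau>) q u0 \<longleftrightarrow> matches H (parts \<tau>) q u"
    using pos by (intro matches_cong) (auto simp: u0_def Suc_le_eq)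
  have "replaced (parts \<tau>) (rest q u0 0 n) v \<longleftrightarrow> matches H (parts \<tau>) q u \<and> v = rest Q U 0 n" for v
    using replaced_rest[OF H n_def q[folded n_def] pos sorted, of u0 v] by (simp add: Q_def U_def m)
  then show ?thesis
    unfolding rule_step_def rule_applicable_def n_def[symmetric] seg0
    using sublist_if_replaced red by (metis Q_def)
qed

text \<open>
  The ranges of the parts are disjoint, so a property that forces parts to have a common state letter
  selects at most one of them.
\<close>

lemma find_parts:
  assumes \<tau>: "wf_rule H \<tau>" and p: "p \<in> set (parts \<tau>)" "P p"
    and u: "\<And>p'. p' \<in> set (parts \<tau>) \<Longrightarrow> P p' \<Longrightarrow>
      \<exists>j. lo H p' \<le> j \<and> j \<le> hi H p' \<and> lo H p \<le> j \<and> j \<le> hi H p"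
  shows "find P (parts \<tau>) = Some p"
proof -
  obtain p' where p': "find P (parts \<tau>) = Some p'"
    using p by (metis find_None_iff not_None_eq)
  then have "p' \<in> set (parts \<tau>)" "P p'"
    by (auto simp: find_Some_iff)
  then obtain j where j: "lo H p' \<le> j" "j \<le> hi H p'" "lo H p \<le> j" "j \<le> hi H p"
    using u by blast
  have "p' = p"
  proof (rule ccontr)
    assume "p' \<noteq> p"
    with p(1) \<open>p' \<in> _\<close> have "hi H p < lo H p' \<or> hi H p' < lo H p"
      using \<tau> by (auto simp: wf_rule_def in_set_conv_nth sorted_wrt_iff_nth_less) (metis linorder_neqE_nat)
    with j show False by linarith
  qed
  with p' show ?thesis by simp
qed

lemma
  assumes \<tau>: "wf_rule H \<tau>" and p: "p \<in> set (parts \<tau>)"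
  shows find_touching: "lo H p \<le> j \<Longrightarrow> j \<le> hi H p \<Longrightarrow>
      find (\<lambda>p. lo H p \<le> j \<and> j \<le> hi H p) (parts \<tau>) = Some p"
    and find_guarding: "lo H p \<le> i \<Longrightarrow> i < hi H p \<Longrightarrow>
      find (\<lambda>p. lo H p \<le> i \<and> i < hi H p) (parts \<tau>) = Some p"
    and find_hi: "hi H p = i \<Longrightarrow> find (\<lambda>p. hi H p = i) (parts \<tau>) = Some p"
    and find_lo: "lo H p = i \<Longrightarrow> find (\<lambda>p. lo H p = i) (parts \<tau>) = Some p"
proof -
  have lr: "lo H p' \<le> hi H p'" if "p' \<in> set (parts \<tau>)" for p'
    using that \<tau> wf_partD(2)[of H p'] by (simp add: wf_rule_def)
  show "lo H p \<le> j \<Longrightarrow> j \<le> hi H p \<Longrightarrow> find (\<lambda>p. lo H p \<le> j \<and> j \<le> hi H p) (parts \<tau>) = Some p"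
    by (rule find_parts[OF \<tau> p]) auto
  show "lo H p \<le> i \<Longrightarrow> i < hi H p \<Longrightarrow> find (\<lambda>p. lo H p \<le> i \<and> i < hi H p) (parts \<tau>) = Some p"
    by (rule find_parts[OF \<tau> p]) (auto intro: exI[of _ i])
  show "hi H p = i \<Longrightarrow> find (\<lambda>p. hi H p = i) (parts \<tau>) = Some p"
    by (rule find_parts[OF \<tau> p]) (simp, metis lr p order_refl)
  show "lo H p = i \<Longrightarrow> find (\<lambda>p. lo H p = i) (parts \<tau>) = Some p"
    by (rule find_parts[OF \<tau> p]) (simp, metis lr p order_refl)
qed

section \<open>Rules and their edges\<close>

lemma rule_action_eq:
  "lmul (rule_action H \<tau>) = (\<lambda>i\<in>{1..len H}. case guarding H (parts \<tau>) i of
     Some p \<Rightarrow> free_red (new_w H p i @ winv (old_w H p i)) | None \<Rightarrow> left_mult H (parts \<tau>) i)"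
  "rmul (rule_action H \<tau>) = (\<lambda>i\<in>{1..len H}. right_mult H (parts \<tau>) i)"
  "guard (rule_action H \<tau>) =
     (\<lambda>i\<in>{1..len H}. map_option (\<lambda>p. old_w H p i) (guarding H (parts \<tau>) i))"
  by (simp_all only: rule_action_def guarding_def left_mult_def right_mult_def action.simps)

lemma rule_state_eq: "rule_state H \<tau> f \<theta> = restrict (next_state H f (parts \<tau>) \<theta>) {1..len H + 1}"
  unfolding rule_state_def by (rule restrict_ext) (simp add: next_state_def)

lemma find_SomeD: "find P ps = Some p \<Longrightarrow> p \<in> set ps \<and> P p"
  by (auto simp: find_Some_iff)

lemma next_state_touched:
  "wf_rule H \<tau> \<Longrightarrow> p \<in> set (parts \<tau>) \<Longrightarrow> lo H p \<le> j \<Longrightarrow> j \<le> hi H p \<Longrightarrow>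
   next_state H f (parts \<tau>) \<theta> j = f p j"
  by (simp add: next_state_def find_touching)

lemma next_state_untouched: "j \<in> untouched H \<tau> \<Longrightarrow> next_state H f (parts \<tau>) \<theta> j = \<theta> j"
  unfolding next_state_def by (subst find_eq_NoneI) (auto simp: untouched_def touched_def)

lemma touched_cases:
  assumes "j \<in> {1..len H + 1}"
  obtains (touched) p where "p \<in> set (parts \<tau>)" "lo H p \<le> j" "j \<le> hi H p"
    | (untouched) "j \<in> untouched H \<tau>"
proof (cases "j \<in> touched H \<tau>")
  case True
  then show ?thesis using touched by (force simp: touched_def)
next
  case False
  then show ?thesis using assms untouched by (simp add: untouched_def)
qed

lemma wf_ruleD: "wf_rule H \<tau> \<Longrightarrow> p \<in> set (parts \<tau>) \<Longrightarrow> wf_part H p"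
  by (simp add: wf_rule_def)

text \<open>
  With \<open>f = old_q H\<close>: the source of an edge of \<open>E\<^sub>\<tau>\<close> is the state of a given word iff the touched
  letters match, and then \<open>\<theta>\<close> is known. This gives existence as well as uniqueness of the edge that
  simulates a rule.
\<close>

lemma next_state_eq_iff:
  assumes \<tau>: "wf_rule H \<tau>" and \<theta>: "\<theta> \<in> (\<Pi>\<^sub>E j\<in>untouched H \<tau>. heads H j)"
  shows "restrict q {1..len H + 1} = restrict (next_state H f (parts \<tau>) \<theta>) {1..len H + 1} \<longleftrightarrow>
    (\<forall>p\<in>set (parts \<tau>). \<forall>j\<in>{lo H p..hi H p}. q j = f p j) \<and> \<theta> = restrict q (untouched H \<tau>)"
    (is "?l \<longleftrightarrow> ?r \<and> ?t")
proof
  assume l: ?l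
  have eq: "q j = next_state H f (parts \<tau>) \<theta> j" if "j \<in> {1..len H + 1}" for j
    using that fun_cong[OF l, of j] by simp
  have ?r
  proof (intro ballI)
    fix p j assume p: "p \<in> set (parts \<tau>)" and j: "j \<in> {lo H p..hi H p}"
    then have "j \<in> {1..len H + 1}"
      using wf_partD(1,3)[OF wf_ruleD[OF \<tau> p]] by auto
    then show "q j = f p j"
      using eq next_state_touched[OF \<tau> p] j by simp
  qed
  moreover have ?t
  proof (rule extensionalityI[of _ "untouched H \<tau>"])
    show "\<theta> j = restrict q (untouched H \<tau>) j" if "j \<in> untouched H \<tau>" for j
      using that eq[of j] next_state_untouched[OF that, of f \<theta>] by (simp add: untouched_def)
  qed (use \<theta> in \<open>auto simp: PiE_def\<close>)
  ultimately show "?r \<and> ?t" ..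
next
  assume r: "?r \<and> ?t"
  show ?l
  proof (rule restrict_ext)
    fix j assume j: "j \<in> {1..len H + 1}"
    show "q j = next_state H f (parts \<tau>) \<theta> j"
      using j
    proof (cases rule: touched_cases[where \<tau> = \<tau>])
      case (touched p)
      then show ?thesis using r next_state_touched[OF \<tau>] by simp
    next
      case untouched
      then show ?thesis using r next_state_untouched by fastforce
    qed
  qed
qed

lemma next_state_cong:
  assumes \<tau>: "wf_rule H \<tau>" and "\<And>j. j \<in> untouched H \<tau> \<Longrightarrow> q j = q' j" "j \<in> {1..len H + 1}"
  shows "next_state H f (parts \<tau>) q j = next_state H f (parts \<tau>) q' j"
  using assms(3)
proof (cases rule: touched_cases[where \<tau> = \<tau>])
  case untouched
  then show ?thesis using assms(2) by (simp add: next_state_untouched)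
qed (simp add: next_state_touched[OF \<tau>])

lemma guarding_Some_iff:
  assumes "wf_rule H \<tau>"
  shows "guarding H (parts \<tau>) i = Some p \<longleftrightarrow> p \<in> set (parts \<tau>) \<and> lo H p \<le> i \<and> i < hi H p"
  using find_guarding[OF assms, of p i] by (auto simp: guarding_def find_Some_iff)

text \<open>
  A part that starts right after a guarded index would overlap with the guarding part.
\<close>

lemma right_mult_guarded:
  assumes \<tau>: "wf_rule H \<tau>" and p: "p \<in> set (parts \<tau>)" "lo H p \<le> i" "i < hi H p"
  shows "right_mult H (parts \<tau>) i = []"
proof -
  have False if "p' \<in> set (parts \<tau>)" "lo H p' = i + 1" for p'
    using find_touching[OF \<tau> p(1), of "i + 1"] find_touching[OF \<tau> that(1), of "i + 1"] that p
      wf_partD(2)[OF wf_ruleD[OF \<tau> that(1)]] by simp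
  then show ?thesis
    unfolding right_mult_def by (subst find_eq_NoneI) auto
qed

lemma accepts_iff:
  assumes \<tau>: "wf_rule H \<tau>"
  shows "accepts (graph_hw H) (rule_action H \<tau>) (restrict u {1..len H}) \<longleftrightarrow>
    (\<forall>p\<in>set (parts \<tau>). \<forall>j\<in>{lo H p..<hi H p}. u j = old_w H p j)" (is "?l \<longleftrightarrow> ?r")
proof
  assume l: ?l
  show ?r
  proof (intro ballI)
    fix p j assume p: "p \<in> set (parts \<tau>)" and j: "j \<in> {lo H p..<hi H p}"
    then have "j \<in> {1..len H}"
      using wf_partD(1,3)[OF wf_ruleD[OF \<tau> p]] by auto
    then show "u j = old_w H p j"
      using bspec[OF l[unfolded accepts_def], of j] guarding_Some_iff[OF \<tau>, of j p] p j
      by (auto simp: graph_hw_def rule_action_eq)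
  qed
next
  assume r: ?r
  show ?l
    unfolding accepts_def
  proof
    fix i assume "i \<in> idx (graph_hw H)"
    then show "guard (rule_action H \<tau>) i = None \<or>
        guard (rule_action H \<tau>) i = Some (restrict u {1..len H} i)"
    proof (cases "guarding H (parts \<tau>) i")
      case (Some p)
      then have "p \<in> set (parts \<tau>)" "lo H p \<le> i" "i < hi H p"
        using guarding_Some_iff[OF \<tau>] by blast+
      with r Some \<open>i \<in> _\<close> show ?thesis
        by (simp add: graph_hw_def rule_action_eq)
    qed (use \<open>i \<in> _\<close> in \<open>simp add: graph_hw_def rule_action_eq\<close>)
  qed
qed

text \<open>
  At a guarded index \<open>v u\<inverse> u\<close> reduces to \<open>v\<close>.
\<close>

lemma transform_eq:
  assumes \<tau>: "wf_rule H \<tau>"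
    and u: "\<forall>p\<in>set (parts \<tau>). \<forall>j\<in>{lo H p..<hi H p}. u j = old_w H p j"
  shows "transform (graph_hw H) (rule_action H \<tau>) (restrict u {1..len H}) =
    restrict (\<lambda>i. free_red (next_tape H (parts \<tau>) u i)) {1..len H}"
  unfolding transform_def graph_hw_def sg_hw.simps
proof (rule restrict_ext)
  fix i assume i: "i \<in> {1..len H}"
  show "free_red (lmul (rule_action H \<tau>) i @ restrict u {1..len H} i @ rmul (rule_action H \<tau>) i) =
      free_red (next_tape H (parts \<tau>) u i)"
  proof (cases "guarding H (parts \<tau>) i")
    case None
    with i show ?thesis
      by (simp add: rule_action_eq next_tape_def)
  next
    case (Some p)
    then have p: "p \<in> set (parts \<tau>)" "lo H p \<le> i" "i < hi H p"
      using guarding_Some_iff[OF \<tau>] by blast+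
    show ?thesis
      using i u p Some right_mult_guarded[OF \<tau> p] by (simp add: rule_action_eq next_tape_def)
  qed
qed

definition rule_edge :: "('q, 'y) sm_hw \<Rightarrow> ('n, 'q, 'y) srule \<Rightarrow> (nat \<Rightarrow> 'q) \<Rightarrow> ('n, 'q, 'y) redge" where
  "rule_edge H \<tau> \<theta> = \<lparr> tag = (\<tau>, \<theta>),
     src = rule_state H \<tau> (old_q H) \<theta>, dst = rule_state H \<tau> (new_q H) \<theta>, act = rule_action H \<tau> \<rparr>"

lemma rule_edges_eq: "rule_edges H \<tau> = rule_edge H \<tau> ` (\<Pi>\<^sub>E j\<in>untouched H \<tau>. heads H j)"
  by (simp add: rule_edges_def rule_edge_def)

lemma rule_edge_simps [simp]:
  "tag (rule_edge H \<tau> \<theta>) = (\<tau>, \<theta>)" "act (rule_edge H \<tau> \<theta>) = rule_action H \<tau>"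
  "src (rule_edge H \<tau> \<theta>) = rule_state H \<tau> (old_q H) \<theta>"
  "dst (rule_edge H \<tau> \<theta>) = rule_state H \<tau> (new_q H) \<theta>"
  by (simp_all add: rule_edge_def)

text \<open>
  The right-hand side is the criterion of \<open>rule_step_iff\<close> plus the value of \<open>\<theta>\<close>.
\<close>

lemma edge_step_iff:
  assumes \<tau>: "wf_rule H \<tau>" and \<theta>: "\<theta> \<in> (\<Pi>\<^sub>E j\<in>untouched H \<tau>. heads H j)"
  shows "edge_step (graph_hw H) (rule_edge H \<tau> \<theta>) (mu H (seg q u 1 (len H + 1))) c \<longleftrightarrow>
    matches H (parts \<tau>) q u \<and> \<theta> = restrict q (untouched H \<tau>) \<and>
    c = mu H (seg (next_state H (new_q H) (parts \<tau>) q) (\<lambda>i. free_red (next_tape H (parts \<tau>) u i)) 1 (len H + 1))"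
proof -
  have dst: "dst (rule_edge H \<tau> \<theta>) = restrict (next_state H (new_q H) (parts \<tau>) q) {1..len H + 1}"
    if "\<theta> = restrict q (untouched H \<tau>)"
    unfolding rule_edge_simps rule_state_eq using that
    by (intro restrict_ext next_state_cong[OF \<tau>]) auto
  have src: "restrict q {1..len H + 1} = src (rule_edge H \<tau> \<theta>) \<longleftrightarrow>
      (\<forall>p\<in>set (parts \<tau>). \<forall>j\<in>{lo H p..hi H p}. q j = old_q H p j) \<and> \<theta> = restrict q (untouched H \<tau>)"
    unfolding rule_edge_simps rule_state_eq by (rule next_state_eq_iff[OF \<tau> \<theta>])
  have m: "matches H (parts \<tau>) q u \<longleftrightarrow>
      (\<forall>p\<in>set (parts \<tau>). \<forall>j\<in>{lo H p..hi H p}. q j = old_q H p j) \<and>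
      (\<forall>p\<in>set (parts \<tau>). \<forall>j\<in>{lo H p..<hi H p}. u j = old_w H p j)"
    unfolding matches_def by blast
  show ?thesis
    unfolding edge_step_def mu_seg m fst_conv snd_conv src rule_edge_simps(2) accepts_iff[OF \<tau>]
    using transform_eq[OF \<tau>, of u] dst by (intro iffI conjI; elim conjE; simp only:)
qed

lemma
  assumes \<tau>: "wf_rule H \<tau>"
  shows left_mult_Free: "left_mult H (parts \<tau>) i \<in> Free (tape H i)"
    and right_mult_Free: "right_mult H (parts \<tau>) i \<in> Free (tape H i)"
proof -
  note wf = wf_partD(2,9)[OF wf_ruleD[OF \<tau>]]
  show "left_mult H (parts \<tau>) i \<in> Free (tape H i)"
  proof (cases "find (\<lambda>p. hi H p = i) (parts \<tau>)")
    case (Some p)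
    then have "p \<in> set (parts \<tau>)" "hi H p = i"
      by (auto dest: find_SomeD)
    with Some show ?thesis
      using wf[of p] by (simp add: left_mult_def)
  qed (simp add: left_mult_def)
  show "right_mult H (parts \<tau>) i \<in> Free (tape H i)"
  proof (cases "find (\<lambda>p. lo H p = i + 1) (parts \<tau>)")
    case (Some p)
    then have "p \<in> set (parts \<tau>)" "lo H p = i + 1"
      by (auto dest: find_SomeD)
    with Some show ?thesis
      using wf[of p] by (simp add: right_mult_def)
  qed (simp add: right_mult_def)
qed

lemma result_admissible:
  assumes \<tau>: "wf_rule H \<tau>" and q: "state_fun H 1 (len H + 1) q" and u: "tape_fun H 1 (len H + 1) u"
  shows "seg (next_state H (new_q H) (parts \<tau>) q) (\<lambda>i. free_red (next_tape H (parts \<tau>) u i)) 1 (len H + 1)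
    \<in> admissible H"
  unfolding admissible_iff
proof (intro exI conjI refl)
  show "state_fun H 1 (len H + 1) (next_state H (new_q H) (parts \<tau>) q)"
    unfolding state_fun_def
  proof (intro allI impI)
    fix j assume j: "1 \<le> j" "j \<le> len H + 1"
    then have "j \<in> {1..len H + 1}" by simp
    then show "next_state H (new_q H) (parts \<tau>) q j \<in> heads H j"
    proof (cases rule: touched_cases[where \<tau> = \<tau>])
      case (touched p)
      then show ?thesis
        using wf_partD(7)[OF wf_ruleD[OF \<tau>]] by (simp add: next_state_touched[OF \<tau>])
    next
      case untouched
      then show ?thesis using q j by (simp add: next_state_untouched state_fun_def)
    qed
  qed
  show "tape_fun H 1 (len H + 1) (\<lambda>i. free_red (next_tape H (parts \<tau>) u i))"
    unfolding tape_fun_def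
  proof (intro allI impI Free_free_red)
    fix i assume i: "1 \<le> i" "i < len H + 1"
    have "fst ` set (u i) \<subseteq> tape H i"
      using u i by (auto simp: tape_fun_def dest: Free_letters)
    then show "fst ` set (next_tape H (parts \<tau>) u i) \<subseteq> tape H i"
    proof (cases "guarding H (parts \<tau>) i")
      case (Some p)
      then have "p \<in> set (parts \<tau>)" "lo H p \<le> i" "i < hi H p"
        using guarding_Some_iff[OF \<tau>] by blast+
      then show ?thesis
        using Some Free_letters[OF wf_partD(9)[OF wf_ruleD[OF \<tau>], of p i]] by (simp add: next_tape_def)
    qed (simp add: next_tape_def image_Un Free_letters[OF left_mult_Free[OF \<tau>]]
        Free_letters[OF right_mult_Free[OF \<tau>]])
  qed
qed (rule refl)

lemma rule_step_imp_edge_step: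
  assumes H: "sm_hardware H" and \<tau>: "wf_rule H \<tau>" and w: "w \<in> admissible H" and "rule_step \<tau> w w'"
  shows "\<exists>!e. e \<in> rule_edges H \<tau> \<and> edge_step (graph_hw H) e (mu H w) (mu H w')"
proof -
  obtain q u where qu: "w = seg q u 1 (len H + 1)" "state_fun H 1 (len H + 1) q"
      "tape_fun H 1 (len H + 1) u"
    using w by (auto simp: admissible_iff)
  \<comment> \<open>The letters that the rule does not touch are copied from the word.\<close>
  define \<theta> where "\<theta> = restrict q (untouched H \<tau>)"
  have \<theta>: "\<theta> \<in> (\<Pi>\<^sub>E j\<in>untouched H \<tau>. heads H j)"
    using qu(2) by (auto simp: \<theta>_def untouched_def state_fun_def)
  note step = \<open>rule_step \<tau> w w'\<close>[unfolded qu(1) rule_step_iff[OF H \<tau> qu(2)]]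
  show ?thesis
  proof (rule ex1I)
    show "rule_edge H \<tau> \<theta> \<in> rule_edges H \<tau> \<and>
        edge_step (graph_hw H) (rule_edge H \<tau> \<theta>) (mu H w) (mu H w')"
      unfolding qu(1) edge_step_iff[OF \<tau> \<theta>] using step \<theta> by (simp add: rule_edges_eq \<theta>_def)
  next
    fix e assume e: "e \<in> rule_edges H \<tau> \<and> edge_step (graph_hw H) e (mu H w) (mu H w')"
    then obtain \<theta>' where \<theta>': "\<theta>' \<in> (\<Pi>\<^sub>E j\<in>untouched H \<tau>. heads H j)" "e = rule_edge H \<tau> \<theta>'"
      by (auto simp: rule_edges_eq)
    with e show "e = rule_edge H \<tau> \<theta>"
      unfolding qu(1) \<theta>_def by (metis edge_step_iff[OF \<tau> \<theta>'(1)])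
  qed
qed

lemma edge_step_imp_rule_step:
  assumes H: "sm_hardware H" and \<tau>: "wf_rule H \<tau>" and w: "w \<in> admissible H" "w' \<in> admissible H"
    and e: "e \<in> rule_edges H \<tau>" and step: "edge_step (graph_hw H) e (mu H w) (mu H w')"
  shows "rule_step \<tau> w w'"
proof -
  obtain q u where qu: "w = seg q u 1 (len H + 1)" "state_fun H 1 (len H + 1) q"
      "tape_fun H 1 (len H + 1) u"
    using w by (auto simp: admissible_iff)
  obtain \<theta> where \<theta>: "\<theta> \<in> (\<Pi>\<^sub>E j\<in>untouched H \<tau>. heads H j)" "e = rule_edge H \<tau> \<theta>"
    using e by (auto simp: rule_edges_eq)
  note * = step[unfolded qu(1) \<theta>(2) edge_step_iff[OF \<tau> \<theta>(1)]]
  have "w' = seg (next_state H (new_q H) (parts \<tau>) q) (\<lambda>i. free_red (next_tape H (parts \<tau>) u i)) 1 (len H + 1)"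
    using * w(2) result_admissible[OF \<tau> qu(2,3)] mu_bij[of H] by (auto simp: bij_betw_def dest: inj_onD)
  with * show ?thesis
    unfolding qu(1) rule_step_iff[OF H \<tau> qu(2)] by blast
qed

section \<open>Inverse rules and inverse edges\<close>

text \<open>
  The coordinates of \<open>[U' \<rightarrow> x\<inverse> U y\<inverse>]\<close> in terms of those of \<open>[U \<rightarrow> x U' y]\<close>.
\<close>

definition inverse_parts :: "('q, 'y) sm_hw \<Rightarrow> ('q, 'y) part \<Rightarrow> ('q, 'y) part \<Rightarrow> bool" where
  "inverse_parts H p p' \<longleftrightarrow> lo H p' = lo H p \<and> hi H p' = hi H p \<and>
     (\<forall>j. lo H p \<le> j \<and> j \<le> hi H p \<longrightarrow> old_q H p' j = new_q H p j \<and> new_q H p' j = old_q H p j) \<and>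
     (\<forall>j. lo H p \<le> j \<and> j < hi H p \<longrightarrow> old_w H p' j = new_w H p j \<and> new_w H p' j = old_w H p j) \<and>
     new_w H p' (lo H p - 1) = winv (new_w H p (lo H p - 1)) \<and>
     new_w H p' (hi H p) = winv (new_w H p (hi H p))"

lemma hl_tw_inject: "a @ hl c # tw x = b @ hl d # tw y \<longleftrightarrow> a = b \<and> c = d \<and> x = y"
proof -
  have "rev (a' @ hl e # tw z) = tw (rev z) @ hl e # rev a'" for a' :: "('a, 'b) hword" and e z
    by (simp add: tw_def rev_map)
  then have "a @ hl c # tw x = b @ hl d # tw y \<longleftrightarrow>
      tw (rev x) @ hl c # rev a = tw (rev y) @ hl d # rev b"
    by (metis rev_rev_ident)
  then show ?thesis
    by (auto simp: tw_hl_inject)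
qed

lemma seg_snoc: "l \<le> r \<Longrightarrow> \<exists>v. seg q u l r = v @ [hl (q r)]"
  by (cases "l = r") (simp_all add: seg_rest rest_snoc[of l r])

text \<open>
  The decomposition \<open>x U' y\<close> in the definition of an inverse rule is unique, because \<open>U'\<close> is delimited
  by state letters.
\<close>

lemma seg_tw_inject:
  assumes eq: "tw x @ U @ tw y = tw x' @ seg q u l r @ tw y'" and lr: "l \<le> r"
    and U: "U \<noteq> []" "hd U \<in> range hl" "last U \<in> range hl"
  shows "x = x' \<and> U = seg q u l r \<and> y = y'"
proof -
  obtain c A where A: "U = hl c # A"
    using U by (cases U) auto
  obtain d B where B: "U = B @ [hl d]"
    using U by (cases U rule: rev_cases) auto
  have x: "x = x'"
    using eq by (simp add: A seg_rest tw_hl_inject)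
  obtain v where v: "seg q u l r = v @ [hl (q r)]"
    using seg_snoc[OF lr] by blast
  have "B @ hl d # tw y = v @ hl (q r) # tw y'"
    using eq by (simp add: x B v)
  then show ?thesis
    by (auto simp: hl_tw_inject x B v)
qed

lemma inverse_parts_if_part_inverse:
  assumes H: "sm_hardware H" and p: "wf_part H p" and inv: "part_inverse p p'"
  shows "inverse_parts H p p'"
proof -
  note wf = wf_partD[OF p]
  obtain x U y where 1: "snd p = tw x @ U @ tw y" "U \<noteq> []" "hd U \<in> range hl" "last U \<in> range hl"
      "p' = (U, tw (winv x) @ fst p @ tw (winv y))"
    using inv unfolding part_inverse_def by (elim exE conjE)
  have 2: "x = new_w H p (lo H p - 1)" "U = seg (new_q H p) (new_w H p) (lo H p) (hi H p)"
      "y = new_w H p (hi H p)"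
    using seg_tw_inject[OF 1(1)[symmetric, unfolded wf(5)] wf(2) 1(2-4)] by blast+
  \<comment> \<open>The right-hand side \<open>x\<inverse> U y\<inverse>\<close> has the inner words of \<open>U\<close> and two inverted outer words.\<close>
  define v where "v j = (if lo H p \<le> j \<and> j < hi H p then old_w H p j else winv (new_w H p j))" for j
  have "seg (old_q H p) (old_w H p) (lo H p) (hi H p) = seg (old_q H p) v (lo H p) (hi H p)"
    using wf(2) by (intro seg_cong) (simp_all add: v_def)
  moreover have "v (lo H p - 1) = winv (new_w H p (lo H p - 1))"
      "v (hi H p) = winv (new_w H p (hi H p))"
    using wf(1) by (auto simp: v_def)
  ultimately have form: "part_form H p' (lo H p) (hi H p) (new_q H p) (new_w H p) (old_q H p) v"
    using wf(1-3) wf(6-9) unfolding part_form_def 1(5) wf(4) 2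
    by (auto simp: state_fun_def tape_fun_def v_def intro: winv_Free)
  note unique = part_form_unique[OF H form]
  show ?thesis
    unfolding inverse_parts_def unique(1,2) using unique(3-6) wf(1,2) by (auto simp: v_def)
qed

lemma rel_option_find: "list_all2 R xs ys \<Longrightarrow> (\<And>x y. R x y \<Longrightarrow> P x \<longleftrightarrow> Q y) \<Longrightarrow>
  rel_option R (find P xs) (find Q ys)"
  by (induction rule: list_all2_induct) auto

context
  fixes H :: "('q, 'y) sm_hw" and \<tau> \<tau>' :: "('n, 'q, 'y) srule"
  assumes \<tau>: "wf_rule H \<tau>" and inv: "list_all2 (inverse_parts H) (parts \<tau>) (parts \<tau>')"
begin

text \<open>
  The parts of a rule and of its inverse have the same ranges, so a lookup by range selects
  corresponding parts.
\<close>

lemma find_inverse: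
  "rel_option (inverse_parts H) (find (\<lambda>p. P (lo H p) (hi H p)) (parts \<tau>))
     (find (\<lambda>p. P (lo H p) (hi H p)) (parts \<tau>'))"
  by (rule rel_option_find[OF inv]) (simp add: inverse_parts_def)

lemma guarding_inverse:
  "rel_option (inverse_parts H) (guarding H (parts \<tau>) i) (guarding H (parts \<tau>') i)"
  unfolding guarding_def by (rule find_inverse)

lemma left_mult_inverse: "left_mult H (parts \<tau>') i = winv (left_mult H (parts \<tau>) i)"
proof (cases "find (\<lambda>p. hi H p = i) (parts \<tau>)")
  case None
  then show ?thesis
    using find_inverse[of "\<lambda>l r. r = i"] by (simp add: left_mult_def)
next
  case (Some p)
  then obtain p' where "find (\<lambda>p. hi H p = i) (parts \<tau>') = Some p'" "inverse_parts H p p'"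
    using find_inverse[of "\<lambda>l r. r = i"] by (auto simp: option_rel_Some1)
  with Some find_SomeD[OF Some] show ?thesis
    by (auto simp: left_mult_def inverse_parts_def)
qed

lemma right_mult_inverse: "right_mult H (parts \<tau>') i = winv (right_mult H (parts \<tau>) i)"
proof (cases "find (\<lambda>p. lo H p = i + 1) (parts \<tau>)")
  case None
  then show ?thesis
    using find_inverse[of "\<lambda>l r. l = i + 1"] by (simp add: right_mult_def)
next
  case (Some p)
  then obtain p' where "find (\<lambda>p. lo H p = i + 1) (parts \<tau>') = Some p'" "inverse_parts H p p'"
    using find_inverse[of "\<lambda>l r. l = i + 1"] by (auto simp: option_rel_Some1)
  with Some find_SomeD[OF Some] show ?thesis
    by (auto simp: right_mult_def inverse_parts_def)
qed

lemma untouched_inverse: "untouched H \<tau>' = untouched H \<tau>"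
proof -
  have "j \<in> touched H \<sigma> \<longleftrightarrow> find (\<lambda>p. lo H p \<le> j \<and> j \<le> hi H p) (parts \<sigma>) \<noteq> None"
    for j and \<sigma> :: "('n, 'q, 'y) srule"
    unfolding find_None_iff touched_def UN_iff Bex_def by auto
  then have "j \<in> touched H \<tau>' \<longleftrightarrow> j \<in> touched H \<tau>" for j
    using find_inverse[of "\<lambda>l r. l \<le> j \<and> j \<le> r"] by (auto simp: rel_option_iff split: option.splits)
  then show ?thesis
    by (auto simp: untouched_def)
qed

lemma rule_state_inverse:
  "rule_state H \<tau>' (old_q H) \<theta> = rule_state H \<tau> (new_q H) \<theta>"
  "rule_state H \<tau>' (new_q H) \<theta> = rule_state H \<tau> (old_q H) \<theta>"
proof -
  have "next_state H (old_q H) (parts \<tau>') \<theta> j = next_state H (new_q H) (parts \<tau>) \<theta> j \<and>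
      next_state H (new_q H) (parts \<tau>') \<theta> j = next_state H (old_q H) (parts \<tau>) \<theta> j" for j
  proof (cases "find (\<lambda>p. lo H p \<le> j \<and> j \<le> hi H p) (parts \<tau>)")
    case None
    then show ?thesis
      using find_inverse[of "\<lambda>l r. l \<le> j \<and> j \<le> r"] by (simp add: next_state_def)
  next
    case (Some p)
    then obtain p' where "find (\<lambda>p. lo H p \<le> j \<and> j \<le> hi H p) (parts \<tau>') = Some p'"
        "inverse_parts H p p'"
      using find_inverse[of "\<lambda>l r. l \<le> j \<and> j \<le> r"] by (auto simp: option_rel_Some1)
    with Some find_SomeD[OF Some] show ?thesis
      by (simp add: next_state_def inverse_parts_def)
  qed
  then show "rule_state H \<tau>' (old_q H) \<theta> = rule_state H \<tau> (new_q H) \<theta>"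
    "rule_state H \<tau>' (new_q H) \<theta> = rule_state H \<tau> (old_q H) \<theta>"
    unfolding rule_state_eq by (auto intro: restrict_ext)
qed

text \<open>
  At a guarded index the left multipliers \<open>v u\<inverse>\<close> and \<open>u v\<inverse>\<close> are inverse to each other, and the guard
  \<open>v\<close> of the inverse rule is the reduction of \<open>v u\<inverse> u\<close>.
\<close>

lemma rule_action_inverse: "rule_action H \<tau>' = action_inv (graph_hw H) (rule_action H \<tau>)"
proof -
  have idx: "idx (graph_hw H) = {1..len H}"
    by (simp add: graph_hw_def)
  have guarded: "\<exists>p'. guarding H (parts \<tau>') i = Some p' \<and>
      old_w H p' i = new_w H p i \<and> new_w H p' i = old_w H p i \<and>
      right_mult H (parts \<tau>) i = [] \<and> free_red (new_w H p i) = new_w H p i"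
    if Some: "guarding H (parts \<tau>) i = Some p" for i p
  proof -
    obtain p' where p': "guarding H (parts \<tau>') i = Some p'" "inverse_parts H p p'"
      using guarding_inverse[of i] unfolding Some option_rel_Some1 by blast
    have p: "p \<in> set (parts \<tau>)" "lo H p \<le> i" "i < hi H p"
      using guarding_Some_iff[OF \<tau>, of i p] Some by simp_all
    with p' show ?thesis
      using right_mult_guarded[OF \<tau> p] free_red_Free[OF wf_partD(9)[OF wf_ruleD[OF \<tau> p(1)], of i]]
      by (auto simp: inverse_parts_def)
  qed
  show ?thesis
  proof (rule action.equality)
    show "lmul (rule_action H \<tau>') = lmul (action_inv (graph_hw H) (rule_action H \<tau>))"
      unfolding rule_action_eq action_inv_def action.simps idx
    proof (rule restrict_ext)
      fix i assume "i \<in> {1..len H}"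
      then show "(case guarding H (parts \<tau>') i of
            None \<Rightarrow> left_mult H (parts \<tau>') i
          | Some p \<Rightarrow> free_red (new_w H p i @ winv (old_w H p i))) =
        winv ((\<lambda>i\<in>{1..len H}. case guarding H (parts \<tau>) i of
            None \<Rightarrow> left_mult H (parts \<tau>) i
          | Some p \<Rightarrow> free_red (new_w H p i @ winv (old_w H p i))) i)"
        using guarding_inverse[of i] guarded[of i]
        by (cases "guarding H (parts \<tau>) i") (auto simp: left_mult_inverse winv_free_red winv_append)
    qed
    show "rmul (rule_action H \<tau>') = rmul (action_inv (graph_hw H) (rule_action H \<tau>))"
      unfolding rule_action_eq action_inv_def action.simps idx
      by (rule restrict_ext) (simp add: right_mult_inverse)
    show "guard (rule_action H \<tau>') = guard (action_inv (graph_hw H) (rule_action H \<tau>))"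
      unfolding rule_action_eq action_inv_def action.simps idx
    proof (rule restrict_ext)
      fix i assume "i \<in> {1..len H}"
      then show "map_option (\<lambda>p. old_w H p i) (guarding H (parts \<tau>') i) =
        map_option (\<lambda>g. free_red ((\<lambda>i\<in>{1..len H}. case guarding H (parts \<tau>) i of
              None \<Rightarrow> left_mult H (parts \<tau>) i
            | Some p \<Rightarrow> free_red (new_w H p i @ winv (old_w H p i))) i @
            g @ (\<lambda>i\<in>{1..len H}. right_mult H (parts \<tau>) i) i))
          ((\<lambda>i\<in>{1..len H}. map_option (\<lambda>p. old_w H p i) (guarding H (parts \<tau>) i)) i)"
        using guarding_inverse[of i] guarded[of i]
        by (cases "guarding H (parts \<tau>) i") auto
    qed
  qed simp
qed

end

section \<open>The S-graph of an S-machine\<close>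

lemma rule_action_sg_action:
  assumes \<tau>: "wf_rule H \<tau>"
  shows "sg_action (graph_hw H) (rule_action H \<tau>)"
proof -
  have tape: "tapes H i = tape H i" if "i \<in> {1..len H}" for i
    using that by (simp add: tape_def)
  have g: "p \<in> set (parts \<tau>)" "lo H p \<le> i" "i < hi H p" if "guarding H (parts \<tau>) i = Some p" for i p
    using guarding_Some_iff[OF \<tau>] that by blast+
  have wf: "old_w H p i \<in> Free (tape H i)" "new_w H p i \<in> Free (tape H i)"
    if "guarding H (parts \<tau>) i = Some p" for i p
    using wf_partD(8,9)[OF wf_ruleD[OF \<tau> g(1)[OF that]], of i] g[OF that] by simp_all
  have lm: "(case guarding H (parts \<tau>) i of Some p \<Rightarrow> free_red (new_w H p i @ winv (old_w H p i))
      | None \<Rightarrow> left_mult H (parts \<tau>) i) \<in> Free (tape H i)" for i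
  proof (cases "guarding H (parts \<tau>) i")
    case (Some p)
    then show ?thesis
      using wf[OF Some] by (simp add: Free_free_red image_Un Free_letters)
  qed (simp add: left_mult_Free[OF \<tau>])
  have gd: "map_option (\<lambda>p. old_w H p i) (guarding H (parts \<tau>) i) \<in> insert None (Some ` Free (tape H i))" for i
    using wf by (cases "guarding H (parts \<tau>) i") auto
  show ?thesis
    unfolding sg_action_def rule_action_eq lang_def graph_hw_def sg_hw.simps
    using lm gd right_mult_Free[OF \<tau>] tape by (intro conjI restrict_PiE_iff[THEN iffD2] ballI) simp_all
qed

text \<open>
  Used for both ends of an edge, with \<open>old_q H\<close> and \<open>new_q H\<close> as \<open>f\<close>.
\<close>

lemma rule_state_graph_states:
  assumes \<tau>: "wf_rule H \<tau>" and \<theta>: "\<theta> \<in> (\<Pi>\<^sub>E j\<in>untouched H \<tau>. heads H j)"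
    and f: "\<And>p j. p \<in> set (parts \<tau>) \<Longrightarrow> lo H p \<le> j \<Longrightarrow> j \<le> hi H p \<Longrightarrow> f p j \<in> heads H j"
  shows "rule_state H \<tau> f \<theta> \<in> graph_states H"
  unfolding rule_state_eq graph_states_def
proof (intro restrict_PiE_iff[THEN iffD2] ballI)
  fix j assume "j \<in> {1..len H + 1}"
  then show "next_state H f (parts \<tau>) \<theta> j \<in> heads H j"
  proof (cases rule: touched_cases[where \<tau> = \<tau>])
    case (touched p)
    then show ?thesis using f by (simp add: next_state_touched[OF \<tau>])
  next
    case untouched
    then show ?thesis using \<theta> by (auto simp: next_state_untouched)
  qed
qed

lemma s_graph_graph_of:
  fixes H :: "('q, 'y) sm_hw" and S :: "('n, 'q, 'y) srule set"
  assumes S: "s_machine H S"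
  shows "s_graph (graph_hw H) (graph_of H S)"
proof -
  have H: "sm_hardware H" and wf: "\<And>\<tau>. \<tau> \<in> S \<Longrightarrow> wf_rule H \<tau>"
    using S by (auto simp: s_machine_def intro: wf_rule_if_s_rule)
  have fin: "finite (heads H j)" if "j \<in> {1..len H + 1}" for j
    using H that unfolding sm_hardware_def by blast
  have "finite (\<Pi>\<^sub>E j\<in>untouched H \<tau>. heads H j)" for \<tau> :: "('n, 'q, 'y) srule"
    by (rule finite_PiE) (auto simp: untouched_def intro: fin)
  then have "finite (edges (graph_of H S))" "finite (verts (graph_of H S))"
    using S fin by (auto simp: graph_of_def rule_edges_eq s_machine_def graph_states_def intro!: finite_PiE)
  moreover have "sg_hardware (graph_hw H)"
    using H by (simp add: sm_hardware_def sg_hardware_def graph_hw_def)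
  moreover have "src e \<in> verts (graph_of H S) \<and> dst e \<in> verts (graph_of H S) \<and>
      sg_action (graph_hw H) (act e) \<and>
      (\<exists>e'\<in>edges (graph_of H S). src e' = dst e \<and> dst e' = src e \<and>
         act e' = action_inv (graph_hw H) (act e))" if "e \<in> edges (graph_of H S)" for e
  proof -
    obtain \<tau> \<theta> where \<tau>: "\<tau> \<in> S" and \<theta>: "\<theta> \<in> (\<Pi>\<^sub>E j\<in>untouched H \<tau>. heads H j)"
      and e: "e = rule_edge H \<tau> \<theta>"
      using \<open>e \<in> _\<close> by (auto simp: graph_of_def rule_edges_eq)
    obtain \<tau>' where \<tau>': "\<tau>' \<in> S" "rule_inverse \<tau> \<tau>'"
      using S \<tau> by (auto simp: s_machine_def)
    have inv: "list_all2 (inverse_parts H) (parts \<tau>) (parts \<tau>')"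
      using \<tau>'(2) inverse_parts_if_part_inverse[OF H] wf_ruleD[OF wf[OF \<tau>]]
      by (auto simp: rule_inverse_def list_all2_conv_all_nth)
    note inverse = untouched_inverse[OF wf[OF \<tau>] inv] rule_state_inverse[OF wf[OF \<tau>] inv]
      rule_action_inverse[OF wf[OF \<tau>] inv]
    have "rule_edge H \<tau>' \<theta> \<in> rule_edges H \<tau>'"
      unfolding rule_edges_eq inverse(1) using \<theta> by (rule imageI)
    then have "rule_edge H \<tau>' \<theta> \<in> edges (graph_of H S)"
      using \<tau>'(1) by (auto simp: graph_of_def)
    then have "\<exists>e'\<in>edges (graph_of H S). src e' = dst e \<and> dst e' = src e \<and>
        act e' = action_inv (graph_hw H) (act e)"
      by (rule bexI[rotated]) (simp add: e inverse)
    moreover have "src e \<in> verts (graph_of H S)" "dst e \<in> verts (graph_of H S)"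
      unfolding e rule_edge_simps using wf_partD(6,7)[OF wf_ruleD[OF wf[OF \<tau>]]]
      by (auto simp: graph_of_def intro!: rule_state_graph_states[OF wf[OF \<tau>] \<theta>])
    ultimately show ?thesis
      using rule_action_sg_action[OF wf[OF \<tau>]] by (simp add: e)
  qed
  ultimately show ?thesis
    by (simp add: s_graph_def)
qed

lemma rule_of_edge: "e \<in> rule_edges H \<tau> \<Longrightarrow> fst (tag e) = \<tau>"
  by (auto simp: rule_edges_eq)

lemma disjoint_rule_edges: "disjoint_family_on (rule_edges H) S"
  by (auto simp: disjoint_family_on_def dest: rule_of_edge)

text \<open>
  The edge of every single step is unique, so the whole sequence of edges is.
\<close>

lemma graph_simulates_machine:
  assumes S: "s_machine H S" and comp: "sm_computation H S ws \<tau>s"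
  shows "\<exists>!es. sg_computation (graph_hw H) (graph_of H S) (map (mu H) ws) es \<and>
    length es = length \<tau>s \<and> (\<forall>i<length \<tau>s. es ! i \<in> rule_edges H (\<tau>s ! i))"
proof -
  have H: "sm_hardware H" and wf: "\<And>\<tau>. \<tau> \<in> S \<Longrightarrow> wf_rule H \<tau>"
    using S by (auto simp: s_machine_def intro: wf_rule_if_s_rule)
  have len: "length ws = length \<tau>s + 1" and adm: "set ws \<subseteq> admissible H" and in_S: "set \<tau>s \<subseteq> S"
    and step: "\<And>i. i < length \<tau>s \<Longrightarrow> rule_step (\<tau>s ! i) (ws ! i) (ws ! (i + 1))"
    using comp by (auto simp: sm_computation_def)
  define P where "P i e \<longleftrightarrow> e \<in> rule_edges H (\<tau>s ! i) \<and>
      edge_step (graph_hw H) e (mu H (ws ! i)) (mu H (ws ! (i + 1)))" for i e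
  have ex1: "\<exists>!e. P i e" if "i < length \<tau>s" for i
    unfolding P_def using that len adm in_S
    by (intro rule_step_imp_edge_step[OF H wf _ step]) auto
  define es where "es = map (\<lambda>i. THE e. P i e) [0..<length \<tau>s]"
  have es: "P i (es ! i)" if "i < length \<tau>s" for i
    using theI'[OF ex1[OF that]] that by (simp add: es_def)
  show ?thesis
  proof (rule ex1I)
    have "mu H ` set ws \<subseteq> lang (graph_hw H) \<times> graph_states H"
      using adm mu_bij[of H] by (auto simp: bij_betw_def)
    moreover have "set es \<subseteq> edges (graph_of H S)"
      using es in_S by (fastforce simp: in_set_conv_nth es_def graph_of_def P_def)
    ultimately show "sg_computation (graph_hw H) (graph_of H S) (map (mu H) ws) es \<and>
        length es = length \<tau>s \<and> (\<forall>i<length \<tau>s. es ! i \<in> rule_edges H (\<tau>s ! i))"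
      using es len by (auto simp: sg_computation_def graph_of_def P_def es_def)
  next
    fix es' assume es': "sg_computation (graph_hw H) (graph_of H S) (map (mu H) ws) es' \<and>
        length es' = length \<tau>s \<and> (\<forall>i<length \<tau>s. es' ! i \<in> rule_edges H (\<tau>s ! i))"
    have P: "P i (es' ! i)" if i: "i < length \<tau>s" for i
    proof -
      have "edge_step (graph_hw H) (es' ! i) (map (mu H) ws ! i) (map (mu H) ws ! (i + 1))"
        using es' i unfolding sg_computation_def by metis
      then show ?thesis
        using es' i len by (simp add: P_def)
    qed
    show "es' = es"
    proof (rule nth_equalityI)
      show "length es' = length es"
        using es' by (simp add: es_def)
      show "es' ! i = es ! i" if "i < length es'" for i
        using that es' the1_equality[OF ex1 P, of i] by (simp add: es_def)
    qed
  qed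
qed

lemma machine_simulates_graph:
  assumes S: "s_machine H S" and comp: "sg_computation (graph_hw H) (graph_of H S) cs es"
  shows "(\<forall>e\<in>set es. \<exists>!\<tau>. \<tau> \<in> S \<and> e \<in> rule_edges H \<tau>) \<and>
    sm_computation H S (map (mu_inv H) cs) (map (\<lambda>e. THE \<tau>. \<tau> \<in> S \<and> e \<in> rule_edges H \<tau>) es)"
proof -
  have H: "sm_hardware H" and wf: "\<And>\<tau>. \<tau> \<in> S \<Longrightarrow> wf_rule H \<tau>"
    using S by (auto simp: s_machine_def intro: wf_rule_if_s_rule)
  have len: "length cs = length es + 1" and cs: "set cs \<subseteq> lang (graph_hw H) \<times> graph_states H"
    and es: "set es \<subseteq> (\<Union>\<tau>\<in>S. rule_edges H \<tau>)"
    and step: "\<And>i. i < length es \<Longrightarrow> edge_step (graph_hw H) (es ! i) (cs ! i) (cs ! (i + 1))"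
    using comp by (simp_all add: sg_computation_def graph_of_def)
  have ex1: "\<exists>!\<tau>. \<tau> \<in> S \<and> e \<in> rule_edges H \<tau>" if "e \<in> set es" for e
    using that es by (auto dest: rule_of_edge)
  define rule where "rule e = (THE \<tau>. \<tau> \<in> S \<and> e \<in> rule_edges H \<tau>)" for e
  have rule: "rule e \<in> S" "e \<in> rule_edges H (rule e)" if "e \<in> set es" for e
    using theI'[OF ex1[OF that]] by (simp_all add: rule_def)
  have "rule_step (rule (es ! i)) (mu_inv H (cs ! i)) (mu_inv H (cs ! (i + 1)))"
    if i: "i < length es" for i
  proof (rule edge_step_imp_rule_step[OF H wf])
    have mem: "cs ! i \<in> set cs" "cs ! (i + 1) \<in> set cs"
      using len i by simp_all
    have c: "cs ! i \<in> lang (graph_hw H) \<times> graph_states H"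
        "cs ! (i + 1) \<in> lang (graph_hw H) \<times> graph_states H"
      by (rule subsetD[OF cs mem(1)], rule subsetD[OF cs mem(2)])
    show "mu_inv H (cs ! i) \<in> admissible H" "mu_inv H (cs ! (i + 1)) \<in> admissible H"
      by (rule mu_inv(1)[OF c(1)], rule mu_inv(1)[OF c(2)])
    show "edge_step (graph_hw H) (es ! i) (mu H (mu_inv H (cs ! i))) (mu H (mu_inv H (cs ! (i + 1))))"
      unfolding mu_inv(2)[OF c(1)] mu_inv(2)[OF c(2)] by (rule step[OF i])
  qed (use rule i in auto)
  then have "sm_computation H S (map (mu_inv H) cs) (map rule es)"
    using len cs rule mu_inv(1)[of _ H] by (auto simp: sm_computation_def)
  with ex1 show ?thesis
    unfolding rule_def by blast
qed

section \<open>Maximal guarded intervals\<close>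

text \<open>
  The shape in which the intervals are computed: \<open>P\<close> holds at the right ends before \<open>b\<close>, and each of
  these is followed by the next left end. The induction splits off the first interval \<open>{a..x}\<close>, where
  \<open>x\<close> is the least element satisfying \<open>P\<close>.
\<close>

lemma zip_intervals:
  fixes P :: "nat \<Rightarrow> bool"
  assumes "a \<le> b"
  defines "I \<equiv> zip (a # map Suc (filter P [a..<b])) (filter P [a..<b] @ [b])"
  shows "(\<forall>x\<in>set I. a \<le> fst x \<and> fst x \<le> snd x \<and> snd x \<le> b \<and> (snd x = b \<or> P (snd x)) \<and>
       (\<forall>j. fst x \<le> j \<longrightarrow> j < snd x \<longrightarrow> \<not> P j)) \<and>
     sorted_wrt (\<lambda>x y. snd x < fst y) I \<and>
     (\<forall>j. a \<le> j \<longrightarrow> j \<le> b \<longrightarrow> (\<exists>x\<in>set I. fst x \<le> j \<and> j \<le> snd x))"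
  using assms(1) unfolding I_def
proof (induction "b - a" arbitrary: a rule: less_induct)
  case less
  show ?case
  proof (cases "\<exists>x. a \<le> x \<and> x < b \<and> P x")
    case False
    then have "filter P [a..<b] = []"
      by (auto simp: filter_empty_conv)
    then show ?thesis
      using False less.prems by simp
  next
    case True
    define x where "x = (LEAST x. a \<le> x \<and> x < b \<and> P x)"
    have x: "a \<le> x" "x < b" "P x"
      using LeastI_ex[OF True] by (simp_all add: x_def)
    have not: "\<not> P j" if "a \<le> j" "j < x" for j
      using not_less_Least[of j "\<lambda>x. a \<le> x \<and> x < b \<and> P x"] that x(2) by (auto simp: x_def)
    have "[a..<b] = [a..<x] @ x # [Suc x..<b]"
      using x upt_add_eq_append[of a x "b - x"] upt_conv_Cons[of x b] by simp
    moreover have "filter P [a..<x] = []"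
      using not by (auto simp: filter_empty_conv)
    ultimately have X: "filter P [a..<b] = x # filter P [Suc x..<b]"
      using x by simp
    have IH: "(\<forall>y\<in>set (zip (Suc x # map Suc (filter P [Suc x..<b])) (filter P [Suc x..<b] @ [b])).
         Suc x \<le> fst y \<and> fst y \<le> snd y \<and> snd y \<le> b \<and> (snd y = b \<or> P (snd y)) \<and>
         (\<forall>j. fst y \<le> j \<longrightarrow> j < snd y \<longrightarrow> \<not> P j)) \<and>
       sorted_wrt (\<lambda>x y. snd x < fst y)
         (zip (Suc x # map Suc (filter P [Suc x..<b])) (filter P [Suc x..<b] @ [b])) \<and>
       (\<forall>j. Suc x \<le> j \<longrightarrow> j \<le> b \<longrightarrow>
         (\<exists>y\<in>set (zip (Suc x # map Suc (filter P [Suc x..<b])) (filter P [Suc x..<b] @ [b])).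
            fst y \<le> j \<and> j \<le> snd y))"
      by (rule less.hyps) (use x in simp_all)
    define J where "J = zip (Suc x # map Suc (filter P [Suc x..<b])) (filter P [Suc x..<b] @ [b])"
    note IH = IH[folded J_def]
    have "zip (a # map Suc (filter P [a..<b])) (filter P [a..<b] @ [b]) = (a, x) # J"
      unfolding X J_def by simp
    moreover have "\<exists>y\<in>set ((a, x) # J). fst y \<le> j \<and> j \<le> snd y" if "a \<le> j" "j \<le> b" for j
      using that IH by (cases "j \<le> x") (simp_all add: not_less_eq_eq)
    moreover have "\<forall>y\<in>set ((a, x) # J). a \<le> fst y \<and> fst y \<le> snd y \<and> snd y \<le> b \<and>
        (snd y = b \<or> P (snd y)) \<and> (\<forall>j. fst y \<le> j \<longrightarrow> j < snd y \<longrightarrow> \<not> P j)"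
      using IH x not by (simp add: Ball_def) (meson Suc_leD le_trans)
    moreover have "sorted_wrt (\<lambda>x y. snd x < fst y) ((a, x) # J)"
      using IH by (simp add: Ball_def Suc_le_eq)
    ultimately show ?thesis
      by (simp only:) blast
  qed
qed

lemma gd_outside [simp]: "gd H \<eta> a 0 = None" "gd H \<eta> a (Suc (card (idx H))) = None"
  by (simp_all add: gd_def)

text \<open>
  The value \<open>None\<close> of \<open>gd\<close> at the indices \<open>0\<close> and \<open>N + 1\<close> makes \<open>1\<close> a left end and \<open>N + 1\<close> a right
  end.
\<close>

lemma intervals_eq:
  "intervals H \<eta> a = zip (1 # map Suc (filter (\<lambda>j. gd H \<eta> a j = None) [1..<card (idx H) + 1]))
     (filter (\<lambda>j. gd H \<eta> a j = None) [1..<card (idx H) + 1] @ [card (idx H) + 1])"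
proof -
  define N where "N = card (idx H)"
  have "[1..<N + 2] = map Suc [0..<N + 1]"
    by (simp only: map_Suc_upt) simp
  then have "filter (\<lambda>j. gd H \<eta> a (j - 1) = None) [1..<N + 2] =
      map Suc (filter (\<lambda>j. gd H \<eta> a j = None) [0..<N + 1])"
    by (simp only: filter_map o_def diff_Suc_1)
  also have "[0..<N + 1] = 0 # [1..<N + 1]"
    by (simp add: upt_conv_Cons del: upt_Suc)
  finally have "filter (\<lambda>j. gd H \<eta> a (j - 1) = None) [1..<N + 2] =
      1 # map Suc (filter (\<lambda>j. gd H \<eta> a j = None) [1..<N + 1])"
    by (simp del: upt_Suc)
  moreover have "[1..<N + 2] = [1..<N + 1] @ [N + 1]"
    by simp
  then have "filter (\<lambda>j. gd H \<eta> a j = None) [1..<N + 2] =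
      filter (\<lambda>j. gd H \<eta> a j = None) [1..<N + 1] @ [N + 1]"
    by (simp add: N_def del: upt_Suc)
  ultimately show ?thesis
    by (simp only: intervals_def Let_def N_def)
qed

lemma
  shows intervals_bounds: "(l, r) \<in> set (intervals H \<eta> a) \<Longrightarrow> 1 \<le> l \<and> l \<le> r \<and> r \<le> card (idx H) + 1"
    and intervals_right: "(l, r) \<in> set (intervals H \<eta> a) \<Longrightarrow> gd H \<eta> a r = None"
    and intervals_inside: "(l, r) \<in> set (intervals H \<eta> a) \<Longrightarrow> l \<le> j \<Longrightarrow> j < r \<Longrightarrow> gd H \<eta> a j \<noteq> None"
    and intervals_sorted: "sorted_wrt (\<lambda>x y. snd x < fst y) (intervals H \<eta> a)"
    and intervals_cover: "1 \<le> j \<Longrightarrow> j \<le> card (idx H) + 1 \<Longrightarrow>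
      \<exists>l r. (l, r) \<in> set (intervals H \<eta> a) \<and> l \<le> j \<and> j \<le> r"
proof -
  note z = zip_intervals[of 1 "card (idx H) + 1" "\<lambda>j. gd H \<eta> a j = None", folded intervals_eq]
  show "1 \<le> l \<and> l \<le> r \<and> r \<le> card (idx H) + 1" "gd H \<eta> a r = None"
    if "(l, r) \<in> set (intervals H \<eta> a)"
    using z that by fastforce+
  show "gd H \<eta> a j \<noteq> None" if "(l, r) \<in> set (intervals H \<eta> a)" "l \<le> j" "j < r"
    using z that by fastforce
  show "sorted_wrt (\<lambda>x y. snd x < fst y) (intervals H \<eta> a)"
    using z by simp
  show "\<exists>l r. (l, r) \<in> set (intervals H \<eta> a) \<and> l \<le> j \<and> j \<le> r" if "1 \<le> j" "j \<le> card (idx H) + 1"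
    using z that by fastforce
qed

section \<open>The S-machine of an S-graph\<close>

definition edge_part :: "('i, 'y) sg_hw \<Rightarrow> ('i \<Rightarrow> nat) \<Rightarrow> ('e, 's, 'i, 'y) edge \<Rightarrow>
    nat \<times> nat \<Rightarrow> ('s mstate, 'y) part" where
  "edge_part H \<eta> e = (\<lambda>(l, r). let a = act e; g = (\<lambda>j. the (gd H \<eta> a j)) in
     (seg (gamma (src e)) g l r,
      tw (rm H \<eta> a (l - 1)) @
      seg (gamma (dst e)) (\<lambda>j. free_red (lm H \<eta> a j @ g j @ rm H \<eta> a j)) l r @
      tw (lm H \<eta> a r)))"

lemma edge_rule_eq:
  "edge_rule H \<eta> e = \<lparr> label = e, parts = map (edge_part H \<eta> e) (intervals H \<eta> (act e)) \<rparr>"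
  by (simp add: edge_rule_def edge_part_def Let_def)

lemma label_edge_rule [simp]: "label (edge_rule H \<eta> e) = e"
  by (simp add: edge_rule_eq)

text \<open>
  The words \<open>v\<^sup>l\<^sup>-\<^sup>1, \<dots>, v\<^sup>r\<close> of the part with range \<open>{l..r}\<close>. Only the values between \<open>l - 1\<close> and \<open>r\<close>
  matter, so \<open>j < l\<close> stands for \<open>j = l - 1\<close> and the last case for \<open>j = r\<close>.
\<close>

definition edge_new_w :: "('i, 'y) sg_hw \<Rightarrow> ('i \<Rightarrow> nat) \<Rightarrow> ('i, 'y) action \<Rightarrow> nat \<Rightarrow> nat \<Rightarrow> nat \<Rightarrow> 'y gword" where
  "edge_new_w H \<eta> a l r j = (if j < l then rm H \<eta> a j
     else if j < r then free_red (lm H \<eta> a j @ the (gd H \<eta> a j) @ rm H \<eta> a j) else lm H \<eta> a j)"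

context
  fixes H :: "('i, 'a) sg_hw" and G :: "('e, 's, 'i, 'a) graph" and \<eta> :: "'i \<Rightarrow> nat"
  assumes G: "s_graph H G" and \<eta>: "bij_betw \<eta> (idx H) {1..card (idx H)}"
begin

abbreviation (input) "HM \<equiv> machine_hw H G \<eta>"

abbreviation (input) "N \<equiv> card (idx H)"

lemma HM_simps [simp]: "len HM = N" "tapes HM j = alph H (idx_at H \<eta> j)"
  "heads HM j = (if j = 1 then Vertex ` verts G else {Star j})"
  by (simp_all add: machine_hw_def)

lemma idx_at_bij: "bij_betw (idx_at H \<eta>) {1..N} (idx H)"
  using bij_betw_inv_into[OF \<eta>] by (simp add: idx_at_def[abs_def])

lemma idx_at_in: "j \<in> {1..N} \<Longrightarrow> idx_at H \<eta> j \<in> idx H"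
  using idx_at_bij by (rule bij_betwE[THEN bspec])

lemma eta_in: "i \<in> idx H \<Longrightarrow> \<eta> i \<in> {1..N}"
  using \<eta> by (rule bij_betwE[THEN bspec])

lemma idx_at_eta: "i \<in> idx H \<Longrightarrow> idx_at H \<eta> (\<eta> i) = i"
  unfolding idx_at_def by (rule bij_betw_inv_into_left[OF \<eta>])

lemma eta_idx_at: "j \<in> {1..N} \<Longrightarrow> \<eta> (idx_at H \<eta> j) = j"
  unfolding idx_at_def by (rule bij_betw_inv_into_right[OF \<eta>])

lemma tape_HM: "j \<in> {1..N} \<Longrightarrow> tape HM j = alph H (idx_at H \<eta> j)"
  by (simp add: tape_def)

lemma hardware_HM: "sm_hardware HM"
proof -
  have "finite (verts G)" "\<And>i. i \<in> idx H \<Longrightarrow> finite (alph H i)"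
    using G by (auto simp: s_graph_def sg_hardware_def)
  then show ?thesis
    using idx_at_in by (auto simp: sm_hardware_def disjoint_family_on_def)
qed

lemma edgeD:
  assumes "e \<in> edges G"
  shows "src e \<in> verts G" "dst e \<in> verts G" "sg_action H (act e)"
  using G assms by (auto simp: s_graph_def)

lemma action_Free:
  assumes "sg_action H a"
  shows "lm H \<eta> a j \<in> Free (tape HM j)" "rm H \<eta> a j \<in> Free (tape HM j)"
    "gd H \<eta> a j = Some g \<Longrightarrow> g \<in> Free (tape HM j)"
proof -
  have "lmul a i \<in> Free (alph H i)" "rmul a i \<in> Free (alph H i)"
    "guard a i \<in> insert None (Some ` Free (alph H i))" if "i \<in> idx H" for i
    using assms that by (auto simp: sg_action_def lang_def)
  from this[OF idx_at_in, of j]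
  show "lm H \<eta> a j \<in> Free (tape HM j)" "rm H \<eta> a j \<in> Free (tape HM j)"
    "gd H \<eta> a j = Some g \<Longrightarrow> g \<in> Free (tape HM j)"
    by (auto simp: lm_def rm_def gd_def tape_HM split: if_splits)
qed

lemma edge_part_form:
  assumes e: "e \<in> edges G" and lr: "(l, r) \<in> set (intervals H \<eta> (act e))"
  shows "part_form HM (edge_part H \<eta> e (l, r)) l r (gamma (src e)) (\<lambda>j. the (gd H \<eta> (act e) j))
    (gamma (dst e)) (edge_new_w H \<eta> (act e) l r)"
proof -
  note bounds = intervals_bounds[OF lr]
  have gd: "the (gd H \<eta> (act e) j) \<in> Free (tape HM j)" if "l \<le> j" "j < r" for j
    using intervals_inside[OF lr that] action_Free(3)[OF edgeD(3)[OF e]] by auto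
  have "edge_new_w H \<eta> (act e) l r j \<in> Free (tape HM j)" for j
    using action_Free(1,2)[OF edgeD(3)[OF e], of j] gd[of j]
    by (simp add: edge_new_w_def Free_free_red image_Un Free_letters)
  moreover have "seg (gamma (dst e)) (edge_new_w H \<eta> (act e) l r) l r = seg (gamma (dst e))
      (\<lambda>j. free_red (lm H \<eta> (act e) j @ the (gd H \<eta> (act e) j) @ rm H \<eta> (act e) j)) l r"
    using bounds by (intro seg_cong) (simp_all add: edge_new_w_def)
  ultimately show ?thesis
    using bounds gd edgeD(1,2)[OF e]
    by (auto simp: part_form_def edge_part_def state_fun_def tape_fun_def gamma_def edge_new_w_def Let_def)
qed

lemmas edge_part_simps = part_form_unique[OF hardware_HM edge_part_form]

lemma wf_edge_rule: "e \<in> edges G \<Longrightarrow> wf_rule HM (edge_rule H \<eta> e)"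
  unfolding wf_rule_def
proof
  assume e: "e \<in> edges G"
  show "\<forall>p\<in>set (parts (edge_rule H \<eta> e)). wf_part HM p"
    using wf_partI[OF hardware_HM edge_part_form[OF e]] by (auto simp: edge_rule_eq)
  have "sorted_wrt (\<lambda>x y. hi HM (edge_part H \<eta> e x) < lo HM (edge_part H \<eta> e y)) (intervals H \<eta> (act e))"
    by (rule sorted_wrt_mono_rel[OF _ intervals_sorted]) (auto simp: edge_part_simps[OF e])
  then show "sorted_wrt (\<lambda>p p'. hi HM p < lo HM p') (parts (edge_rule H \<eta> e))"
    by (simp add: edge_rule_eq sorted_wrt_map)
qed

lemma inverse_gd: "gd H \<eta> (action_inv H a) j =
    map_option (\<lambda>g. free_red (lm H \<eta> a j @ g @ rm H \<eta> a j)) (gd H \<eta> a j)"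
  and inverse_lm: "lm H \<eta> (action_inv H a) j = winv (lm H \<eta> a j)"
  and inverse_rm: "rm H \<eta> (action_inv H a) j = winv (rm H \<eta> a j)"
  using idx_at_in[of j] by (auto simp: gd_def lm_def rm_def action_inv_def)

text \<open>
  Both edges have the same unguarded indices, hence the same intervals, and the parts can be compared
  one by one. The guard of the inverse action is the reduction of \<open>l g r\<close>, and applying the inverse
  multipliers to it gives back \<open>g\<close>.
\<close>

lemma rule_inverse_edge_rule:
  assumes e: "e \<in> edges G" and e': "src e' = dst e" "dst e' = src e" "act e' = action_inv H (act e)"
  shows "rule_inverse (edge_rule H \<eta> e) (edge_rule H \<eta> e')"
proof -
  have I: "intervals H \<eta> (act e') = intervals H \<eta> (act e)"
    by (simp add: intervals_def e' inverse_gd)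
  have "part_inverse (edge_part H \<eta> e (l, r)) (edge_part H \<eta> e' (l, r))"
    if lr: "(l, r) \<in> set (intervals H \<eta> (act e))" for l r
  proof -
    define a g where "a = act e" and "g = (\<lambda>j. the (gd H \<eta> a j))"
    define v where "v = (\<lambda>j. free_red (lm H \<eta> a j @ g j @ rm H \<eta> a j))"
    note bounds = intervals_bounds[OF lr]
    have gd: "gd H \<eta> a j = Some (g j)" "free_red (g j) = g j" if "l \<le> j" "j < r" for j
      using intervals_inside[OF lr that] action_Free(3)[OF edgeD(3)[OF e], of j]
      by (auto simp: a_def g_def free_red_Free)
    have U: "seg (gamma (src e')) (\<lambda>j. the (gd H \<eta> (act e') j)) l r = seg (gamma (dst e)) v l r"
      using bounds gd by (intro seg_cong) (simp_all add: e' inverse_gd v_def flip: a_def)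
    have V: "seg (gamma (dst e')) (\<lambda>j. free_red (lm H \<eta> (act e') j @ the (gd H \<eta> (act e') j) @
        rm H \<eta> (act e') j)) l r = seg (gamma (src e)) g l r"
      using bounds gd
      by (intro seg_cong) (simp_all add: e' inverse_gd inverse_lm inverse_rm flip: a_def)
    have "last (seg (gamma (dst e)) v l r) \<in> range hl"
      using seg_snoc[of l r "gamma (dst e)" v] bounds by auto
    then show ?thesis
      unfolding part_inverse_def
      by (intro exI[of _ "rm H \<eta> a (l - 1)"] exI[of _ "seg (gamma (dst e)) v l r"] exI[of _ "lm H \<eta> a r"])
         (simp add: edge_part_def Let_def U V, simp add: e' inverse_lm inverse_rm a_def v_def g_def seg_rest)
  qed
  then show ?thesis
    by (simp add: rule_inverse_def edge_rule_eq I list.rel_map list.rel_refl_strong split_paired_all)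
qed

lemma s_machine_machine_of: "s_machine HM (machine_of H G \<eta>)"
  unfolding s_machine_def
proof (intro conjI ballI)
  show "finite (machine_of H G \<eta>)"
    using G by (simp add: machine_of_def s_graph_def)
next
  fix \<tau> assume "\<tau> \<in> machine_of H G \<eta>"
  then obtain e where e: "e \<in> edges G" "\<tau> = edge_rule H \<eta> e"
    by (auto simp: machine_of_def)
  show "s_rule HM \<tau>"
    unfolding e(2) using edgeD(1)[OF e(1)] by (intro s_rule_if_wf_rule[OF wf_edge_rule[OF e(1)]]) auto
  obtain e' where "e' \<in> edges G" "src e' = dst e" "dst e' = src e" "act e' = action_inv H (act e)"
    using G e(1) unfolding s_graph_def by blast
  then show "\<exists>\<tau>'\<in>machine_of H G \<eta>. rule_inverse \<tau> \<tau>'"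
    using rule_inverse_edge_rule[OF e(1)] by (auto simp: machine_of_def e(2))
qed (rule hardware_HM)

text \<open>
  The action of the rule of \<open>e\<close>. A guarded index lies in the interior of its interval, which yields
  the left multiplier \<open>(l g r) g\<inverse>\<close> and no right multiplier. An unguarded index \<open>i\<close> is the right end of
  one interval and the next interval starts at \<open>i + 1\<close>; these two contribute the left and the right
  multiplier of \<open>e\<close>.
\<close>

lemma
  assumes e: "e \<in> edges G" and i: "i \<in> {1..N}"
  shows guard_edge_rule: "guard (rule_action HM (edge_rule H \<eta> e)) i = gd H \<eta> (act e) i"
    and lmul_edge_rule: "lmul (rule_action HM (edge_rule H \<eta> e)) i = (case gd H \<eta> (act e) i of
      None \<Rightarrow> lm H \<eta> (act e) i
    | Some g \<Rightarrow> free_red (lm H \<eta> (act e) i @ g @ rm H \<eta> (act e) i @ winv g))"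
    and rmul_edge_rule: "rmul (rule_action HM (edge_rule H \<eta> e)) i = (case gd H \<eta> (act e) i of
      None \<Rightarrow> rm H \<eta> (act e) i | Some g \<Rightarrow> [])"
proof -
  note wf = wf_edge_rule[OF e]
  let ?a = "act e" and ?ps = "parts (edge_rule H \<eta> e)"
  obtain l r where lr: "(l, r) \<in> set (intervals H \<eta> ?a)" "l \<le> i" "i \<le> r"
    using intervals_cover[of i H \<eta> ?a] i by auto
  define p where "p = edge_part H \<eta> e (l, r)"
  have p: "p \<in> set ?ps"
    using lr(1) by (simp add: p_def edge_rule_eq)
  note ps = edge_part_simps[OF e lr(1), folded p_def]
  have "guard (rule_action HM (edge_rule H \<eta> e)) i = gd H \<eta> ?a i \<and>
    lmul (rule_action HM (edge_rule H \<eta> e)) i = (case gd H \<eta> ?a i of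
      None \<Rightarrow> lm H \<eta> ?a i | Some g \<Rightarrow> free_red (lm H \<eta> ?a i @ g @ rm H \<eta> ?a i @ winv g)) \<and>
    rmul (rule_action HM (edge_rule H \<eta> e)) i = (case gd H \<eta> ?a i of None \<Rightarrow> rm H \<eta> ?a i | Some g \<Rightarrow> [])"
  proof (cases "gd H \<eta> ?a i")
    case (Some g)
    then have "i \<noteq> r"
      using intervals_right[OF lr(1)] by auto
    then have ir: "i < r"
      using lr by simp
    have "guarding HM ?ps i = Some p"
      using guarding_Some_iff[OF wf] p lr ir ps by simp
    moreover have "right_mult HM ?ps i = []"
      using right_mult_guarded[OF wf p] lr ir ps by simp
    moreover have "old_w HM p i = g" "new_w HM p i = free_red (lm H \<eta> ?a i @ g @ rm H \<eta> ?a i)"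
      using ps(5,6)[of i] lr ir Some by (simp_all add: edge_new_w_def)
    ultimately show ?thesis
      using i Some by (simp add: rule_action_eq)
  next
    case None
    have unguarded: False if "(l', r') \<in> set (intervals H \<eta> ?a)" "l' \<le> i" "i < r'" for l' r'
      using intervals_inside[OF that] None by simp
    \<comment> \<open>The maximal interval cannot go on beyond an unguarded index.\<close>
    then have ir: "i = r"
      using lr by fastforce
    have "guarding HM ?ps i = None"
    proof (rule ccontr)
      assume "guarding HM ?ps i \<noteq> None"
      then obtain p' where "p' \<in> set ?ps" "lo HM p' \<le> i" "i < hi HM p'"
        using guarding_Some_iff[OF wf, of i] by blast
      moreover from this obtain l' r' where "(l', r') \<in> set (intervals H \<eta> ?a)"
          "p' = edge_part H \<eta> e (l', r')"
        by (auto simp: edge_rule_eq)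
      ultimately show False
        using unguarded edge_part_simps(1,2)[OF e] by metis
    qed
    moreover have "left_mult HM ?ps i = lm H \<eta> ?a i"
    proof -
      have "left_mult HM ?ps i = new_w HM p i"
        using find_hi[OF wf p, of i] ps(2) ir by (simp add: left_mult_def)
      also have "\<dots> = lm H \<eta> ?a i"
        using ps(6)[of i] lr ir by (simp add: edge_new_w_def)
      finally show ?thesis .
    qed
    moreover have "right_mult HM ?ps i = rm H \<eta> ?a i"
    proof -
      obtain l' r' where lr': "(l', r') \<in> set (intervals H \<eta> ?a)" "l' \<le> i + 1" "i + 1 \<le> r'"
        using intervals_cover[of "i + 1" H \<eta> ?a] i by auto
      then have l': "l' = i + 1"
        using unguarded[of l' r'] by fastforce
      have p': "edge_part H \<eta> e (l', r') \<in> set ?ps"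
        using lr'(1) by (simp add: edge_rule_eq)
      note ps' = edge_part_simps[OF e lr'(1)]
      have "right_mult HM ?ps i = new_w HM (edge_part H \<eta> e (l', r')) i"
        using find_lo[OF wf p', of "i + 1"] ps'(1) l' by (simp add: right_mult_def)
      also have "\<dots> = rm H \<eta> ?a i"
        using ps'(6)[of i] lr' l' by (simp add: edge_new_w_def)
      finally show ?thesis .
    qed
    ultimately show ?thesis
      using i None by (simp add: rule_action_eq)
  qed
  then show "guard (rule_action HM (edge_rule H \<eta> e)) i = gd H \<eta> ?a i"
    "lmul (rule_action HM (edge_rule H \<eta> e)) i = (case gd H \<eta> ?a i of
      None \<Rightarrow> lm H \<eta> ?a i | Some g \<Rightarrow> free_red (lm H \<eta> ?a i @ g @ rm H \<eta> ?a i @ winv g))"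
    "rmul (rule_action HM (edge_rule H \<eta> e)) i = (case gd H \<eta> ?a i of None \<Rightarrow> rm H \<eta> ?a i | Some g \<Rightarrow> [])"
    by simp_all
qed

text \<open>
  The state of \<open>graph_of\<close> that corresponds to a state of \<open>G\<close>: only the first letter carries
  information.
\<close>

definition state_of :: "'s \<Rightarrow> nat \<Rightarrow> 's mstate" where
  "state_of s = restrict (gamma s) {1..N + 1}"

definition edge_of :: "('e, 's, 'i, 'a) edge \<Rightarrow> (('e, 's, 'i, 'a) edge, 's mstate, 'a) redge" where
  "edge_of e = rule_edge HM (edge_rule H \<eta> e) (\<lambda>_. undefined)"

lemma touched_edge_rule:
  assumes e: "e \<in> edges G" and j: "j \<in> {1..N + 1}"
  obtains l r where "(l, r) \<in> set (intervals H \<eta> (act e))" "l \<le> j" "j \<le> r"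
    "edge_part H \<eta> e (l, r) \<in> set (parts (edge_rule H \<eta> e))"
  using intervals_cover[of j H \<eta> "act e"] j by (force simp: edge_rule_eq)

text \<open>
  The intervals cover all indices, so no letter is left for \<open>\<theta>\<close> to choose.
\<close>

lemma rule_edges_edge_rule:
  assumes e: "e \<in> edges G"
  shows "rule_edges HM (edge_rule H \<eta> e) = {edge_of e}"
proof -
  have "untouched HM (edge_rule H \<eta> e) = {}"
  proof -
    have "j \<in> touched HM (edge_rule H \<eta> e)" if j: "j \<in> {1..N + 1}" for j
    proof -
      obtain l r where lr: "(l, r) \<in> set (intervals H \<eta> (act e))" "l \<le> j" "j \<le> r"
          "edge_part H \<eta> e (l, r) \<in> set (parts (edge_rule H \<eta> e))"
        using touched_edge_rule[OF e j] .
      then have "j \<in> {lo HM (edge_part H \<eta> e (l, r))..hi HM (edge_part H \<eta> e (l, r))}"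
        using edge_part_simps(1,2)[OF e lr(1)] by simp
      with lr(4) show ?thesis
        unfolding touched_def by (rule UN_I)
    qed
    then show ?thesis
      by (auto simp: untouched_def)
  qed
  then show ?thesis
    by (simp add: rule_edges_eq edge_of_def)
qed

lemma edge_of_simps:
  assumes e: "e \<in> edges G"
  shows "src (edge_of e) = state_of (src e)" "dst (edge_of e) = state_of (dst e)"
    "act (edge_of e) = rule_action HM (edge_rule H \<eta> e)" "fst (tag (edge_of e)) = edge_rule H \<eta> e"
proof -
  have put: "next_state HM f (parts (edge_rule H \<eta> e)) \<theta> j = gamma s j"
    if j: "j \<in> {1..N + 1}" and f: "\<And>l r. (l, r) \<in> set (intervals H \<eta> (act e)) \<Longrightarrow> l \<le> j \<Longrightarrow> j \<le> r \<Longrightarrow>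
      f (edge_part H \<eta> e (l, r)) j = gamma s j" for f \<theta> s j
  proof -
    obtain l r where lr: "(l, r) \<in> set (intervals H \<eta> (act e))" "l \<le> j" "j \<le> r"
        "edge_part H \<eta> e (l, r) \<in> set (parts (edge_rule H \<eta> e))"
      using touched_edge_rule[OF e j] .
    then show ?thesis
      using next_state_touched[OF wf_edge_rule[OF e] lr(4)] f[OF lr(1-3)] edge_part_simps(1,2)[OF e lr(1)]
      by simp
  qed
  show "src (edge_of e) = state_of (src e)" "dst (edge_of e) = state_of (dst e)"
    unfolding edge_of_def rule_edge_simps rule_state_eq state_of_def HM_simps
    by (rule restrict_ext, rule put; simp add: edge_part_simps(3,4)[OF e])+
qed (simp_all add: edge_of_def)

lemma vertex_state_of [simp]: "vertex (state_of s 1) = s"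
  by (simp add: state_of_def gamma_def)

lemma state_of_in: "s \<in> verts G \<Longrightarrow> state_of s \<in> graph_states HM"
  by (auto simp: graph_states_def state_of_def gamma_def)

lemma graph_states_HM:
  assumes "s \<in> graph_states HM"
  shows "vertex (s 1) \<in> verts G" "s = state_of (vertex (s 1))"
proof -
  have s: "s j \<in> (if j = 1 then Vertex ` verts G else {Star j})" if "j \<in> {1..N + 1}" for j
    using PiE_mem[OF assms[unfolded graph_states_def], of j] that by simp
  show "vertex (s 1) \<in> verts G"
    using s[of 1] by auto
  show "s = state_of (vertex (s 1))"
  proof (rule extensionalityI)
    show "s \<in> extensional {1..N + 1}"
      using assms by (simp add: graph_states_def PiE_def)
    show "s j = state_of (vertex (s 1)) j" if "j \<in> {1..N + 1}" for j
      using s[OF that] s[of 1] that by (auto simp: state_of_def gamma_def split: if_splits)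
  qed (simp add: state_of_def)
qed

lemma edges_graph_of_machine: "edges (graph_of HM (machine_of H G \<eta>)) = edge_of ` edges G"
  by (auto simp: graph_of_def machine_of_def rule_edges_edge_rule)

text \<open>
  The configurations of the graph of the machine, translated to configurations of \<open>G\<close>. It turns \<open>mu\<close>
  into \<open>nu\<close>, see \<open>nu_eq\<close>.
\<close>

definition reindex_config :: "(nat \<Rightarrow> 'a gword) \<times> (nat \<Rightarrow> 's mstate) \<Rightarrow> ('i \<Rightarrow> 'a gword) \<times> 's" where
  "reindex_config c = ((\<lambda>i\<in>idx H. fst c (\<eta> i)), vertex (snd c 1))"

text \<open>
  The tape words are only required to be extensional, so that the lemma also applies to the result of
  a transformation without computing its alphabet.
\<close>

lemma reindex_config_eqD:
  assumes c: "fst c \<in> extensional {1..N}" "fst c' \<in> extensional {1..N}"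
    "snd c \<in> graph_states HM" "snd c' \<in> graph_states HM" and eq: "reindex_config c = reindex_config c'"
  shows "c = c'"
proof (rule prod_eqI)
  show "fst c = fst c'"
  proof (rule extensionalityI[OF c(1,2)])
    fix j assume j: "j \<in> {1..N}"
    have "fst (reindex_config c) (idx_at H \<eta> j) = fst (reindex_config c') (idx_at H \<eta> j)"
      by (simp add: eq)
    then show "fst c j = fst c' j"
      using idx_at_in[OF j] eta_idx_at[OF j] by (simp add: reindex_config_def)
  qed
  have "vertex (snd c 1) = vertex (snd c' 1)"
    using eq by (simp add: reindex_config_def)
  then show "snd c = snd c'"
    using graph_states_HM(2)[OF c(3)] graph_states_HM(2)[OF c(4)] by metis
qed

lemma reindex_config_bij: "bij_betw reindex_config (lang (graph_hw HM) \<times> graph_states HM) (lang H \<times> verts G)"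
proof (rule bij_betw_imageI)
  show "inj_on reindex_config (lang (graph_hw HM) \<times> graph_states HM)"
    by (intro inj_onI reindex_config_eqD) (auto simp: lang_def graph_hw_def PiE_def)
  show "reindex_config ` (lang (graph_hw HM) \<times> graph_states HM) = lang H \<times> verts G"
  proof (intro equalityI subsetI)
    fix d assume "d \<in> reindex_config ` (lang (graph_hw HM) \<times> graph_states HM)"
    then obtain c where c: "fst c \<in> lang (graph_hw HM)" "snd c \<in> graph_states HM" "d = reindex_config c"
      by auto
    have "fst c (\<eta> i) \<in> Free (alph H i)" if i: "i \<in> idx H" for i
      using c(1) eta_in[OF i] PiE_mem[of "fst c" "{1..N}" "\<lambda>j. Free (alph H (idx_at H \<eta> j))" "\<eta> i"]
      by (simp add: lang_def graph_hw_def idx_at_eta[OF i])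
    then show "d \<in> lang H \<times> verts G"
      using graph_states_HM(1)[OF c(2)] by (simp add: c(3) reindex_config_def lang_def)
  next
    fix d assume "d \<in> lang H \<times> verts G"
    then obtain w s where d: "d = (w, s)" "w \<in> lang H" "s \<in> verts G"
      by auto
    define u where "u = (\<lambda>j\<in>{1..N}. w (idx_at H \<eta> j))"
    have "u \<in> lang (graph_hw HM)"
      using d(2) idx_at_in by (auto simp: lang_def graph_hw_def u_def)
    moreover have "reindex_config (u, state_of s) = d"
    proof -
      have "(\<lambda>i\<in>idx H. u (\<eta> i)) = w"
        using d(2) eta_in idx_at_eta
        by (intro extensionalityI[of _ "idx H"]) (auto simp: u_def lang_def PiE_def)
      then show ?thesis
        by (simp add: reindex_config_def d(1) vertex_state_of[unfolded One_nat_def])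
    qed
    ultimately show "d \<in> reindex_config ` (lang (graph_hw HM) \<times> graph_states HM)"
      using state_of_in[OF d(3)] by (intro image_eqI[of _ _ "(u, state_of s)"]) auto
  qed
qed

lemma nu_eq:
  assumes "w \<in> admissible HM"
  shows "nu H \<eta> w = reindex_config (mu HM w)"
proof -
  obtain q u where w: "w = seg q u 1 (N + 1)"
    using assms unfolding admissible_iff HM_simps by blast
  have "state_letters w = map q [1..<Suc (N + 1)]"
    using state_letters_seg[of 1 "N + 1" "[]" q u "[]"] by (simp add: w del: upt_Suc)
  then have "hd (state_letters w) = q 1"
    by (simp add: upt_conv_Cons del: upt_Suc)
  moreover have "mu HM w = (restrict u {1..N}, restrict q {1..N + 1})"
    using mu_seg[of HM q u] by (simp add: w)
  moreover have "fst (mu HM w) (\<eta> i) = blocks w ! \<eta> i" if "i \<in> idx H" for i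
    using eta_in[OF that] by (simp add: mu_def)
  ultimately show ?thesis
    by (auto simp: nu_def reindex_config_def intro!: restrict_ext)
qed

lemma nu_bij: "bij_betw (nu H \<eta>) (admissible HM) (lang H \<times> verts G)"
  using bij_betw_trans[OF mu_bij reindex_config_bij] nu_eq by (subst bij_betw_cong[where g = "reindex_config \<circ> mu HM"]) simp_all

lemma
  assumes "i \<in> idx H"
  shows gd_eta: "gd H \<eta> a (\<eta> i) = guard a i"
    and lm_eta: "lm H \<eta> a (\<eta> i) = lmul a i"
    and rm_eta: "rm H \<eta> a (\<eta> i) = rmul a i"
  using eta_in[OF assms] by (simp_all add: gd_def lm_def rm_def idx_at_eta[OF assms])

lemma accepts_edge_of:
  assumes e: "e \<in> edges G"
  shows "accepts (graph_hw HM) (act (edge_of e)) u \<longleftrightarrow> accepts H (act e) (\<lambda>i\<in>idx H. u (\<eta> i))"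
proof -
  have "accepts (graph_hw HM) (act (edge_of e)) u \<longleftrightarrow>
      (\<forall>j\<in>{1..N}. gd H \<eta> (act e) j = None \<or> gd H \<eta> (act e) j = Some (u j))"
    by (simp add: accepts_def edge_of_simps[OF e] guard_edge_rule[OF e] graph_hw_def)
  also have "{1..N} = \<eta> ` idx H"
    using \<eta> by (simp add: bij_betw_def)
  finally show ?thesis
    by (simp add: accepts_def gd_eta)
qed

text \<open>
  The two actions differ at guarded indices, where acceptance fixes the word to be \<open>g\<close>; there
  \<open>l g r g\<inverse> g\<close> and \<open>l g r\<close> have the same reduction.
\<close>

lemma transform_edge_of:
  assumes e: "e \<in> edges G" and acc: "accepts (graph_hw HM) (act (edge_of e)) u"
  shows "(\<lambda>i\<in>idx H. transform (graph_hw HM) (act (edge_of e)) u (\<eta> i)) =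
    transform H (act e) (\<lambda>i\<in>idx H. u (\<eta> i))"
  unfolding transform_def
proof (rule restrict_ext)
  fix i assume i: "i \<in> idx H"
  note j = eta_in[OF i]
  let ?a = "rule_action HM (edge_rule H \<eta> e)"
  have acc_i: "guard (act e) i = None \<or> guard (act e) i = Some (u (\<eta> i))"
    using acc i unfolding accepts_edge_of[OF e] by (auto simp: accepts_def)
  have "free_red (lmul ?a (\<eta> i) @ u (\<eta> i) @ rmul ?a (\<eta> i)) =
      free_red (lmul (act e) i @ u (\<eta> i) @ rmul (act e) i)"
  proof (cases "guard (act e) i")
    case None
    then show ?thesis
      by (simp add: lmul_edge_rule[OF e j] rmul_edge_rule[OF e j] gd_eta[OF i] lm_eta[OF i] rm_eta[OF i])
  next
    case (Some g)
    with acc_i have "u (\<eta> i) = g" by simp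
    with Some show ?thesis
      using free_red_winv_cancel_end(1)[of "lmul (act e) i @ g @ rmul (act e) i" g]
      by (simp add: lmul_edge_rule[OF e j] rmul_edge_rule[OF e j] gd_eta[OF i] lm_eta[OF i] rm_eta[OF i])
  qed
  then show "(\<lambda>i\<in>idx (graph_hw HM). free_red (lmul (act (edge_of e)) i @ u i @ rmul (act (edge_of e)) i)) (\<eta> i) =
      free_red (lmul (act e) i @ (\<lambda>i\<in>idx H. u (\<eta> i)) i @ rmul (act e) i)"
    using i j by (simp add: edge_of_simps(3)[OF e] graph_hw_def)
qed

text \<open>
  A state of the large graph is known from its first letter, and the remaining data of a step agree
  by \<open>accepts_edge_of\<close> and \<open>transform_edge_of\<close>.
\<close>

lemma edge_step_edge_of:
  assumes e: "e \<in> edges G"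
    and c: "c \<in> lang (graph_hw HM) \<times> graph_states HM" "c' \<in> lang (graph_hw HM) \<times> graph_states HM"
  shows "edge_step (graph_hw HM) (edge_of e) c c' \<longleftrightarrow> edge_step H e (reindex_config c) (reindex_config c')"
proof -
  define T where "T = (transform (graph_hw HM) (act (edge_of e)) (fst c), dst (edge_of e))"
  have src: "snd c = src (edge_of e) \<longleftrightarrow> snd (reindex_config c) = src e"
    using graph_states_HM(2)[of "snd c"] c(1) vertex_state_of
    unfolding edge_of_simps(1)[OF e] reindex_config_def snd_conv by (metis mem_Times_iff)
  have acc: "accepts (graph_hw HM) (act (edge_of e)) (fst c) \<longleftrightarrow> accepts H (act e) (fst (reindex_config c))"
    by (simp add: accepts_edge_of[OF e] reindex_config_def)
  have T: "reindex_config T = (transform H (act e) (fst (reindex_config c)), dst e)"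
    if "accepts (graph_hw HM) (act (edge_of e)) (fst c)"
    using transform_edge_of[OF e that] vertex_state_of
    unfolding T_def reindex_config_def edge_of_simps(2)[OF e] fst_conv snd_conv by (simp only:)
  have "c' = T \<longleftrightarrow> reindex_config c' = reindex_config T"
  proof
    assume "reindex_config c' = reindex_config T"
    then show "c' = T"
      using c(2) state_of_in[OF edgeD(2)[OF e]]
      by (intro reindex_config_eqD) (auto simp: T_def edge_of_simps[OF e] lang_def graph_hw_def PiE_def transform_def)
  qed simp
  then show ?thesis
    unfolding edge_step_def src acc[symmetric] T_def[symmetric] using T by metis
qed

lemma label_bij: "bij_betw label (machine_of H G \<eta>) (edges G)"
  by (rule bij_betw_byWitness[where f' = "edge_rule H \<eta>"]) (auto simp: machine_of_def)

text \<open>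
  A step of the machine is a step of its graph, along the only edge of \<open>E\<^sub>\<tau>\<close>, and that edge acts like
  \<open>e\<close>.
\<close>

lemma rule_step_edge_rule:
  assumes e: "e \<in> edges G" and w: "w \<in> admissible HM" "w' \<in> admissible HM"
  shows "rule_step (edge_rule H \<eta> e) w w' \<longleftrightarrow> edge_step H e (nu H \<eta> w) (nu H \<eta> w')"
proof -
  have mu: "mu HM w \<in> lang (graph_hw HM) \<times> graph_states HM" "mu HM w' \<in> lang (graph_hw HM) \<times> graph_states HM"
    using w bij_betwE[OF mu_bij] by blast+
  have "rule_step (edge_rule H \<eta> e) w w' \<longleftrightarrow> edge_step (graph_hw HM) (edge_of e) (mu HM w) (mu HM w')"
    using rule_step_imp_edge_step[OF hardware_HM wf_edge_rule[OF e] w(1)]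
      edge_step_imp_rule_step[OF hardware_HM wf_edge_rule[OF e] w]
    unfolding rule_edges_edge_rule[OF e] by blast
  then show ?thesis
    by (simp add: edge_step_edge_of[OF e mu] nu_eq w)
qed

lemma graph_simulates_machine_of:
  assumes comp: "sm_computation HM (machine_of H G \<eta>) ws \<tau>s"
  shows "sg_computation H G (map (nu H \<eta>) ws) (map label \<tau>s)"
proof -
  have len: "length ws = length \<tau>s + 1" and adm: "set ws \<subseteq> admissible HM"
    and \<tau>s: "set \<tau>s \<subseteq> machine_of H G \<eta>"
    and step: "\<And>i. i < length \<tau>s \<Longrightarrow> rule_step (\<tau>s ! i) (ws ! i) (ws ! (i + 1))"
    using comp by (auto simp: sm_computation_def)
  have "edge_step H (label (\<tau>s ! i)) (nu H \<eta> (ws ! i)) (nu H \<eta> (ws ! (i + 1)))" if i: "i < length \<tau>s" for i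
  proof -
    have "\<tau>s ! i \<in> machine_of H G \<eta>"
      using \<tau>s nth_mem[OF i] by blast
    then obtain e where e: "e \<in> edges G" "\<tau>s ! i = edge_rule H \<eta> e"
      by (auto simp: machine_of_def)
    have "ws ! i \<in> set ws" "ws ! (i + 1) \<in> set ws"
      using i len by simp_all
    with adm have "ws ! i \<in> admissible HM" "ws ! (i + 1) \<in> admissible HM"
      by blast+
    from rule_step_edge_rule[OF e(1) this] show ?thesis
      using step[OF i] by (simp add: e(2))
  qed
  moreover have "nu H \<eta> ` set ws \<subseteq> lang H \<times> verts G"
    using adm bij_betwE[OF nu_bij] by blast
  moreover have "label ` set \<tau>s \<subseteq> edges G"
    using \<tau>s by (auto simp: machine_of_def)
  ultimately show ?thesis
    using len by (simp add: sg_computation_def)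
qed

lemma machine_of_simulates_graph:
  assumes comp: "sg_computation H G cs es"
  shows "sm_computation HM (machine_of H G \<eta>) (map (nu_inv H G \<eta>) cs)
    (map (inv_into (machine_of H G \<eta>) label) es)"
proof -
  have len: "length cs = length es + 1" and cs: "set cs \<subseteq> lang H \<times> verts G" and es: "set es \<subseteq> edges G"
    and step: "\<And>i. i < length es \<Longrightarrow> edge_step H (es ! i) (cs ! i) (cs ! (i + 1))"
    using comp by (simp_all add: sg_computation_def)
  have inv: "inv_into (machine_of H G \<eta>) label e = edge_rule H \<eta> e" if "e \<in> edges G" for e
    using that label_bij by (intro inv_into_f_eq) (auto simp: bij_betw_def machine_of_def)
  have nu_inv: "nu_inv H G \<eta> c \<in> admissible HM" "nu H \<eta> (nu_inv H G \<eta> c) = c"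
    if "c \<in> lang H \<times> verts G" for c
    using that nu_bij inv_into_into[of c "nu H \<eta>" "admissible HM"] f_inv_into_f[of c "nu H \<eta>" "admissible HM"]
    by (simp_all add: nu_inv_def bij_betw_def)
  have "rule_step (inv_into (machine_of H G \<eta>) label (es ! i)) (nu_inv H G \<eta> (cs ! i)) (nu_inv H G \<eta> (cs ! (i + 1)))"
    if i: "i < length es" for i
  proof -
    have e: "es ! i \<in> edges G"
      using es nth_mem[OF i] by blast
    have mem: "cs ! i \<in> set cs" "cs ! (i + 1) \<in> set cs"
      using i len by simp_all
    note c = subsetD[OF cs mem(1)] subsetD[OF cs mem(2)]
    show ?thesis
      unfolding inv[OF e] rule_step_edge_rule[OF e nu_inv(1)[OF c(1)] nu_inv(1)[OF c(2)]]
        nu_inv(2)[OF c(1)] nu_inv(2)[OF c(2)]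
      by (rule step[OF i])
  qed
  moreover have "nu_inv H G \<eta> ` set cs \<subseteq> admissible HM"
    using cs nu_inv(1) by blast
  moreover have "inv_into (machine_of H G \<eta>) label ` set es \<subseteq> machine_of H G \<eta>"
    using es inv by (auto simp: machine_of_def)
  ultimately show ?thesis
    using len by (simp add: sm_computation_def)
qed

text \<open>
  The source, the target and the action of the edge of a rule depend only on its parts. They determine
  source and target of \<open>e\<close>, and its action up to \<open>same_action\<close>: multiplying \<open>l g r g\<inverse>\<close> by \<open>g\<close> recovers
  the reduction of \<open>l g r\<close>.
\<close>

lemma inj_on_parts_machine_of:
  assumes distinct: "\<forall>e\<in>edges G. \<forall>e'\<in>edges G.
    src e = src e' \<and> dst e = dst e' \<and> same_action (idx H) (act e) (act e') \<longrightarrow> e = e'"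
  shows "inj_on parts (machine_of H G \<eta>)"
proof (rule inj_onI)
  fix \<tau> \<tau>' assume "\<tau> \<in> machine_of H G \<eta>" "\<tau>' \<in> machine_of H G \<eta>" and eq: "parts \<tau> = parts \<tau>'"
  then obtain e e' where e: "e \<in> edges G" "\<tau> = edge_rule H \<eta> e" and e': "e' \<in> edges G" "\<tau>' = edge_rule H \<eta> e'"
    by (auto simp: machine_of_def)
  have act: "rule_action HM (edge_rule H \<eta> e) = rule_action HM (edge_rule H \<eta> e')"
    unfolding rule_action_def eq[unfolded e(2) e'(2)] by (rule refl)
  have "rule_state HM \<tau> f \<theta> = rule_state HM \<tau>' f \<theta>" for f \<theta>
    unfolding rule_state_def eq by (rule refl)
  then have "src (edge_of e) = src (edge_of e')" "dst (edge_of e) = dst (edge_of e')"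
    by (simp_all add: edge_of_def e(2) e'(2))
  then have "src e = src e'" "dst e = dst e'"
    using edge_of_simps(1,2) e(1) e'(1) vertex_state_of by metis+
  moreover have "same_action (idx H) (act e) (act e')"
    unfolding same_action_def
  proof
    fix i assume i: "i \<in> idx H"
    note j = eta_in[OF i]
    note eval = guard_edge_rule[OF _ j] lmul_edge_rule[OF _ j] rmul_edge_rule[OF _ j]
      gd_eta[OF i] lm_eta[OF i] rm_eta[OF i]
    have guard: "guard (act e) i = guard (act e') i"
      using arg_cong[OF act, of "\<lambda>a. guard a (\<eta> i)"] by (simp add: eval e(1) e'(1))
    show "guard (act e) i = guard (act e') i \<and> (case guard (act e) i of
        None \<Rightarrow> lmul (act e) i = lmul (act e') i \<and> rmul (act e) i = rmul (act e') i
      | Some g \<Rightarrow> free_red (lmul (act e) i @ g @ rmul (act e) i) = free_red (lmul (act e') i @ g @ rmul (act e') i))"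
    proof (cases "guard (act e) i")
      case None
      then show ?thesis
        using guard arg_cong[OF act, of "\<lambda>a. lmul a (\<eta> i)"] arg_cong[OF act, of "\<lambda>a. rmul a (\<eta> i)"]
        by (simp add: eval e(1) e'(1))
    next
      case (Some g)
      have "free_red (lmul (act e) i @ g @ rmul (act e) i @ winv g) =
          free_red (lmul (act e') i @ g @ rmul (act e') i @ winv g)"
        using Some guard arg_cong[OF act, of "\<lambda>a. lmul a (\<eta> i)"] by (simp add: eval e(1) e'(1))
      from arg_cong[OF this, of "\<lambda>x. free_red (x @ g)"] show ?thesis
        using Some guard free_red_winv_cancel_end(1)[of "lmul (act e) i @ g @ rmul (act e) i" g]
          free_red_winv_cancel_end(1)[of "lmul (act e') i @ g @ rmul (act e') i" g] by simp
    qed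
  qed
  ultimately show "\<tau> = \<tau>'"
    using distinct e e' by blast
qed

text \<open>
  The isomorphism keeps the first letter of a state, sends an edge of \<open>E\<^sub>\<tau>\<close> to the edge that labels
  \<open>\<tau>\<close>, and renumbers the indices by the inverse of \<open>\<eta>\<close>. Only the comparison of the actions depends on
  \<open>R\<close>.
\<close>

lemma sg_iso_wrt_graph_of_machine:
  assumes R: "\<And>e. e \<in> edges G \<Longrightarrow> R (act (edge_of e)) (reindex {1..N} (idx_at H \<eta>) (act e))"
  shows "sg_iso_wrt R (graph_hw HM) (graph_of HM (machine_of H G \<eta>)) H G"
  unfolding sg_iso_wrt_def
proof (intro exI conjI ballI)
  have hw: "idx (graph_hw HM) = {1..N}"
    by (simp add: graph_hw_def)
  show "bij_betw (\<lambda>s. vertex (s 1)) (verts (graph_of HM (machine_of H G \<eta>))) (verts G)"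
    using graph_states_HM state_of_in vertex_state_of
    by (intro bij_betw_byWitness[where f' = state_of]) (auto simp: graph_of_def)
  show "bij_betw (idx_at H \<eta>) (idx (graph_hw HM)) (idx H)"
    unfolding hw by (rule idx_at_bij)
  show "bij_betw (\<lambda>e. label (fst (tag e))) (edges (graph_of HM (machine_of H G \<eta>))) (edges G)"
    by (intro bij_betw_byWitness[where f' = edge_of])
       (auto simp: edges_graph_of_machine edge_of_simps)
  show "alph H (idx_at H \<eta> i) = alph (graph_hw HM) i" for i
    by (simp add: graph_hw_def)
  fix e' assume "e' \<in> edges (graph_of HM (machine_of H G \<eta>))"
  then obtain e where e: "e \<in> edges G" and e': "e' = edge_of e"
    by (auto simp: edges_graph_of_machine)
  have b: "label (fst (tag e')) = e"
    by (simp add: e' edge_of_simps[OF e])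
  show "src (label (fst (tag e'))) = vertex (src e' 1)" "dst (label (fst (tag e'))) = vertex (dst e' 1)"
    unfolding b unfolding e' edge_of_simps[OF e] vertex_state_of by (rule refl)+
  show "R (act e') (reindex (idx (graph_hw HM)) (idx_at H \<eta>) (act (label (fst (tag e')))))"
    unfolding b hw unfolding e' by (rule R[OF e])
qed

lemma reindex_simps:
  assumes "j \<in> {1..N}"
  shows "guard (reindex {Suc 0..N} (idx_at H \<eta>) a) j = gd H \<eta> a j"
    "lmul (reindex {Suc 0..N} (idx_at H \<eta>) a) j = lm H \<eta> a j"
    "rmul (reindex {Suc 0..N} (idx_at H \<eta>) a) j = rm H \<eta> a j"
  using assms by (simp_all add: reindex_def gd_def lm_def rm_def)

lemma sg_iso_graph_of_machine: "sg_iso (graph_hw HM) (graph_of HM (machine_of H G \<eta>)) H G"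
  unfolding sg_iso_def
proof (rule sg_iso_wrt_graph_of_machine)
  fix e assume e: "e \<in> edges G"
  have "free_red (l @ g @ r @ winv g @ g) = free_red (l @ g @ r)" for l g r :: "'a gword"
    using free_red_winv_cancel_end(1)[of "l @ g @ r" g] by simp
  then show "same_action (idx (graph_hw HM)) (act (edge_of e)) (reindex {1..N} (idx_at H \<eta>) (act e))"
    unfolding same_action_def
    by (auto simp: graph_hw_def reindex_simps edge_of_simps(3)[OF e] guard_edge_rule[OF e]
        lmul_edge_rule[OF e] rmul_edge_rule[OF e] split: option.split)
qed

text \<open>
  If \<open>r\<close> is empty, then \<open>l g r g\<inverse>\<close> reduces to \<open>l\<close>.
\<close>

lemma sg_iso_literal_graph_of_machine:
  assumes normal: "guard_normal H G"
  shows "sg_iso_literal (graph_hw HM) (graph_of HM (machine_of H G \<eta>)) H G"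
  unfolding sg_iso_literal_def
proof (rule sg_iso_wrt_graph_of_machine)
  fix e assume e: "e \<in> edges G"
  let ?a = "act (edge_of e)" and ?b = "reindex {1..N} (idx_at H \<eta>) (act e)"
  have "guard ?a j = guard ?b j \<and> lmul ?a j = lmul ?b j \<and> rmul ?a j = rmul ?b j" if j: "j \<in> {1..N}" for j
  proof (cases "gd H \<eta> (act e) j")
    case (Some g)
    then have "guard (act e) (idx_at H \<eta> j) \<noteq> None"
      using j by (simp add: gd_def)
    then have "rm H \<eta> (act e) j = []"
      using normal e j idx_at_in[OF j] by (auto simp: guard_normal_def rm_def)
    with Some show ?thesis
      using free_red_Free[OF action_Free(1)[OF edgeD(3)[OF e]], of j]
      by (simp add: edge_of_simps(3)[OF e] guard_edge_rule[OF e j] lmul_edge_rule[OF e j]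
          rmul_edge_rule[OF e j] reindex_simps[OF j])
  qed (simp add: edge_of_simps(3)[OF e] guard_edge_rule[OF e j] lmul_edge_rule[OF e j]
      rmul_edge_rule[OF e j] reindex_simps[OF j])
  moreover have "guard ?a \<in> extensional {1..N}" "lmul ?a \<in> extensional {1..N}" "rmul ?a \<in> extensional {1..N}"
    "guard ?b \<in> extensional {1..N}" "lmul ?b \<in> extensional {1..N}" "rmul ?b \<in> extensional {1..N}"
    by (simp_all add: edge_of_simps(3)[OF e] rule_action_eq reindex_def)
  ultimately show "?a = ?b"
    by (intro action.equality extensionalityI[of _ "{1..N}"]) simp_all
qed

end

theorem theorem3p4:
  shows
    "(\<forall>(H :: ('q, 'y) sm_hw) (S :: ('n, 'q, 'y) srule set). s_machine H S \<longrightarrow>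
        s_graph (graph_hw H) (graph_of H S) \<and>
        verts (graph_of H S) = graph_states H \<and>
        edges (graph_of H S) = (\<Union>\<tau>\<in>S. rule_edges H \<tau>) \<and>
        disjoint_family_on (rule_edges H) S \<and>
        (\<forall>ws \<tau>s. sm_computation H S ws \<tau>s \<longrightarrow>
           (\<exists>!es. sg_computation (graph_hw H) (graph_of H S) (map (mu H) ws) es \<and>
              length es = length \<tau>s \<and> (\<forall>i<length \<tau>s. es ! i \<in> rule_edges H (\<tau>s ! i)))) \<and>
        (\<forall>cs es. sg_computation (graph_hw H) (graph_of H S) cs es \<longrightarrow>
           (\<forall>e\<in>set es. \<exists>!\<tau>. \<tau> \<in> S \<and> e \<in> rule_edges H \<tau>) \<and>
           sm_computation H S (map (mu_inv H) cs)
             (map (\<lambda>e. THE \<tau>. \<tau> \<in> S \<and> e \<in> rule_edges H \<tau>) es)))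
     \<and>
     (\<forall>(H :: ('i, 'a) sg_hw) (G :: ('e, 's, 'i, 'a) graph) \<eta>.
        s_graph H G \<and> bij_betw \<eta> (idx H) {1..card (idx H)} \<longrightarrow>
        s_machine (machine_hw H G \<eta>) (machine_of H G \<eta>) \<and>
        (\<exists>\<phi>. bij_betw \<phi> (machine_of H G \<eta>) (edges G) \<and>
           (\<forall>e\<in>edges G. \<phi> (edge_rule H \<eta> e) = e) \<and>
           (\<forall>ws \<tau>s. sm_computation (machine_hw H G \<eta>) (machine_of H G \<eta>) ws \<tau>s \<longrightarrow>
              sg_computation H G (map (nu H \<eta>) ws) (map \<phi> \<tau>s)) \<and>
           (\<forall>cs es. sg_computation H G cs es \<longrightarrow>
              sm_computation (machine_hw H G \<eta>) (machine_of H G \<eta>)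
                (map (nu_inv H G \<eta>) cs) (map (inv_into (machine_of H G \<eta>) \<phi>) es))) \<and>
        ((\<forall>e\<in>edges G. \<forall>e'\<in>edges G.
            src e = src e' \<and> dst e = dst e' \<and> same_action (idx H) (act e) (act e') \<longrightarrow> e = e') \<longrightarrow>
         inj_on parts (machine_of H G \<eta>)))
     \<and>
     (\<forall>(H :: ('i, 'a) sg_hw) (G :: ('e, 's, 'i, 'a) graph) \<eta>.
        s_graph H G \<and> bij_betw \<eta> (idx H) {1..card (idx H)} \<longrightarrow>
        (let M = machine_hw H G \<eta>; G' = graph_of M (machine_of H G \<eta>) in
           sg_iso (graph_hw M) G' H G \<and>
           (guard_normal H G \<longrightarrow> sg_iso_literal (graph_hw M) G' H G)))"
proof (intro conjI allI impI)
  fix H :: "('q, 'y) sm_hw" and S :: "('n, 'q, 'y) srule set"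
  assume S: "s_machine H S"
  show "s_graph (graph_hw H) (graph_of H S)"
    by (rule s_graph_graph_of[OF S])
  show "verts (graph_of H S) = graph_states H" "edges (graph_of H S) = (\<Union>\<tau>\<in>S. rule_edges H \<tau>)"
    by (simp_all add: graph_of_def)
  show "disjoint_family_on (rule_edges H) S"
    by (rule disjoint_rule_edges)
  show "\<exists>!es. sg_computation (graph_hw H) (graph_of H S) (map (mu H) ws) es \<and>
      length es = length \<tau>s \<and> (\<forall>i<length \<tau>s. es ! i \<in> rule_edges H (\<tau>s ! i))"
    if "sm_computation H S ws \<tau>s" for ws \<tau>s
    by (rule graph_simulates_machine[OF S that])
  show "\<forall>e\<in>set es. \<exists>!\<tau>. \<tau> \<in> S \<and> e \<in> rule_edges H \<tau>"
    "sm_computation H S (map (mu_inv H) cs) (map (\<lambda>e. THE \<tau>. \<tau> \<in> S \<and> e \<in> rule_edges H \<tau>) es)"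
    if "sg_computation (graph_hw H) (graph_of H S) cs es" for cs es
    using machine_simulates_graph[OF S that] by simp_all
next
  fix H :: "('i, 'a) sg_hw" and G :: "('e, 's, 'i, 'a) graph" and \<eta>
  assume "s_graph H G \<and> bij_betw \<eta> (idx H) {1..card (idx H)}"
  then have G: "s_graph H G" and \<eta>: "bij_betw \<eta> (idx H) {1..card (idx H)}"
    by simp_all
  show "s_machine (machine_hw H G \<eta>) (machine_of H G \<eta>)"
    by (rule s_machine_machine_of[OF G \<eta>])
  show "\<exists>\<phi>. bij_betw \<phi> (machine_of H G \<eta>) (edges G) \<and> (\<forall>e\<in>edges G. \<phi> (edge_rule H \<eta> e) = e) \<and>
      (\<forall>ws \<tau>s. sm_computation (machine_hw H G \<eta>) (machine_of H G \<eta>) ws \<tau>s \<longrightarrow>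
         sg_computation H G (map (nu H \<eta>) ws) (map \<phi> \<tau>s)) \<and>
      (\<forall>cs es. sg_computation H G cs es \<longrightarrow>
         sm_computation (machine_hw H G \<eta>) (machine_of H G \<eta>)
           (map (nu_inv H G \<eta>) cs) (map (inv_into (machine_of H G \<eta>) \<phi>) es))"
    by (intro exI[of _ label] conjI ballI allI impI label_bij[OF G \<eta>] label_edge_rule
        graph_simulates_machine_of[OF G \<eta>] machine_of_simulates_graph[OF G \<eta>])
  show "inj_on parts (machine_of H G \<eta>)"
    if "\<forall>e\<in>edges G. \<forall>e'\<in>edges G.
      src e = src e' \<and> dst e = dst e' \<and> same_action (idx H) (act e) (act e') \<longrightarrow> e = e'"
    by (rule inj_on_parts_machine_of[OF G \<eta> that])
next
  fix H :: "('i, 'a) sg_hw" and G :: "('e, 's, 'i, 'a) graph" and \<eta>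
  assume "s_graph H G \<and> bij_betw \<eta> (idx H) {1..card (idx H)}"
  then have G: "s_graph H G" and \<eta>: "bij_betw \<eta> (idx H) {1..card (idx H)}"
    by simp_all
  show "let M = machine_hw H G \<eta>; G' = graph_of M (machine_of H G \<eta>) in
      sg_iso (graph_hw M) G' H G \<and> (guard_normal H G \<longrightarrow> sg_iso_literal (graph_hw M) G' H G)"
    unfolding Let_def
    using sg_iso_graph_of_machine[OF G \<eta>] sg_iso_literal_graph_of_machine[OF G \<eta>] by blast
qed

end
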